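(* Let $D\ge1$ be an odd integer. With $\mathcal E_D^-$ and $M^-_{X,X'}$ ($X,X'\in\mathcal E_D^-$) as defined in the context, the elements $$\sum_{X\in\mathcal E_D^-}M^-_{X,X'}\,X\in\mathbb Z[\mathcal E_D^-]\qquad(\text{for the various }X'\in\mathcal E_D^-)$$ form a $\mathbb Z$-basis of the free abelian group $\mathbb Z[\mathcal E_D^-]$ with basis $\mathcal E_D^-$.
   Context: Notation: $[i,j]=\{z\in\mathbb Z: i\le z\le j\}$ (empty if $i>j$); $F$ is the field with two elements; $\mathbb Z[Y]$ is the free abelian group with basis a finite set $Y$. $D\ge0$ is an integer; $N=D+1$ if $D$ is even and $N=D+2$ if $D$ is odd (so $N$ is odd). The set of all subsets of $[1,N]$ is viewed as an $F$-vector space, with sum $A+B=(A\cup B)-(A\cap B)$; $E_N$ is the subspace of subsets of even cardinality. ${}^2E_N$ is the set of $2$-element subsets of $[1,N]$. An element $\{i,j\}\in{}^2E_N$ is written $ij$ where the order is chosen so that $i<j$ if $i-j$ is odd, and $i>j$ if $i-j$ is even. For such $ij$ put $\lfloor i,j\rfloor=[i,j]$ if $i<j$ ($i-j$ odd) and $\lfloor i,j\rfloor=[i,N]\cup[1,j]$ if $i>j$ ($i-j$ even); then $\lfloor i,j\rfloor\in E_N$. $\mathcal P_N$ is the set of all (possibly empty) sets $B$ of pairwise disjoint elements of ${}^2E_N$. For $B\in\mathcal P_N$: $\mathrm{supp}(B)\subset[1,N]$ is the union of the members of $B$; $B^1$ is the set of $ij\in B$ with $i-j$ odd; $B^0$ is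 the set of $ij\in B$ with $i-j$ even (so $i>j$); if $B^0\neq\emptyset$, $i_B$ is the largest $i$ such that $ij\in B^0$ for some $j$. From now on $D$ is odd. $Pr_D\subset\mathcal P_N$ consists of $\emptyset$; of $\{\{D+1,D+2\}\}$; of $\{\{D+1,2\},\{D,3\},\dots,\{D+3-t,t\}\}$ for even $t\in[2,(D+1)/2]$; of $\{\{D,1\},\{D-1,2\},\dots,\{D+2-t,t-1\}\}$ for even $t\in[2,(D+1)/2]$; of $\{\{D+2,1\},\{D+1,2\},\dots,\{D+4-t,t-1\}\}$ for even $t\in[2,(D+3)/2]$; and of $\{\{D+1,D+2\},\{D,1\},\{D-1,2\},\dots,\{D+1-t,t\}\}$ for even $t\in[2,(D-1)/2]$. For $k\in[1,D]$ let $\iota_k:[1,N-2]\to[1,N]$, $\iota_k(i)=i$ for $i\le k-1$, $\iota_k(i)=i+2$ for $i\ge k$. Define $I_k:\mathcal P_{N-2}\to\mathcal P_N$ by $I_k(B')=\{\{\iota_k(i),\iota_k(j)\}:\{i,j\}\in B'\}\cup\{\{k,k+1\}\}$. Subset $\mathcal X_D\subset\mathcal P_N$, by induction on odd $D$: $\mathcal X_1=Pr_1\cup\{\{\{1,2\}\}\}$; for $D\ge3$, $\mathcal X_D=Pr_D\cup\bigcup_{k\in[1,D]}I_k(\mathcal X_{D-2})$. The element $u_B$. Let $B\in\mathcal X_D$ with $B^0\ne\emptyset$, $N\notin\mathrm{supp}(B)$. Then there is a unique sequence $i_1<i_2<\dots<i_{2s}$ ($s\ge1$) with $B^0=\{i_{2s}i_1,i_{2s-1}i_2,\dots,i_{s+1}i_s\}$,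 and $i_B=i_{2s}$. Let $\mathcal J=[i_{2s}+1,N-1]$ if $i_{2s}$ is odd, $\mathcal J=[1,i_1-1]$ if $i_{2s}$ is even. It is known that there is a unique sequence $a_1<b_1<a_2<b_2<\dots<a_m<b_m$ ($m\ge 0$) with all $a_rb_r\in B^1$ such that $\mathcal J$ is the disjoint union of $[a_1,b_1],\dots,[a_m,b_m]$ and of a one-element set; $u_B$ denotes the unique element of that one-element set. The map $\epsilon$. For $B\in\mathcal X_D$ define $\underline B\in E_N$: if $B^0\neq\emptyset$ and $N\notin\mathrm{supp}(B)$, then $\underline B=[u_B,N]$ when $i_B$ is odd and $\underline B=\{N\}\cup[1,u_B]$ when $i_B$ is even; otherwise $\underline B=\emptyset$. Define $\epsilon:\mathcal X_D\to E_N$ by $\epsilon(B)=\sum_{ij\in B}\lfloor i,j\rfloor+\underline B$ (sum in $E_N$). It is known that $\epsilon$ is a bijection. For $B\in\mathcal X_D$, $\langle B\rangle$ is the $F$-subspace of $E_N$ spanned by the vectors $\{i,j\}\in E_N$, $ij\in B$. $\mathcal E_D^-=\{X\in E_N:N\in X\}$. For $X,X'\in\mathcal E_D^-$: $M^-_{X,X'}=1$ if $X\in\langle\epsilon^{-1}(X')\rangle$ and $M^-_{X,X'}=0$ otherwise. *)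

theory Defs
  imports
    "HOL-Algebra.Module"
    "HOL-Algebra.Free_Abelian_Groups"
    "HOL-Number_Theory.Residues"
begin

section \<open>The vector space of even subsets of \<open>[1,N]\<close> over the field with two elements\<close>

definition N_of :: "nat \<Rightarrow> nat" where
  "N_of D = (if even D then D + 1 else D + 2)"

abbreviation F2 :: "int ring" where
  "F2 \<equiv> residue_ring 2"

text \<open>The fields \<open>mult\<close> and \<open>one\<close> are required by the record type of modules, but have no
  meaning for a module.\<close>

definition EN :: "nat \<Rightarrow> (int, nat set) module" where
  "EN N = \<lparr>carrier = {A. A \<subseteq> {1..N} \<and> even (card A)},
           monoid.mult = undefined, one = undefined,
           zero = {}, add = (\<lambda>A B. (A \<union> B) - (A \<inter> B)),
           smult = (\<lambda>c A. if c = 1 then A else {})\<rparr>"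

lemma F2_cring: "cring F2"
  by (rule residues.cring, unfold_locales) simp

lemma even_card_sym_diff:
  assumes "finite A" "finite B"
  shows "even (card ((A \<union> B) - (A \<inter> B))) \<longleftrightarrow> (even (card A) \<longleftrightarrow> even (card B))"
proof -
  have "card ((A \<union> B) - (A \<inter> B)) + card (A \<inter> B) = card (A \<union> B)"
    using assms by (subst card_Un_disjoint[symmetric]) (auto intro: arg_cong[where f = card])
  then have "card ((A \<union> B) - (A \<inter> B)) + 2 * card (A \<inter> B) = card A + card B"
    using assms card_Un_Int[of A B] by simp
  then show ?thesis
    by (metis even_add even_mult_iff even_numeral)
qed

lemma module_EN: "Module.module F2 (EN N)"
proof (rule Module.moduleI)
  show "cring F2" by (rule F2_cring)
  have fin: "A \<subseteq> {1..N} \<Longrightarrow> finite A" for A :: "nat set"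
    by (rule finite_subset) auto
  show "abelian_group (EN N)"
  proof (rule abelian_groupI)
    fix A B assume "A \<in> carrier (EN N)" "B \<in> carrier (EN N)"
    then show "A \<oplus>\<^bsub>EN N\<^esub> B \<in> carrier (EN N)"
      using even_card_sym_diff[of A B] fin by (auto simp: EN_def)
  next
    fix A assume "A \<in> carrier (EN N)"
    then show "\<exists>B\<in>carrier (EN N). B \<oplus>\<^bsub>EN N\<^esub> A = \<zero>\<^bsub>EN N\<^esub>"
      by (auto simp: EN_def)
  qed (auto simp: EN_def)
next
  have F2: "a = 0 \<or> a = 1" if "a \<in> carrier F2" for a
    using that by (auto simp: residue_ring_def)
  show "(a \<oplus>\<^bsub>F2\<^esub> b) \<odot>\<^bsub>EN N\<^esub> x = a \<odot>\<^bsub>EN N\<^esub> x \<oplus>\<^bsub>EN N\<^esub> b \<odot>\<^bsub>EN N\<^esub> x"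
    if "a \<in> carrier F2" "b \<in> carrier F2" for a b x
    using that[THEN F2] by (auto simp: EN_def residue_ring_def)
  show "(a \<otimes>\<^bsub>F2\<^esub> b) \<odot>\<^bsub>EN N\<^esub> x = a \<odot>\<^bsub>EN N\<^esub> (b \<odot>\<^bsub>EN N\<^esub> x)"
    if "a \<in> carrier F2" "b \<in> carrier F2" for a b x
    using that[THEN F2] by (auto simp: EN_def residue_ring_def)
qed (auto simp: EN_def residue_ring_def)

text \<open>The subspace spanned by \<open>S\<close>: the smallest one containing \<open>S\<close>.\<close>

definition span_EN :: "nat \<Rightarrow> nat set set \<Rightarrow> nat set set" where
  "span_EN N S = \<Inter> {W. submodule W F2 (EN N) \<and> S \<subseteq> W}"

section \<open>Pairs\<close>

text \<open>\<open>std i j\<close> says that the two-element set \<open>{i,j}\<close> is written \<open>ij\<close>, in this order. In both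
  disjuncts the subtraction on \<^typ>\<open>nat\<close> is an honest one.\<close>

definition std :: "nat \<Rightarrow> nat \<Rightarrow> bool" where
  "std i j \<longleftrightarrow> i < j \<and> odd (j - i) \<or> j < i \<and> even (i - j)"

definition floor_set :: "nat \<Rightarrow> nat \<Rightarrow> nat \<Rightarrow> nat set" where
  "floor_set N i j = (if i < j then {i..j} else {i..N} \<union> {1..j})"

definition two_subsets :: "nat \<Rightarrow> nat set set" where
  "two_subsets N = {P. P \<subseteq> {1..N} \<and> card P = 2}"

definition PN :: "nat \<Rightarrow> nat set set set" where
  "PN N = {B. B \<subseteq> two_subsets N \<and> pairwise disjnt B}"

definition oriented :: "nat set set \<Rightarrow> (nat \<times> nat) set" where
  "oriented B = {(i, j). {i, j} \<in> B \<and> std i j}"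

definition supp :: "nat set set \<Rightarrow> nat set" where
  "supp B = \<Union> B"

definition B1 :: "nat set set \<Rightarrow> nat set set" where
  "B1 B = {P \<in> B. \<exists>i j. P = {i, j} \<and> i < j \<and> odd (j - i)}"

definition B0 :: "nat set set \<Rightarrow> nat set set" where
  "B0 B = {P \<in> B. \<exists>i j. P = {i, j} \<and> j < i \<and> even (i - j)}"

definition i_of :: "nat set set \<Rightarrow> nat" where
  "i_of B = Max {i. \<exists>j. (i, j) \<in> oriented (B0 B)}"

section \<open>The set \<open>X\<^sub>D\<close> for odd \<open>D\<close>\<close>

text \<open>\<open>nest c a b\<close> is \<open>{{c-a,a}, {c-a-1,a+1}, \<dots>, {c-b,b}}\<close>.\<close>

definition nest :: "nat \<Rightarrow> nat \<Rightarrow> nat \<Rightarrow> nat set set" where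
  "nest c a b = (\<lambda>r. {c - r, r}) ` {a..b}"

definition Pr :: "nat \<Rightarrow> nat set set set" where
  "Pr D = {{}} \<union> {{{D + 1, D + 2}}}
     \<union> {nest (D + 3) 2 t | t. even t \<and> t \<in> {2..(D + 1) div 2}}
     \<union> {nest (D + 1) 1 (t - 1) | t. even t \<and> t \<in> {2..(D + 1) div 2}}
     \<union> {nest (D + 3) 1 (t - 1) | t. even t \<and> t \<in> {2..(D + 3) div 2}}
     \<union> {{{D + 1, D + 2}} \<union> nest (D + 1) 1 t | t. even t \<and> t \<in> {2..(D - 1) div 2}}"

definition iota :: "nat \<Rightarrow> nat \<Rightarrow> nat" where
  "iota k i = (if i < k then i else i + 2)"

definition I_map :: "nat \<Rightarrow> nat set set \<Rightarrow> nat set set" where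
  "I_map k B = (\<lambda>P. iota k ` P) ` B \<union> {{k, k + 1}}"

text \<open>Only the values at odd \<open>D\<close> are meaningful.\<close>

fun XD :: "nat \<Rightarrow> nat set set set" where
  "XD 0 = {}"
| "XD (Suc 0) = Pr 1 \<union> {{{1, 2}}}"
| "XD (Suc (Suc D)) = Pr (Suc (Suc D)) \<union> (\<Union>k\<in>{1..Suc (Suc D)}. I_map k ` XD D)"

lemma nest_PN:
  assumes "1 \<le> a" "2 * b < c" "c \<le> N + a"
  shows "nest c a b \<in> PN N"
proof -
  have "card {c - r, r} = 2" if "r \<in> {a..b}" for r
    using that assms by (subst card_2_iff) force
  then show ?thesis
    using assms by (auto simp: nest_def PN_def two_subsets_def pairwise_def disjnt_def)
qed

lemma Pr_PN:
  assumes "odd D"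
  shows "Pr D \<subseteq> PN (D + 2)"
proof -
  have 1: "{} \<in> PN (D + 2)" "{{D + 1, D + 2}} \<in> PN (D + 2)"
    by (auto simp: PN_def two_subsets_def)
  have 2: "{{D + 1, D + 2}} \<union> nest (D + 1) 1 t \<in> PN (D + 2)" if "t \<le> (D - 1) div 2" for t
  proof -
    have "nest (D + 1) 1 t \<in> PN (D + 2)"
      by (rule nest_PN) (use that assms in \<open>auto elim!: oddE\<close>)
    moreover have "P \<subseteq> {1..D}" if "P \<in> nest (D + 1) 1 t" for P
      using that \<open>t \<le> (D - 1) div 2\<close> by (auto simp: nest_def)
    ultimately show ?thesis
      by (fastforce simp: PN_def two_subsets_def pairwise_insert disjnt_def)
  qed
  have "nest (D + 3) 2 t \<in> PN (D + 2)" "nest (D + 1) 1 (t - 1) \<in> PN (D + 2)"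
    if "t \<le> (D + 1) div 2" "2 \<le> t" for t
    by (rule nest_PN; use that assms in \<open>auto elim!: oddE\<close>)+
  moreover have "nest (D + 3) 1 (t - 1) \<in> PN (D + 2)"
    if "t \<le> (D + 3) div 2" "2 \<le> t" for t
    by (rule nest_PN; use that assms in \<open>auto elim!: oddE\<close>)
  ultimately show ?thesis
    unfolding Pr_def using 1 2 by auto
qed

lemma inj_iota: "inj (iota k)"
  by (auto simp: inj_def iota_def split: if_splits)

lemma I_map_PN:
  assumes "B \<in> PN N" "k \<in> {1..N}"
  shows "I_map k B \<in> PN (N + 2)"
proof -
  have card: "card (iota k ` P) = card P" for P
    by (meson card_image inj_iota inj_on_subset subset_UNIV)
  have sub: "iota k ` P \<subseteq> {1..N + 2}" if "P \<subseteq> {1..N}" for P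
  proof
    fix x assume "x \<in> iota k ` P"
    then obtain y where "y \<in> {1..N}" "x = iota k y"
      using \<open>P \<subseteq> {1..N}\<close> by blast
    then show "x \<in> {1..N + 2}"
      by (simp add: iota_def)
  qed
  have "iota k ` P \<in> two_subsets (N + 2)" if "P \<in> B" for P
  proof -
    have "P \<subseteq> {1..N}" "card P = 2"
      using that assms(1) unfolding PN_def two_subsets_def by blast+
    then show ?thesis
      using sub card unfolding two_subsets_def by simp
  qed
  moreover have "{k, k + 1} \<in> two_subsets (N + 2)"
    using assms by (auto simp: two_subsets_def)
  ultimately have "I_map k B \<subseteq> two_subsets (N + 2)"
    unfolding I_map_def by blast
  moreover have "disjnt (iota k ` P) (iota k ` Q)" if "disjnt P Q" for P Q
    using that inj_iota[of k] by (simp add: disjnt_def image_Int[symmetric])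
  then have "pairwise disjnt ((\<lambda>P. iota k ` P) ` B)"
    using assms(1) unfolding PN_def pairwise_def by blast
  moreover have "disjnt (iota k ` P) {k, k + 1}" for P
    by (auto simp: disjnt_def iota_def split: if_splits)
  ultimately show ?thesis
    unfolding I_map_def PN_def by (auto simp: pairwise_insert disjnt_sym)
qed

lemma XD_PN: "odd D \<Longrightarrow> XD D \<subseteq> PN (N_of D)"
proof (induction D rule: XD.induct)
  case 2
  have "{{1, 2}} \<in> PN 3"
    by (auto simp: PN_def two_subsets_def)
  then show ?case
    using Pr_PN[of 1] by (auto simp: N_of_def numeral_3_eq_3)
next
  case (3 D)
  then have "I_map k B \<in> PN (D + 2 + 2)" if "B \<in> XD D" "k \<in> {1..D + 2}" for k B
    using that I_map_PN[of B "D + 2" k] by (auto simp: N_of_def)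
  then show ?case
    using 3 Pr_PN[of "D + 2"] by (auto simp: N_of_def)
qed simp

section \<open>The map \<open>\<epsilon>\<close>\<close>

text \<open>\<open>xs\<close> is the sequence \<open>i\<^sub>1 < \<dots> < i\<^sub>2\<^sub>s\<close> attached to the set \<open>C = B\<^sup>0\<close>.\<close>

definition nested_seq :: "nat set set \<Rightarrow> nat list \<Rightarrow> bool" where
  "nested_seq C xs \<longleftrightarrow> sorted_wrt (<) xs \<and>
     (\<exists>s\<ge>1. length xs = 2 * s \<and> C = {{xs ! (2 * s - 1 - r), xs ! r} | r. r < s})"

definition J_set :: "nat \<Rightarrow> nat list \<Rightarrow> nat set" where
  "J_set N xs = (if odd (last xs) then {last xs + 1..N - 1} else {1..hd xs - 1})"

text \<open>\<open>ps\<close> lists the pairs \<open>(a\<^sub>r, b\<^sub>r)\<close>; the ordering condition makes the intervals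
  disjoint from each other.\<close>

definition is_u :: "nat \<Rightarrow> nat set set \<Rightarrow> nat \<Rightarrow> bool" where
  "is_u N B u \<longleftrightarrow> (\<exists>xs ps. nested_seq (B0 B) xs \<and>
     sorted_wrt (<) (concat (map (\<lambda>(a, b). [a, b]) ps)) \<and>
     (\<forall>(a, b) \<in> set ps. {a, b} \<in> B1 B) \<and>
     J_set N xs = (\<Union>(a, b) \<in> set ps. {a..b}) \<union> {u} \<and>
     u \<notin> (\<Union>(a, b) \<in> set ps. {a..b}))"

definition u_of :: "nat \<Rightarrow> nat set set \<Rightarrow> nat" where
  "u_of N B = (THE u. is_u N B u)"

definition under :: "nat \<Rightarrow> nat set set \<Rightarrow> nat set" where
  "under N B = (if B0 B \<noteq> {} \<and> N \<notin> supp B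
     then (if odd (i_of B) then {u_of N B..N} else {N} \<union> {1..u_of N B})
     else {})"

definition eps :: "nat \<Rightarrow> nat set set \<Rightarrow> nat set" where
  "eps D B = (let N = N_of D in
     (\<Oplus>\<^bsub>EN N\<^esub> p \<in> oriented B. floor_set N (fst p) (snd p)) \<oplus>\<^bsub>EN N\<^esub> under N B)"

section \<open>The matrix \<open>M\<^sup>-\<close>\<close>

text \<open>The elements of \<open>B\<close>, being two-element subsets of \<open>[1,N]\<close>, are themselves vectors.\<close>

definition bracket :: "nat \<Rightarrow> nat set set \<Rightarrow> nat set set" where
  "bracket D B = span_EN (N_of D) B"

definition Eminus :: "nat \<Rightarrow> nat set set" where
  "Eminus D = {X \<in> carrier (EN (N_of D)). N_of D \<in> X}"

definition Mminus :: "nat \<Rightarrow> nat set \<Rightarrow> nat set \<Rightarrow> int" where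
  "Mminus D X X' = (if X \<in> bracket D (the_inv_into (XD D) (eps D) X') then 1 else 0)"

definition Mcolumn :: "nat \<Rightarrow> nat set \<Rightarrow> (nat set \<Rightarrow>\<^sub>0 int)" where
  "Mcolumn D X' = (\<Sum>X\<in>Eminus D. frag_cmul (Mminus D X X') (frag_of X))"

text \<open>Formal integer combinations as a \<open>\<int>\<close>-module, for linear independence and span.\<close>

global_interpretation frag: Modules.module frag_cmul
  by unfold_locales (simp_all add: frag_cmul_distrib frag_cmul_distrib2)

end

theory Submission
  imports Defs
begin

text \<open>
  Place \<open>1, \<dots>, N\<close> on a circle, where \<open>N = D + 2\<close>, and think of a pair \<open>ij\<close> as the arc \<open>\<lfloor>i,j\<rfloor>\<close>, which
  contains an even number of points. Only those \<open>B \<in> X\<^sub>D\<close> with \<open>N \<in> supp(B)\<close> (the set \<open>Xminus D\<close>) matter: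
  they correspond under \<open>\<epsilon>\<close> to the vectors containing \<open>N\<close>, and the column of such a \<open>B\<close> is the sum of
  the vectors of \<open>\<langle>B\<rangle>\<close> that contain \<open>N\<close>. Each member of \<open>Xminus D\<close> arises by inserting adjacent pairs into
  an initial one, and the initial ones are nests of an odd number of arcs around the edge from \<open>N\<close> to \<open>1\<close>
  (\<open>prim1\<close>) or around the edge from \<open>N - 1\<close> to \<open>N\<close> (\<open>prim2\<close>). The proof has two independent halves.

  The columns span (\<open>columns_span\<close>). By induction every vector for \<open>D - 2\<close> is a combination of columns,
  so inserting the pair \<open>{k, k + 1}\<close> gives, modulo the columns for \<open>D\<close>, the relation
  \<open>X + (X \<union> {k, k + 1}) = 0\<close> whenever \<open>k, k + 1 \<notin> X\<close> (\<open>I_map_relation\<close>). Up to sign these relations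
  identify two vectors as soon as they have the same charge, the number of odd elements minus the number of
  even ones (\<open>charge_determines\<close>). Finally the columns of the initial members, taken in the order \<open>prim2\<close> with
  \<open>m = 0\<close>, \<open>prim1\<close> with \<open>m = 1\<close>, \<open>prim2\<close> with \<open>m = 1\<close>, \<open>\<dots>\<close>, each involve exactly one vector of a new charge,
  and so remove the charges \<open>0, 2, -2, 4, -4, \<dots>\<close> one after the other.

  The map \<open>\<epsilon>\<close> is injective on \<open>Xminus D\<close> (\<open>odd_depth_injective\<close>). Here \<open>\<epsilon>(B)\<close> is the set of points that lie in
  an odd number of arcs. If \<open>k\<close> and \<open>k + 1\<close> have depths of equal parity, the two points can be deleted from
  \<open>B\<close>, possibly joining two arcs into one, without changing any other depth parity; and the parity in the gap
  before \<open>k\<close> shows whether \<open>{k, k + 1}\<close> was a pair of \<open>B\<close> (\<open>contraction\<close>). Hence a member that shares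
  its image with \<open>I\<^sub>k(B')\<close> contracts, by induction, to \<open>B'\<close>, and so is \<open>I\<^sub>k(B')\<close>.

  Injectivity bounds the number of columns by the rank, and a spanning family with no more elements than
  the rank is a basis (\<open>spanning_family_is_basis\<close>); it also follows that \<open>\<epsilon>\<close> is onto. It remains to see that
  no \<open>B\<close> avoiding \<open>N\<close> has an image containing \<open>N\<close> (\<open>top_parity\<close>), which is where the correction term of
  \<open>\<epsilon>\<close> enters.
\<close>

section \<open>Spanning families that are as small as possible\<close>

lemma frag_keys_expansion:
  assumes "finite E" "Poly_Mapping.keys c \<subseteq> E"
  shows "c = (\<Sum>x\<in>E. frag_cmul (Poly_Mapping.lookup c x) (frag_of x))"
proof (rule poly_mapping_eqI)
  fix y
  have "Poly_Mapping.lookup (\<Sum>x\<in>E. frag_cmul (Poly_Mapping.lookup c x) (frag_of x)) y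
      = (\<Sum>x\<in>E. if x = y then Poly_Mapping.lookup c x else 0)"
    by (auto simp: lookup_sum intro!: sum.cong)
  then show "Poly_Mapping.lookup c y
      = Poly_Mapping.lookup (\<Sum>x\<in>E. frag_cmul (Poly_Mapping.lookup c x) (frag_of x)) y"
    using assms by (auto simp: in_keys_iff)
qed

text \<open>Modulo 2 the linear combinations define a map from the subsets of \<open>I\<close> to the subsets of \<open>E\<close>. It is onto,
  hence a bijection since \<open>card I \<le> card E\<close>; so a relation between the \<open>f i\<close> has even coefficients only.\<close>

lemma spanning_family_is_basis:
  fixes f :: "'i \<Rightarrow> 'a \<Rightarrow>\<^sub>0 int"
  assumes finI: "finite I" and finE: "finite E" and card: "card I \<le> card E"
    and spans: "frag_of ` E \<subseteq> frag.span (f ` I)"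
  shows "card I = card E" "inj_on f I" "frag.independent (f ` I)"
proof -
  define T where "T c = (\<Sum>i\<in>I. frag_cmul (c i) (f i))" for c :: "'i \<Rightarrow> int"
  define par where "par c = {i\<in>I. odd (c i)}" for c :: "'i \<Rightarrow> int"
  define \<Phi> where
    "\<Phi> S = {y\<in>E. odd (Poly_Mapping.lookup (T (\<lambda>i. if i \<in> S then 1 else 0)) y)}" for S
  have lookup_T: "Poly_Mapping.lookup (T c) y = (\<Sum>i\<in>I. c i * Poly_Mapping.lookup (f i) y)" for c y
    by (simp add: T_def lookup_sum)
  have par: "{y\<in>E. odd (Poly_Mapping.lookup (T c) y)} = \<Phi> (par c)" for c
  proof -
    have "even (\<Sum>i\<in>I. (c i - (if i \<in> par c then 1 else 0)) * Poly_Mapping.lookup (f i) y)" for y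
      by (rule dvd_sum) (auto simp: par_def)
    then have "even (Poly_Mapping.lookup (T c) y
        - Poly_Mapping.lookup (T (\<lambda>i. if i \<in> par c then 1 else 0)) y)" for y
      unfolding lookup_T by (simp add: sum_subtractf[symmetric] left_diff_distrib)
    then show ?thesis
      unfolding \<Phi>_def by auto
  qed
  have span_T: "frag.span (f ` I) \<subseteq> range T"
  proof (rule frag.span_minimal)
    show "f ` I \<subseteq> range T"
    proof
      fix v assume "v \<in> f ` I"
      then obtain j where j: "j \<in> I" "v = f j" by blast
      have "T (\<lambda>i. if i = j then 1 else 0) = (\<Sum>i\<in>I. if i = j then f i else 0)"
        unfolding T_def by (rule sum.cong) auto
      then have "T (\<lambda>i. if i = j then 1 else 0) = v"
        using j finI by simp
      then show "v \<in> range T" by blast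
    qed
    have "T (\<lambda>_. 0) = 0" "T c + T d = T (\<lambda>i. c i + d i)" "frag_cmul a (T c) = T (\<lambda>i. a * c i)"
      for c d a
      by (simp_all add: T_def frag_cmul_distrib sum.distrib frag_cmul_sum)
    then show "frag.subspace (range T)"
      unfolding frag.subspace_def by (metis (no_types, lifting) rangeE rangeI)
  qed
  have "\<Phi> ` Pow I = Pow E"
  proof (intro equalityI subsetI)
    fix Y assume "Y \<in> Pow E"
    then have "Y \<subseteq> E" by simp
    have "(\<Sum>y\<in>Y. frag_of y) \<in> frag.span (f ` I)"
      using \<open>Y \<subseteq> E\<close> spans by (intro frag.span_sum) blast
    then obtain c where c: "T c = (\<Sum>y\<in>Y. frag_of y)"
      using span_T by fastforce
    have "finite Y" using \<open>Y \<subseteq> E\<close> finE finite_subset by blast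
    then have "Poly_Mapping.lookup (T c) y = (if y \<in> Y then 1 else 0)" for y
      by (simp add: c lookup_sum)
    then have "\<Phi> (par c) = Y"
      using \<open>Y \<subseteq> E\<close> unfolding par[symmetric] by auto
    then show "Y \<in> \<Phi> ` Pow I"
      by (auto simp: par_def)
  qed (auto simp: \<Phi>_def)
  moreover have "card (Pow I) \<le> card (Pow E)"
    using card by (simp add: card_Pow finI finE)
  ultimately have "inj_on \<Phi> (Pow I)" and card_Pow_eq: "card (Pow I) = card (Pow E)"
    using finI finE
    by (metis card_image_le eq_card_imp_inj_on finite_Pow_iff le_antisym)+
  from card_Pow_eq show "card I = card E"
    by (simp add: card_Pow finI finE)
  \<comment> \<open>Modulo 2 a relation has no nonzero coefficient, so it may be divided by 2 forever.\<close>
  have T_eq_0: "\<forall>i\<in>I. c i = 0" if "T c = 0" for c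
    using that
  proof (induction "\<Sum>i\<in>I. nat \<bar>c i\<bar>" arbitrary: c rule: less_induct)
    case less
    have "\<Phi> (par c) = {}"
      unfolding par[of c, symmetric] using less.prems by simp
    moreover have "\<Phi> {} = {}"
      by (simp add: \<Phi>_def T_def)
    moreover have "par c \<in> Pow I" "{} \<in> Pow I"
      by (auto simp: par_def)
    ultimately have "par c = {}"
      using \<open>inj_on \<Phi> (Pow I)\<close> by (metis inj_onD)
    then have even: "2 * (c i div 2) = c i" if "i \<in> I" for i
      using that by (auto simp: par_def)
    have "frag_cmul 2 (T (\<lambda>i. c i div 2)) = T c"
      unfolding T_def frag_cmul_sum by (rule sum.cong) (auto simp: even)
    then have half: "T (\<lambda>i. c i div 2) = 0"
      using less.prems by (simp add: poly_mapping_eq_iff fun_eq_iff)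
    show ?case
    proof (rule ccontr)
      assume "\<not> ?case"
      then obtain j where j: "j \<in> I" "c j \<noteq> 0" by blast
      have "(\<Sum>i\<in>I. nat \<bar>c i div 2\<bar>) < (\<Sum>i\<in>I. nat \<bar>c i\<bar>)"
      proof (rule sum_strict_mono_ex1[OF finI])
        show "\<forall>i\<in>I. nat \<bar>c i div 2\<bar> \<le> nat \<bar>c i\<bar>"
          using even by (smt (verit) nat_mono)
        show "\<exists>i\<in>I. nat \<bar>c i div 2\<bar> < nat \<bar>c i\<bar>"
          using j even[of j] by (intro bexI[of _ j]) auto
      qed
      from less.hyps[OF this half] j even[of j] show False by simp
    qed
  qed
  show inj: "inj_on f I"
  proof (rule inj_onI, rule ccontr)
    fix i j assume ij: "i \<in> I" "j \<in> I" "f i = f j" "i \<noteq> j"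
    define c where "c k = (if k = i then 1 else if k = j then -1 else 0 :: int)" for k
    have "T c = (\<Sum>k\<in>I. (if k = i then f i else 0) - (if k = j then f i else 0))"
      unfolding T_def by (rule sum.cong) (use ij in \<open>auto simp: c_def\<close>)
    also have "\<dots> = 0"
      using ij finI by (simp add: sum_subtractf)
    finally have "c i = 0"
      using T_eq_0 ij by blast
    then show False by (simp add: c_def)
  qed
  show "frag.independent (f ` I)"
    unfolding frag.independent_explicit_module
  proof (intro allI impI)
    fix t u v
    assume t: "finite t" "t \<subseteq> f ` I" "(\<Sum>v\<in>t. frag_cmul (u v) v) = 0" "v \<in> t"
    obtain S where S: "S \<subseteq> I" "t = f ` S"
      using t(2) by (meson subset_imageE)
    have "T (\<lambda>i. if i \<in> S then u (f i) else 0) = (\<Sum>i\<in>S. frag_cmul (u (f i)) (f i))"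
      unfolding T_def using S finI by (intro sum.mono_neutral_cong_right) auto
    also have "\<dots> = 0"
      using t(3) unfolding S by (subst (asm) sum.reindex) (use inj S inj_on_subset in auto)
    finally show "u v = 0"
      using T_eq_0 t(4) S by fastforce
  qed
qed

section \<open>The space of even subsets\<close>

lemma EN_simps:
  "carrier (EN N) = {A. A \<subseteq> {1..N} \<and> even (card A)}" "\<zero>\<^bsub>EN N\<^esub> = {}"
  "A \<oplus>\<^bsub>EN N\<^esub> B = (A \<union> B) - (A \<inter> B)" "c \<odot>\<^bsub>EN N\<^esub> A = (if c = 1 then A else {})"
  by (auto simp: EN_def)

lemma EN_minus: "A \<in> carrier (EN N) \<Longrightarrow> \<ominus>\<^bsub>EN N\<^esub> A = A"
proof -
  interpret Module.module F2 "EN N" by (rule module_EN)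
  assume "A \<in> carrier (EN N)"
  then show ?thesis
    by (intro minus_equality) (auto simp: EN_simps)
qed

lemma mem_finsum_EN:
  assumes "finite S" "\<And>p. p \<in> S \<Longrightarrow> f p \<in> carrier (EN N)"
  shows "x \<in> (\<Oplus>\<^bsub>EN N\<^esub> p \<in> S. f p) \<longleftrightarrow> odd (card {p\<in>S. x \<in> f p})"
  using assms
proof (induction S rule: finite_induct)
  case empty
  interpret Module.module F2 "EN N" by (rule module_EN)
  show ?case by (simp add: EN_simps)
next
  case (insert p S)
  interpret Module.module F2 "EN N" by (rule module_EN)
  have "{q \<in> insert p S. x \<in> f q} = (if x \<in> f p then insert p {q\<in>S. x \<in> f q} else {q\<in>S. x \<in> f q})"
    by auto
  moreover have "(\<Oplus>\<^bsub>EN N\<^esub> q \<in> insert p S. f q) = f p \<oplus>\<^bsub>EN N\<^esub> (\<Oplus>\<^bsub>EN N\<^esub> q \<in> S. f q)"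
    using insert by (intro finsum_insert) auto
  ultimately show ?case
    using insert by (simp add: EN_simps)
qed

lemma finsum_EN_closed:
  assumes "\<And>p. p \<in> S \<Longrightarrow> f p \<in> carrier (EN N)"
  shows "(\<Oplus>\<^bsub>EN N\<^esub> p \<in> S. f p) \<in> carrier (EN N)"
proof -
  interpret Module.module F2 "EN N" by (rule module_EN)
  show ?thesis using assms by (intro finsum_closed) auto
qed

lemma finite_PN: "B \<in> PN N \<Longrightarrow> finite B"
  unfolding PN_def two_subsets_def by (rule finite_subset[of B "Pow {1..N}"]) blast+

lemma PN_disjnt: "\<lbrakk>B \<in> PN N; P \<in> B; Q \<in> B; x \<in> P; x \<in> Q\<rbrakk> \<Longrightarrow> P = Q"
  unfolding PN_def pairwise_def disjnt_def by blast

lemma PN_subset: "\<lbrakk>B \<in> PN N; P \<in> B\<rbrakk> \<Longrightarrow> P \<subseteq> {1..N} \<and> card P = 2"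
  unfolding PN_def two_subsets_def by blast

definition unions :: "nat set set \<Rightarrow> nat set set" where
  "unions B = Union ` Pow B"

text \<open>Over two elements a linear combination is a choice of a subfamily, and sums of disjoint sets are
  unions.\<close>

lemma span_EN_eq_unions:
  assumes B: "B \<in> PN N"
  shows "span_EN N B = unions B"
proof -
  interpret Module.module F2 "EN N" by (rule module_EN)
  have fin: "finite P" if "P \<in> B" for P
    using PN_subset[OF B that] finite_subset by blast
  have carr: "\<Union> S \<in> carrier (EN N)" if "S \<subseteq> B" for S
  proof -
    have "finite S" using that finite_PN[OF B] finite_subset by blast
    have "card (\<Union> S) = sum card S"
      by (rule card_Union_disjoint)
        (use that fin B in \<open>auto simp: PN_def intro: pairwise_subset\<close>)
    also have "\<dots> = (\<Sum>P\<in>S. 2)"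
      by (rule sum.cong) (use that PN_subset[OF B] in auto)
    finally have "card (\<Union> S) = 2 * card S" by simp
    then show ?thesis
      using that PN_subset[OF B] by (auto simp: EN_simps)
  qed
  have add: "\<Union> S \<oplus>\<^bsub>EN N\<^esub> \<Union> T = \<Union> ((S - T) \<union> (T - S))" if "S \<subseteq> B" "T \<subseteq> B" for S T
    using that PN_disjnt[OF B] by (auto simp: EN_simps) blast+
  have sub: "submodule (unions B) F2 (EN N)"
  proof (rule submoduleI)
    show "\<zero>\<^bsub>EN N\<^esub> \<in> unions B" by (auto simp: unions_def EN_simps)
    show "a \<oplus>\<^bsub>EN N\<^esub> b \<in> unions B" if "a \<in> unions B" "b \<in> unions B" for a b
    proof -
      obtain S T where "S \<subseteq> B" "T \<subseteq> B" "a = \<Union> S" "b = \<Union> T"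
        using \<open>a \<in> unions B\<close> \<open>b \<in> unions B\<close> unfolding unions_def by blast
      then show ?thesis
        using add[of S T] unfolding unions_def by (metis Diff_subset PowI Un_least imageI order_trans)
    qed
    show "\<ominus>\<^bsub>EN N\<^esub> a \<in> unions B" if "a \<in> unions B" for a
      using that carr EN_minus by (auto simp: unions_def)
    show "a \<odot>\<^bsub>EN N\<^esub> x \<in> unions B" if "x \<in> unions B" for a x
      using that by (auto simp: EN_simps unions_def)
  qed (use carr in \<open>auto simp: unions_def\<close>)
  have "unions B \<subseteq> W" if W: "submodule W F2 (EN N)" "B \<subseteq> W" for W
  proof -
    have "\<Union> S \<in> W" if "finite S" "S \<subseteq> B" for S
      using that
    proof (induction S rule: finite_induct)
      case empty
      then show ?case
        using submoduleE(2)[OF W(1)] W(1)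
        by (metis EN_simps(2) Union_empty additive_subgroup.zero_closed additive_subgroup.intro submodule.axioms(1))
    next
      case (insert P S)
      have "\<Union> {P} \<oplus>\<^bsub>EN N\<^esub> \<Union> S = \<Union> (insert P S)"
        using add[of "{P}" S] insert by (simp add: insert_Diff_if)
      moreover have "P \<oplus>\<^bsub>EN N\<^esub> \<Union> S \<in> W"
        using insert W submoduleE(5)[OF W(1)] by blast
      ultimately show ?case by simp
    qed
    then show ?thesis
      using finite_PN[OF B] finite_subset by (auto simp: unions_def)
  qed
  moreover have "B \<subseteq> unions B"
    unfolding unions_def by (auto intro: image_eqI[of _ _ "{_}"])
  ultimately show ?thesis
    using sub unfolding span_EN_def by blast
qed

lemma unions_carrier:
  assumes "B \<in> PN N"
  shows "unions B \<subseteq> carrier (EN N)"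
proof -
  interpret Module.module F2 "EN N" by (rule module_EN)
  have "B \<subseteq> carrier (EN N)"
    using PN_subset[OF assms] by (auto simp: EN_simps)
  then show ?thesis
    using carrier_is_submodule unfolding span_EN_eq_unions[OF assms, symmetric] span_EN_def by blast
qed

lemma unions_insert: "unions (insert P B) = unions B \<union> (\<union>) P ` unions B"
  by (auto simp: unions_def Pow_insert image_image image_Un)

lemma unions_image: "unions ((`) f ` B) = (`) f ` unions B"
proof
  show "unions ((`) f ` B) \<subseteq> (`) f ` unions B"
  proof
    fix X assume "X \<in> unions ((`) f ` B)"
    then obtain S where "S \<subseteq> B" "X = \<Union> ((`) f ` S)"
      unfolding unions_def by (auto simp: subset_image_iff)
    then have "X = f ` \<Union> S" "\<Union> S \<in> unions B"
      by (auto simp: unions_def)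
    then show "X \<in> (`) f ` unions B" by blast
  qed
  show "(`) f ` unions B \<subseteq> unions ((`) f ` B)"
  proof
    fix X assume "X \<in> (`) f ` unions B"
    then obtain S where "S \<subseteq> B" "X = f ` \<Union> S"
      unfolding unions_def by auto
    then have "X = \<Union> ((`) f ` S)" "(`) f ` S \<in> Pow ((`) f ` B)"
      by auto
    then show "X \<in> unions ((`) f ` B)"
      unfolding unions_def by blast
  qed
qed

text \<open>Inserting the pair \<open>{k, k + 1}\<close> doubles the spanned subspace: each vector of the old one,
  moved apart, occurs with and without the new pair.\<close>

lemma unions_I_map:
  "unions (I_map k B) = (`) (iota k) ` unions B \<union> (\<lambda>X. iota k ` X \<union> {k, k + 1}) ` unions B"
  unfolding I_map_def Un_insert_right sup_bot_right unions_insert unions_image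
  by (auto simp: image_image Un_commute)

section \<open>The members of \<open>X\<^sub>D\<close> that meet \<open>N\<close>\<close>

text \<open>The number of arcs is odd in both families. In \<open>prim2\<close> the innermost arc is \<open>{D + 1, D + 2}\<close>, the only
  one that does not pass from \<open>D + 2\<close> to \<open>1\<close>; it is the only arc if \<open>m = 0\<close>.\<close>

definition prim1 :: "nat \<Rightarrow> nat \<Rightarrow> nat set set" where
  "prim1 D m = nest (D + 3) 1 (2 * m - 1)"

definition prim2 :: "nat \<Rightarrow> nat \<Rightarrow> nat set set" where
  "prim2 D m = insert {D + 1, D + 2} (nest (D + 1) 1 (2 * m))"

definition Xminus :: "nat \<Rightarrow> nat set set set" where
  "Xminus D = {B \<in> XD D. D + 2 \<in> supp B}"

lemma supp_nest: "supp (nest c a b) = {a..b} \<union> (\<lambda>r. c - r) ` {a..b}"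
  by (auto simp: supp_def nest_def)

lemma supp_I_map: "supp (I_map k B) = iota k ` supp B \<union> {k, k + 1}"
  by (auto simp: supp_def I_map_def)

text \<open>No pair is inserted behind the last point, which therefore stays the last one.\<close>

lemma I_map_top: "k \<in> {1..D} \<Longrightarrow> D + 2 \<in> supp (I_map k B) \<longleftrightarrow> D \<in> supp B"
  unfolding supp_I_map by (force simp: iota_def split: if_splits)

lemma XD_step: "3 \<le> D \<Longrightarrow> XD D = Pr D \<union> (\<Union>k\<in>{1..D}. I_map k ` XD (D - 2))"
proof -
  assume "3 \<le> D"
  then have "D = Suc (Suc (D - 2))" by simp
  then show ?thesis using XD.simps(3)[of "D - 2"] by simp
qed

lemma Pr_top:
  assumes D: "odd D"
  shows "{B \<in> Pr D. D + 2 \<in> supp B}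
    = {prim1 D m | m. 1 \<le> m \<and> 2 * m \<le> (D + 3) div 2} \<union> {prim2 D m | m. 2 * m \<le> (D - 1) div 2}"
    (is "?L = ?R")
proof
  have D1: "1 \<le> D" using D by (auto elim: oddE)
  show "?L \<subseteq> ?R"
  proof
    fix B assume B: "B \<in> ?L"
    then have top: "D + 2 \<in> supp B" by simp
    have "(\<exists>t. even t \<and> t \<in> {2..(D + 3) div 2} \<and> B = nest (D + 3) 1 (t - 1)) \<or>
       (\<exists>t. even t \<and> t \<le> (D - 1) div 2 \<and> B = insert {D + 1, D + 2} (nest (D + 1) 1 t))"
    proof -
      have no: "D + 2 \<notin> supp {}" "\<And>t. t \<le> (D + 1) div 2 \<Longrightarrow> D + 2 \<notin> supp (nest (D + 3) 2 t)"
        "\<And>t. t \<le> (D + 1) div 2 \<Longrightarrow> D + 2 \<notin> supp (nest (D + 1) 1 (t - 1))"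
        using D1 by (auto simp: supp_nest) (auto simp: supp_def)
      have "B \<noteq> {}"
        and "\<And>t. t \<in> {2..(D + 1) div 2} \<Longrightarrow> B \<noteq> nest (D + 3) 2 t"
        and "\<And>t. t \<in> {2..(D + 1) div 2} \<Longrightarrow> B \<noteq> nest (D + 1) 1 (t - 1)"
        using no top by auto
      then consider "B = {{D + 1, D + 2}}"
        | t where "even t" "t \<in> {2..(D + 3) div 2}" "B = nest (D + 3) 1 (t - 1)"
        | t where "even t" "t \<in> {2..(D - 1) div 2}" "B = {{D + 1, D + 2}} \<union> nest (D + 1) 1 t"
        using B unfolding Pr_def by blast
      then show ?thesis
      proof cases
        case 1
        then have "B = insert {D + 1, D + 2} (nest (D + 1) 1 0)"
          by (simp add: nest_def)
        then show ?thesis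
          by (intro disjI2 exI[of _ 0]) simp
      qed auto
    qed
    then show "B \<in> ?R"
    proof (elim disjE exE conjE)
      fix t assume "even t" "t \<in> {2..(D + 3) div 2}" "B = nest (D + 3) 1 (t - 1)"
      then have "B = prim1 D (t div 2)" "1 \<le> t div 2" "2 * (t div 2) \<le> (D + 3) div 2"
        by (auto simp: prim1_def)
      then show ?thesis by blast
    next
      fix t assume "even t" "t \<le> (D - 1) div 2" "B = insert {D + 1, D + 2} (nest (D + 1) 1 t)"
      then have "B = prim2 D (t div 2)" "2 * (t div 2) \<le> (D - 1) div 2"
        by (auto simp: prim2_def)
      then show ?thesis by blast
    qed
  qed
  show "?R \<subseteq> ?L"
  proof
    fix B assume "B \<in> ?R"
    then consider m where "1 \<le> m" "2 * m \<le> (D + 3) div 2" "B = prim1 D m"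
      | m where "2 * m \<le> (D - 1) div 2" "B = prim2 D m" by blast
    then show "B \<in> ?L"
    proof cases
      case 1
      then have "B \<in> {nest (D + 3) 1 (t - 1) | t. even t \<and> t \<in> {2..(D + 3) div 2}}"
        by (auto simp: prim1_def intro!: exI[of _ "2 * m"])
      then show ?thesis
        using 1 by (auto simp: Pr_def prim1_def supp_nest intro!: image_eqI[of _ _ 1])
    next
      case 2
      have "B \<in> Pr D"
      proof (cases "m = 0")
        case True
        then show ?thesis by (simp add: 2 prim2_def Pr_def nest_def)
      next
        case False
        then have "B \<in> {{{D + 1, D + 2}} \<union> nest (D + 1) 1 t | t. even t \<and> t \<in> {2..(D - 1) div 2}}"
          using 2 by (auto simp: prim2_def intro!: exI[of _ "2 * m"])
        then show ?thesis unfolding Pr_def by blast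
      qed
      then show ?thesis by (simp add: 2 prim2_def supp_def)
    qed
  qed
qed

lemma Xminus_eq:
  assumes D: "odd D"
  shows "Xminus D = {prim1 D m | m. 1 \<le> m \<and> 2 * m \<le> (D + 3) div 2}
     \<union> {prim2 D m | m. 2 * m \<le> (D - 1) div 2}
     \<union> (if 3 \<le> D then \<Union>k\<in>{1..D}. I_map k ` Xminus (D - 2) else {})"
proof (cases "3 \<le> D")
  case True
  have "D + 2 \<in> supp (I_map k B) \<longleftrightarrow> D - 2 + 2 \<in> supp B" if "k \<in> {1..D}" for k B
  proof -
    have "D - 2 + 2 = D" using True by simp
    then show ?thesis using I_map_top[OF that] by metis
  qed
  then have "Xminus D = {B \<in> Pr D. D + 2 \<in> supp B} \<union> (\<Union>k\<in>{1..D}. I_map k ` Xminus (D - 2))"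
    unfolding Xminus_def XD_step[OF True] by blast
  then show ?thesis using True Pr_top[OF D] by simp
next
  case False
  then have "D = 1" using D by (auto elim!: oddE)
  then have "Xminus D = {B \<in> Pr D. D + 2 \<in> supp B}"
    by (auto simp: Xminus_def supp_def)
  then show ?thesis using False Pr_top[OF D] by simp
qed

lemma Xminus_induct [consumes 2, case_names prim1 prim2 insertion]:
  assumes "odd D" "B \<in> Xminus D"
    and "\<And>D m. \<lbrakk>odd D; 1 \<le> m; 2 * m \<le> (D + 3) div 2\<rbrakk> \<Longrightarrow> P D (prim1 D m)"
    and "\<And>D m. \<lbrakk>odd D; 2 * m \<le> (D - 1) div 2\<rbrakk> \<Longrightarrow> P D (prim2 D m)"
    and "\<And>D k B. \<lbrakk>odd D; k \<in> {1..D + 2}; B \<in> Xminus D; P D B\<rbrakk> \<Longrightarrow> P (D + 2) (I_map k B)"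
  shows "P D B"
  using assms(1,2)
proof (induction D arbitrary: B rule: less_induct)
  case (less D)
  consider m where "1 \<le> m" "2 * m \<le> (D + 3) div 2" "B = prim1 D m"
    | m where "2 * m \<le> (D - 1) div 2" "B = prim2 D m"
    | k B' where "3 \<le> D" "k \<in> {1..D}" "B' \<in> Xminus (D - 2)" "B = I_map k B'"
    using less.prems(2) unfolding Xminus_eq[OF less.prems(1)] by (auto split: if_splits)
  then show ?case
  proof cases
    case 1
    then show ?thesis using assms(3) less.prems(1) by blast
  next
    case 2
    then show ?thesis using assms(4) less.prems(1) by blast
  next
    case 3
    then have D': "odd (D - 2)" "D - 2 < D" "D - 2 + 2 = D" using less.prems(1) by auto
    then have "P (D - 2) B'" using less.IH 3 by blast
    then show ?thesis using assms(5)[of "D - 2" k B'] D' 3 by simp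
  qed
qed

lemma Xminus_PN:
  assumes "odd D" "B \<in> Xminus D"
  shows "B \<in> PN (D + 2)"
  using XD_PN[OF assms(1)] assms by (auto simp: Xminus_def N_of_def)

section \<open>The columns span\<close>

definition column :: "nat \<Rightarrow> nat set set \<Rightarrow> nat set \<Rightarrow>\<^sub>0 int" where
  "column N B = (\<Sum>X | X \<in> unions B \<and> N \<in> X. frag_of X)"

lemma iota_notin [simp]: "k \<notin> iota k ` X" "Suc k \<notin> iota k ` X"
  by (auto simp: iota_def split: if_splits)

lemma iota_image_eq_iff: "iota k ` X = iota k ` Y \<longleftrightarrow> X = Y"
  using inj_iota[of k] by (metis inj_image_eq_iff)

lemma iota_top: "k \<le> N \<Longrightarrow> N + 2 \<in> iota k ` X \<longleftrightarrow> N \<in> X"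
  by (force simp: iota_def split: if_splits)

lemma finite_unions: "finite B \<Longrightarrow> finite (unions B)"
  by (simp add: unions_def)

text \<open>The linear map that sends each vector to the sum of its two ways of making room for the pair
  \<open>{k, k + 1}\<close> carries columns to columns.\<close>

lemma column_I_map:
  assumes fin: "finite B" and k: "k \<in> {1..N}"
  shows "frag_extend (\<lambda>X. frag_of (iota k ` X) + frag_of (iota k ` X \<union> {k, k + 1})) (column N B)
    = column (N + 2) (I_map k B)"
proof -
  define A where "A = {X \<in> unions B. N \<in> X}"
  have finA: "finite A" using finite_unions[OF fin] by (simp add: A_def)
  have inj: "inj_on ((`) (iota k)) A" "inj_on (\<lambda>X. iota k ` X \<union> {k, k + 1}) A"
  proof -
    show "inj_on ((`) (iota k)) A" by (auto simp: inj_on_def iota_image_eq_iff)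
    have "iota k ` X \<union> {k, k + 1} - {k, k + 1} = iota k ` X" for X
      by (auto simp: iota_def split: if_splits)
    then show "inj_on (\<lambda>X. iota k ` X \<union> {k, k + 1}) A"
      by (metis (no_types, lifting) inj_onI iota_image_eq_iff)
  qed
  have disj: "(`) (iota k) ` A \<inter> (\<lambda>X. iota k ` X \<union> {k, k + 1}) ` A = {}"
  proof -
    have "iota k ` X \<noteq> iota k ` Y \<union> {k, k + 1}" for X Y
      by (metis Un_iff insertI1 iota_notin(1))
    then show ?thesis by blast
  qed
  have "N + 2 \<in> iota k ` X \<longleftrightarrow> N \<in> X" "N + 2 \<in> iota k ` X \<union> {k, k + 1} \<longleftrightarrow> N \<in> X" for X
    using k iota_top[of k N X] by auto
  then have "{X \<in> unions (I_map k B). N + 2 \<in> X}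
      = (`) (iota k) ` A \<union> (\<lambda>X. iota k ` X \<union> {k, k + 1}) ` A"
    unfolding unions_I_map A_def by blast
  then have "column (N + 2) (I_map k B)
      = (\<Sum>X\<in>A. frag_of (iota k ` X)) + (\<Sum>X\<in>A. frag_of (iota k ` X \<union> {k, k + 1}))"
    unfolding column_def
    by (simp only: sum.union_disjoint[OF finite_imageI[OF finA] finite_imageI[OF finA] disj]
        sum.reindex[OF inj(1)] sum.reindex[OF inj(2)] o_def)
  then show ?thesis
    using finA by (simp add: column_def A_def[symmetric] frag_extend_sum sum.distrib o_def)
qed

lemma Eminus_eq:
  "odd D \<Longrightarrow> Eminus D = {X. X \<subseteq> {1..D + 2} \<and> even (card X) \<and> D + 2 \<in> X}"
  by (auto simp: Eminus_def EN_simps N_of_def)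

lemma finite_Eminus: "finite (Eminus D)"
  by (rule finite_subset[of _ "Pow {1..N_of D}"]) (auto simp: Eminus_def EN_simps)

definition charge :: "nat set \<Rightarrow> int" where
  "charge X = (\<Sum>x\<in>X. if odd x then 1 else -1)"

lemma charge_insert: "\<lbrakk>finite X; x \<notin> X\<rbrakk> \<Longrightarrow> charge (insert x X) = (if odd x then 1 else -1) + charge X"
  by (simp add: charge_def)

lemma charge_Un: "\<lbrakk>finite X; finite Y; X \<inter> Y = {}\<rbrakk> \<Longrightarrow> charge (X \<union> Y) = charge X + charge Y"
  by (simp add: charge_def sum.union_disjoint)

text \<open>The normal form for two moves that preserve the charge: erase adjacent elements \<open>k, k + 1\<close>, and move an
  element two places to the left across free places.\<close>

definition irreducible_set :: "nat \<Rightarrow> nat set \<Rightarrow> bool" where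
  "irreducible_set n X \<longleftrightarrow>
     (\<forall>k. k \<in> X \<longrightarrow> k + 1 \<le> n \<longrightarrow> k + 1 \<notin> X) \<and> (\<forall>x\<in>X. 3 \<le> x \<longrightarrow> x \<le> n \<longrightarrow> x - 2 \<in> X)"

text \<open>A set on which neither move applies consists, below \<open>D + 2\<close>, of the first few odd numbers
  or of the first few even numbers. The charge tells which.\<close>

lemma irreducible_set_unique:
  assumes D: "odd D" and X: "X \<in> Eminus D" "irreducible_set (D + 1) X"
    and Y: "Y \<in> Eminus D" "irreducible_set (D + 1) Y" and charge: "charge X = charge Y"
  shows "X = Y"
proof -
  have shape: "\<exists>b. (\<forall>x \<in> Z - {D + 2}. odd x = b) \<and>
      (\<forall>x \<in> Z - {D + 2}. \<forall>y. 1 \<le> y \<longrightarrow> y \<le> x \<longrightarrow> odd y = b \<longrightarrow> y \<in> Z - {D + 2}) \<and>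
      charge (Z - {D + 2}) = (if b then 1 else -1) * int (card (Z - {D + 2})) \<and>
      0 < card (Z - {D + 2}) \<and> finite (Z - {D + 2}) \<and> Z - {D + 2} \<subseteq> {1..} \<and> charge Z = 1 + charge (Z - {D + 2})
      \<and> insert (D + 2) (Z - {D + 2}) = Z"
    if Z: "Z \<in> Eminus D" "irreducible_set (D + 1) Z" for Z
  proof -
    define Z' where "Z' = Z - {D + 2}"
    have ZE: "Z \<subseteq> {1..D + 2}" "even (card Z)" "D + 2 \<in> Z" using Z(1) Eminus_eq[OF D] by auto
    have finZ: "finite Z" using ZE(1) finite_subset by blast
    have Z': "Z' \<subseteq> {1..D + 1}"
    proof
      fix x assume "x \<in> Z'"
      then have "x \<in> {1..D + 2}" "x \<noteq> D + 2" using ZE(1) by (auto simp: Z'_def)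
      then show "x \<in> {1..D + 1}" by auto
    qed
    have fin: "finite Z'" using finZ by (simp add: Z'_def)
    have Zeq: "insert (D + 2) Z' = Z" using ZE by (auto simp: Z'_def)
    have "card Z = Suc (card Z')" using fin Zeq by (metis Z'_def card_insert_disjoint insert_Diff_single Diff_iff singletonI)
    then have "odd (card Z')" using ZE by simp
    then have pos: "0 < card Z'" by (cases "card Z'") auto
    have down2: "x - 2 \<in> Z'" if "x \<in> Z'" "3 \<le> x" for x
    proof -
      have "x \<in> Z" "x \<le> D + 1" using that Z' by (auto simp: Z'_def)
      then have "x - 2 \<in> Z" using that Z(2) by (auto simp: irreducible_set_def)
      moreover have "x - 2 \<noteq> D + 2" using \<open>x \<le> D + 1\<close> by simp
      ultimately show ?thesis by (simp add: Z'_def)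
    qed
    have down: "x - 2 * j \<in> Z'" if "x \<in> Z'" "2 * j < x" for x j
      using that(2)
    proof (induction j)
      case 0
      then show ?case using that by simp
    next
      case (Suc j)
      then show ?case using down2[of "x - 2 * j"] by simp
    qed
    have down': "y \<in> Z'" if "x \<in> Z'" "1 \<le> y" "y \<le> x" "odd y = odd x" for x y
    proof -
      have "even (x - y)" using that by simp
      then obtain j where "x - y = 2 * j" by (elim evenE)
      then have "y = x - 2 * j" "2 * j < x" using that by auto
      then show ?thesis using down[OF that(1)] by simp
    qed
    have "\<not> (1 \<in> Z' \<and> 2 \<in> Z')"
    proof -
      have "1 + 1 \<le> D + 1" using D by (auto elim: oddE)
      then have "1 \<in> Z \<Longrightarrow> 1 + 1 \<notin> Z" using Z(2) unfolding irreducible_set_def by blast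
      then show ?thesis by (auto simp: Z'_def numeral_2_eq_2)
    qed
    moreover have "1 \<in> Z'" if "x \<in> Z'" "odd x" for x
      using down'[of x 1] that Z' by fastforce
    moreover have "2 \<in> Z'" if "x \<in> Z'" "even x" for x
    proof -
      have "x \<noteq> 0" using that Z' by auto
      then have "2 \<le> x" using that(2) by presburger
      then show ?thesis using down'[of x 2] that by simp
    qed
    ultimately obtain b where b: "\<forall>x \<in> Z'. odd x = b" by metis
    have "charge Z' = (\<Sum>x\<in>Z'. if b then 1 else -1)"
      unfolding charge_def by (rule sum.cong) (use b in auto)
    then have "charge Z' = (if b then 1 else -1) * int (card Z')" by simp
    moreover have "charge Z = 1 + charge Z'"
      using charge_insert[OF fin, of "D + 2"] Zeq D by (simp add: Z'_def)
    moreover have "Z' \<subseteq> {1..}" using Z' by auto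
    moreover have "\<forall>x \<in> Z'. \<forall>y. 1 \<le> y \<longrightarrow> y \<le> x \<longrightarrow> odd y = b \<longrightarrow> y \<in> Z'"
    proof (intro ballI allI impI)
      fix x y assume xy: "x \<in> Z'" "1 \<le> y" "y \<le> x" "odd y = b"
      have "odd x = b" using b xy(1) by (rule bspec)
      then show "y \<in> Z'" using down'[OF xy(1-3)] xy(4) by simp
    qed
    ultimately show ?thesis
      using b fin pos Zeq unfolding Z'_def[symmetric] by (intro exI[of _ b] conjI)
  qed
  obtain b where b: "\<forall>x \<in> X - {D + 2}. odd x = b"
      "\<forall>x \<in> X - {D + 2}. \<forall>y. 1 \<le> y \<longrightarrow> y \<le> x \<longrightarrow> odd y = b \<longrightarrow> y \<in> X - {D + 2}"
      "charge (X - {D + 2}) = (if b then 1 else -1) * int (card (X - {D + 2}))"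
      "0 < card (X - {D + 2})" "finite (X - {D + 2})" "X - {D + 2} \<subseteq> {1..}"
      "charge X = 1 + charge (X - {D + 2})" "insert (D + 2) (X - {D + 2}) = X"
    using shape[OF X] by (elim exE conjE) (rule that)
  obtain c where c: "\<forall>x \<in> Y - {D + 2}. odd x = c"
      "\<forall>x \<in> Y - {D + 2}. \<forall>y. 1 \<le> y \<longrightarrow> y \<le> x \<longrightarrow> odd y = c \<longrightarrow> y \<in> Y - {D + 2}"
      "charge (Y - {D + 2}) = (if c then 1 else -1) * int (card (Y - {D + 2}))"
      "0 < card (Y - {D + 2})" "finite (Y - {D + 2})" "Y - {D + 2} \<subseteq> {1..}"
      "charge Y = 1 + charge (Y - {D + 2})" "insert (D + 2) (Y - {D + 2}) = Y"
    using shape[OF Y] by (elim exE conjE) (rule that)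
  have "charge (X - {D + 2}) = charge (Y - {D + 2})"
    using b(7) c(7) charge by linarith
  then have "(if b then 1 else -1) * int (card (X - {D + 2})) = (if c then 1 else -1) * int (card (Y - {D + 2}))"
    unfolding b(3) c(3) .
  moreover have "(if b then 1 else -1) * int p = (if c then 1 else -1) * int q \<Longrightarrow> 0 < p \<Longrightarrow> 0 < q \<Longrightarrow> b = c \<and> p = q" for p q
    by (cases b; cases c) simp_all
  ultimately have "b = c" and card: "card (X - {D + 2}) = card (Y - {D + 2})"
    using b(4) c(4) by blast+
  have "X - {D + 2} \<subseteq> Y - {D + 2} \<or> Y - {D + 2} \<subseteq> X - {D + 2}"
  proof (rule ccontr)
    assume "\<not> ?thesis"
    then obtain x y where xy: "x \<in> X - {D + 2}" "x \<notin> Y - {D + 2}" "y \<in> Y - {D + 2}" "y \<notin> X - {D + 2}"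
      by blast
    have "1 \<le> x" "1 \<le> y" using subsetD[OF b(6) xy(1)] subsetD[OF c(6) xy(3)] by simp_all
    moreover have "odd x = c" "odd y = b"
      using bspec[OF b(1) xy(1)] bspec[OF c(1) xy(3)] \<open>b = c\<close> by simp_all
    moreover have "x \<le> y \<or> y \<le> x" by linarith
    ultimately show False
      using bspec[OF b(2) xy(1)] bspec[OF c(2) xy(3)] xy(2,4) by blast
  qed
  then have "X - {D + 2} = Y - {D + 2}"
    using card card_subset_eq[OF b(5)] card_subset_eq[OF c(5)] by metis
  then have "insert (D + 2) (X - {D + 2}) = insert (D + 2) (Y - {D + 2})" by (rule arg_cong)
  then show ?thesis unfolding b(8) c(8) .
qed

text \<open>Both moves lower the sum of the elements. The second one is an insertion of the pair \<open>{k, k + 1}\<close>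
  followed by an erasure of \<open>{k + 1, k + 2}\<close>, so it also respects \<open>R\<close>.\<close>

lemma reduce_to_irreducible:
  assumes D: "odd D" and X: "X \<in> Eminus D"
    and R: "\<And>X k. \<lbrakk>X \<in> Eminus D; k \<in> {1..D}; k \<notin> X; k + 1 \<notin> X\<rbrakk> \<Longrightarrow> R X \<longleftrightarrow> R (X \<union> {k, k + 1})"
  shows "\<exists>Z \<in> Eminus D. irreducible_set (D + 1) Z \<and> charge Z = charge X \<and> (R Z \<longleftrightarrow> R X)"
  using X
proof (induction "\<Sum>X" arbitrary: X rule: less_induct)
  case (less X)
  have XE: "X \<subseteq> {1..D + 2}" "even (card X)" "D + 2 \<in> X" using less.prems Eminus_eq[OF D] by auto
  have fin: "finite X" using XE(1) finite_subset by blast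
  have step: ?case if "Z \<in> Eminus D" "\<Sum>Z < \<Sum>X" "charge Z = charge X" "R Z \<longleftrightarrow> R X" for Z
    using less.hyps[OF that(2,1)] that by auto
  have ins: "Z \<union> {k, k + 1} \<in> Eminus D" "charge (Z \<union> {k, k + 1}) = charge Z"
      "\<Sum>(Z \<union> {k, k + 1}) = \<Sum>Z + k + (k + 1)"
    if "Z \<in> Eminus D" "k \<in> {1..D}" "k \<notin> Z" "k + 1 \<notin> Z" for Z k
  proof -
    have "finite Z" using that(1) Eminus_eq[OF D] finite_subset by auto
    then show "Z \<union> {k, k + 1} \<in> Eminus D" "charge (Z \<union> {k, k + 1}) = charge Z"
        "\<Sum>(Z \<union> {k, k + 1}) = \<Sum>Z + k + (k + 1)"
      using that by (auto simp: Eminus_eq[OF D] charge_insert)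
  qed
  have del: "Z - {k, k + 1} \<in> Eminus D" if "Z \<in> Eminus D" "k \<in> {1..D}" "k \<in> Z" "k + 1 \<in> Z" for Z k
  proof -
    have "finite Z" using that(1) Eminus_eq[OF D] finite_subset by auto
    then have "card (Z - {k, k + 1}) = card Z - 2"
      using that by (subst card_Diff_subset) auto
    then show ?thesis
      using that by (auto simp: Eminus_eq[OF D])
  qed
  show ?case
  proof (cases "irreducible_set (D + 1) X")
    case True
    then show ?thesis using less.prems by blast
  next
    case False
    then consider k where "k \<in> X" "k \<le> D" "k + 1 \<in> X"
      | x where "x \<in> X" "3 \<le> x" "x \<le> D + 1" "x - 2 \<notin> X" "\<And>k. k \<in> X \<Longrightarrow> k \<le> D \<Longrightarrow> k + 1 \<notin> X"
      unfolding irreducible_set_def by force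
    then show ?thesis
    proof cases
      case 1
      define Z where "Z = X - {k, k + 1}"
      have k: "k \<in> {1..D}" using 1 XE(1) by auto
      have Z: "Z \<in> Eminus D" using del[OF less.prems k] 1 by (simp add: Z_def)
      have free: "k \<notin> Z" "k + 1 \<notin> Z" and eq: "Z \<union> {k, k + 1} = X" using 1 by (auto simp: Z_def)
      show ?thesis
        using step[OF Z] R[OF Z k free] ins[OF Z k free] k unfolding eq by simp
    next
      case 2
      define k where "k = x - 2"
      have x: "x = k + 2" and k: "k \<in> {1..D}" "k + 1 \<in> {1..D}" using 2 by (auto simp: k_def)
      have free: "k \<notin> X" "k + 1 \<notin> X"
        using 2(4) 2(5)[of "k + 1"] 2(1) k unfolding x by auto
      define Y where "Y = X \<union> {k, k + 1}"
      define Z where "Z = Y - {k + 1, k + 2}"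
      have Y: "Y \<in> Eminus D" using ins(1)[OF less.prems k(1) free] by (simp add: Y_def)
      have Z: "Z \<in> Eminus D"
        using del[OF Y k(2)] 2(1) by (simp add: Z_def Y_def x)
      have free': "k + 1 \<notin> Z" "k + 1 + 1 \<notin> Z" and eq: "Z \<union> {k + 1, k + 1 + 1} = Y"
        using 2(1) by (auto simp: Z_def Y_def x)
      have "\<Sum>Y = \<Sum>X + k + (k + 1)" "\<Sum>Y = \<Sum>Z + (k + 1) + (k + 1 + 1)"
        using ins(3)[OF less.prems k(1) free] ins(3)[OF Z k(2) free'] unfolding eq Y_def by auto
      then have "\<Sum>Z < \<Sum>X" by simp
      moreover have "charge Z = charge X"
        using ins(2)[OF less.prems k(1) free] ins(2)[OF Z k(2) free'] unfolding eq Y_def by simp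
      moreover have "R Z \<longleftrightarrow> R X"
        using R[OF less.prems k(1) free] R[OF Z k(2) free'] unfolding eq Y_def by simp
      ultimately show ?thesis using step[OF Z] by blast
    qed
  qed
qed

lemma charge_determines:
  assumes D: "odd D" and XY: "X \<in> Eminus D" "Y \<in> Eminus D" "charge X = charge Y"
    and R: "\<And>X k. \<lbrakk>X \<in> Eminus D; k \<in> {1..D}; k \<notin> X; k + 1 \<notin> X\<rbrakk> \<Longrightarrow> R X \<longleftrightarrow> R (X \<union> {k, k + 1})"
  shows "R X \<longleftrightarrow> R Y"
proof -
  obtain X' where X': "X' \<in> Eminus D" "irreducible_set (D + 1) X'" "charge X' = charge X" "R X' \<longleftrightarrow> R X"
    using reduce_to_irreducible[OF D XY(1), of R] R by blast
  obtain Y' where Y': "Y' \<in> Eminus D" "irreducible_set (D + 1) Y'" "charge Y' = charge Y" "R Y' \<longleftrightarrow> R Y"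
    using reduce_to_irreducible[OF D XY(2), of R] R by blast
  have "X' = Y'"
    using irreducible_set_unique[OF D X'(1,2) Y'(1,2)] X'(3) Y'(3) XY(3) by simp
  then show ?thesis using X' Y' by simp
qed

text \<open>Write \<open>X\<close> as the image of some \<open>Y\<close> for \<open>D - 2\<close>. By hypothesis \<open>Y\<close> is a combination of columns, and
  the linear map of \<open>column_I_map\<close> turns it into the vector claimed. For \<open>D = 1\<close> there is no such \<open>X\<close>.\<close>

lemma I_map_relation:
  assumes D: "odd D" and X: "X \<in> Eminus D" "k \<in> {1..D}" "k \<notin> X" "k + 1 \<notin> X"
    and IH: "3 \<le> D \<Longrightarrow> frag_of ` Eminus (D - 2) \<subseteq> frag.span (column D ` Xminus (D - 2))"
  shows "frag_of X + frag_of (X \<union> {k, k + 1}) \<in> frag.span (column (D + 2) ` Xminus D)"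
proof -
  have XE: "X \<subseteq> {1..D + 2}" "even (card X)" "D + 2 \<in> X" using X(1) Eminus_eq[OF D] by auto
  have D3: "3 \<le> D"
  proof (rule ccontr)
    assume "\<not> 3 \<le> D"
    then have "D = 1" "k = 1" using D X(2) by (auto elim!: oddE)
    have x3: "x = 3" if "x \<in> X" for x
    proof -
      have "x \<in> {1..D + 2}" "x \<noteq> k" "x \<noteq> k + 1"
        using XE(1) X(3,4) that by auto
      then show ?thesis using \<open>D = 1\<close> \<open>k = 1\<close> by auto
    qed
    have "3 \<in> X" using XE(3) \<open>D = 1\<close> by (simp add: numeral_3_eq_3)
    then have "X = {3}" using x3 by blast
    then show False using XE(2) by simp
  qed
  define Y where "Y = {i. iota k i \<in> X}"
  have YX: "iota k ` Y = X"
  proof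
    show "X \<subseteq> iota k ` Y"
    proof
      fix x assume x: "x \<in> X"
      have "x < k \<or> k + 2 \<le> x" using X(3,4) x by (metis Suc_1 Suc_leI add.commute add_Suc_right linorder_neqE_nat not_less_eq_eq plus_1_eq_Suc)
      then have "x = iota k (if x < k then x else x - 2)" by (auto simp: iota_def)
      then obtain i where i: "x = iota k i" ..
      then have "i \<in> Y" using x by (simp add: Y_def)
      then show "x \<in> iota k ` Y" using i by blast
    qed
  qed (auto simp: Y_def)
  have "Y \<subseteq> {1..D}"
  proof
    fix i assume "i \<in> Y"
    then have i: "iota k i \<in> {1..D + 2}" using XE(1) by (auto simp: Y_def)
    then show "i \<in> {1..D}" using X(2) by (auto simp: iota_def split: if_splits)
  qed
  moreover have "card X = card Y"
    unfolding YX[symmetric] by (meson card_image inj_iota inj_on_subset subset_UNIV)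
  moreover have "D \<in> Y" using XE(3) X(2) by (simp add: Y_def iota_def)
  moreover have D2: "odd (D - 2)" "D - 2 + 2 = D" using D D3 by auto
  ultimately have "Y \<in> Eminus (D - 2)"
    using XE(2) by (simp add: Eminus_eq)
  then have Y: "frag_of Y \<in> frag.span (column D ` Xminus (D - 2))"
    using IH[OF D3] by blast
  define T where "T = frag_extend (\<lambda>X. frag_of (iota k ` X) + frag_of (iota k ` X \<union> {k, k + 1}))"
  define W where "W = frag.span (column (D + 2) ` Xminus D)"
  have sub: "frag.subspace W" unfolding W_def by (rule frag.subspace_span)
  have "frag.span (column D ` Xminus (D - 2)) \<subseteq> {v. T v \<in> W}"
  proof (rule frag.span_minimal)
    show "column D ` Xminus (D - 2) \<subseteq> {v. T v \<in> W}"
    proof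
      fix v assume "v \<in> column D ` Xminus (D - 2)"
      then obtain B where B: "B \<in> Xminus (D - 2)" "v = column D B" by blast
      have "T v = column (D + 2) (I_map k B)"
        unfolding B(2) T_def using Xminus_PN[OF D2(1) B(1)] finite_PN X(2) by (intro column_I_map) auto
      moreover have "I_map k B \<in> Xminus D"
        using B(1) D3 X(2) unfolding Xminus_eq[OF D] by auto
      ultimately show "v \<in> {v. T v \<in> W}"
        by (auto simp: W_def intro: frag.span_base)
    qed
    show "frag.subspace {v. T v \<in> W}"
      using frag.subspace_0[OF sub] frag.subspace_add[OF sub] frag.subspace_scale[OF sub]
      by (auto simp: frag.subspace_def T_def frag_extend_add frag_extend_cmul)
  qed
  then have "T (frag_of Y) \<in> W" using Y by blast
  then show ?thesis by (simp add: T_def YX W_def)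
qed

lemma unions_nest: "unions (nest c 1 r) = (\<lambda>J. \<Union>j\<in>J. {c - j, j}) ` Pow {1..r}"
proof -
  have "Pow (nest c 1 r) = (`) (\<lambda>j. {c - j, j}) ` Pow {1..r}"
    unfolding nest_def image_Pow_surj[OF refl, symmetric] by simp
  then show ?thesis unfolding unions_def by (simp add: image_image)
qed

text \<open>For even \<open>c\<close> both elements of \<open>{c - j, j}\<close> have the parity of \<open>j\<close>.\<close>

lemma charge_nest:
  assumes J: "J \<subseteq> {1..r}" and c: "even c" "2 * r < c"
  shows "charge (\<Union>j\<in>J. {c - j, j}) = 2 * charge J" "finite (\<Union>j\<in>J. {c - j, j})"
proof -
  have fin: "finite J" using J finite_subset by blast
  show "finite (\<Union>j\<in>J. {c - j, j})" using fin by auto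
  show "charge (\<Union>j\<in>J. {c - j, j}) = 2 * charge J"
    using fin J
  proof (induction J rule: finite_induct)
    case empty
    then show ?case by (simp add: charge_def)
  next
    case (insert i J)
    have i: "i \<in> {1..r}" "J \<subseteq> {1..r}" using insert.prems by auto
    then have parity: "odd (c - i) = odd i" and "i \<noteq> c - i" using c by auto
    have "{c - i, i} \<inter> (\<Union>j\<in>J. {c - j, j}) = {}"
    proof -
      have "{c - i, i} \<inter> {c - j, j} = {}" if "j \<in> J" for j
      proof -
        have "j \<in> {1..r}" "j \<noteq> i" using that i(2) insert.hyps by auto
        then show ?thesis using i(1) c(2) by auto
      qed
      then show ?thesis by blast
    qed
    then have "charge ({c - i, i} \<union> (\<Union>j\<in>J. {c - j, j})) = charge {c - i, i} + charge (\<Union>j\<in>J. {c - j, j})"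
      using insert.hyps by (intro charge_Un) auto
    then show ?case
      using insert parity \<open>i \<noteq> c - i\<close> i(2) by (simp add: charge_insert charge_def)
  qed
qed

lemma card_odd_even_interval:
  "card {j\<in>{1..r}. odd j} = (r + 1) div 2" "card {j\<in>{1..r}. even j} = r div 2"
proof -
  have "card {j\<in>{1..r}. odd j} = (r + 1) div 2 \<and> card {j\<in>{1..r}. even j} = r div 2"
  proof (induction r)
    case (Suc r)
    have "{j\<in>{1..Suc r}. odd j} = (if even r then insert (Suc r) {j\<in>{1..r}. odd j} else {j\<in>{1..r}. odd j})"
      "{j\<in>{1..Suc r}. even j} = (if odd r then insert (Suc r) {j\<in>{1..r}. even j} else {j\<in>{1..r}. even j})"
      by (auto simp: le_Suc_eq)
    then show ?case using Suc by auto
  qed simp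
  then show "card {j\<in>{1..r}. odd j} = (r + 1) div 2" "card {j\<in>{1..r}. even j} = r div 2" by auto
qed

lemma charge_interval_subset:
  assumes J: "J \<subseteq> {1..r}"
  shows "charge J = int (card {j\<in>J. odd j}) - int (card {j\<in>J. even j})"
    and "card {j\<in>J. odd j} \<le> (r + 1) div 2" and "card {j\<in>J. even j} \<le> r div 2"
    and "card {j\<in>J. odd j} = (r + 1) div 2 \<Longrightarrow> {j\<in>J. odd j} = {j\<in>{1..r}. odd j}"
    and "card {j\<in>J. even j} = r div 2 \<Longrightarrow> {j\<in>J. even j} = {j\<in>{1..r}. even j}"
proof -
  have fin: "finite J" using J finite_subset by blast
  have "J = {j\<in>J. odd j} \<union> {j\<in>J. even j}" by auto
  then have "charge J = charge {j\<in>J. odd j} + charge {j\<in>J. even j}"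
    using fin charge_Un[of "{j\<in>J. odd j}" "{j\<in>J. even j}"] by fastforce
  then show "charge J = int (card {j\<in>J. odd j}) - int (card {j\<in>J. even j})"
    by (simp add: charge_def)
  note cards = card_odd_even_interval[of r]
  have sub: "{j\<in>J. odd j} \<subseteq> {j\<in>{1..r}. odd j}" "{j\<in>J. even j} \<subseteq> {j\<in>{1..r}. even j}"
    using J by auto
  show "card {j\<in>J. odd j} \<le> (r + 1) div 2" "card {j\<in>J. even j} \<le> r div 2"
    using card_mono[OF _ sub(1)] card_mono[OF _ sub(2)] cards by auto
  show "card {j\<in>J. odd j} = (r + 1) div 2 \<Longrightarrow> {j\<in>J. odd j} = {j\<in>{1..r}. odd j}"
    "card {j\<in>J. even j} = r div 2 \<Longrightarrow> {j\<in>J. even j} = {j\<in>{1..r}. even j}"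
    using card_subset_eq[OF _ sub(1)] card_subset_eq[OF _ sub(2)] cards by auto
qed

text \<open>A vector of the span that contains \<open>D + 2\<close> is given by a set \<open>J\<close> of indices with \<open>1 \<in> J\<close>; its charge is
  largest exactly when \<open>J\<close> consists of all odd indices.\<close>

lemma prim1_charges:
  assumes D: "odd D" and m: "1 \<le> m" "2 * m \<le> (D + 3) div 2"
  shows "\<exists>X0 \<in> unions (prim1 D m). D + 2 \<in> X0 \<and> charge X0 = 2 * int m \<and>
    (\<forall>X \<in> unions (prim1 D m). D + 2 \<in> X \<longrightarrow> X \<noteq> X0 \<longrightarrow> 2 - 2 * int (m - 1) \<le> charge X \<and> charge X \<le> 2 * int (m - 1))"
proof -
  define r where "r = 2 * m - 1"
  have r: "2 * r < D + 3" "1 \<le> r" "(r + 1) div 2 = m" "r div 2 = m - 1" using m by (auto simp: r_def)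
  have top: "D + 2 \<in> (\<Union>j\<in>J. {D + 3 - j, j}) \<longleftrightarrow> 1 \<in> J" if "J \<subseteq> {1..r}" for J
  proof -
    have *: "D + 2 \<in> {D + 3 - j, j} \<longleftrightarrow> j = 1" if "j \<in> J" for j
    proof -
      have "j \<in> {1..r}" using that \<open>J \<subseteq> {1..r}\<close> by blast
      then show ?thesis using r by auto
    qed
    show ?thesis unfolding UN_iff using * by metis
  qed
  have ch: "charge (\<Union>j\<in>J. {D + 3 - j, j}) = 2 * charge J" if "J \<subseteq> {1..r}" for J
    using charge_nest(1)[OF that _ r(1)] D by simp
  define J0 where "J0 = {j\<in>{1..r}. odd j}"
  define X0 where "X0 = (\<Union>j\<in>J0. {D + 3 - j, j})"
  have J0: "J0 \<subseteq> {1..r}" "1 \<in> J0" using r by (auto simp: J0_def)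
  have "charge J0 = int m"
  proof -
    have eq: "{j\<in>J0. odd j} = J0" "{j\<in>J0. even j} = {}" by (auto simp: J0_def)
    have "card J0 = m"
      using card_odd_even_interval(1)[of r] r(3) by (simp only: J0_def)
    then show ?thesis
      using charge_interval_subset(1)[OF J0(1)] unfolding eq by simp
  qed
  then have X0: "X0 \<in> unions (prim1 D m)" "D + 2 \<in> X0" "charge X0 = 2 * int m"
    using J0 top[OF J0(1)] ch[OF J0(1)] unfolding prim1_def r_def[symmetric] unions_nest X0_def by auto
  have "2 - 2 * int (m - 1) \<le> charge X \<and> charge X \<le> 2 * int (m - 1)"
    if X: "X \<in> unions (prim1 D m)" "D + 2 \<in> X" "X \<noteq> X0" for X
  proof -
    obtain J where J: "J \<subseteq> {1..r}" "X = (\<Union>j\<in>J. {D + 3 - j, j})"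
      using X(1) unfolding prim1_def r_def[symmetric] unions_nest by blast
    have "1 \<in> J" using top[OF J(1)] X(2) J(2) by simp
    then have "{j\<in>J. odd j} \<noteq> {}" by force
    moreover have finJ: "finite J" using finite_subset[OF J(1)] by simp
    ultimately have "0 < card {j\<in>J. odd j}"
      unfolding card_gt_0_iff by (intro conjI) simp_all
    then have o1: "1 \<le> card {j\<in>J. odd j}" by simp
    note o = charge_interval_subset[OF J(1), unfolded r(3,4)]
    have "J \<noteq> J0" using J(2) X(3) by (auto simp: X0_def)
    have "card {j\<in>J. odd j} < m \<or> 1 \<le> card {j\<in>J. even j}"
    proof (rule ccontr)
      assume "\<not> ?thesis"
      then have "{j\<in>J. odd j} = J0" "card {j\<in>J. even j} = 0" using o(2,4) by (auto simp: J0_def)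
      moreover have "finite J" using finite_subset[OF J(1)] by simp
      ultimately have "J = J0" by (auto simp: card_eq_0_iff)
      then show False using \<open>J \<noteq> J0\<close> by simp
    qed
    then show ?thesis
      using o(1-3) o1 ch[OF J(1)] m J(2) by auto
  qed
  then show ?thesis using X0 by (intro bexI[of _ X0] conjI ballI impI) simp_all
qed

text \<open>The pair \<open>{D + 1, D + 2}\<close> always occurs and has charge 0. The other indices are free, and the charge is
  smallest exactly when all even ones and no odd ones are chosen.\<close>

lemma prim2_charges:
  assumes D: "odd D" and m: "2 * m \<le> (D - 1) div 2"
  shows "\<exists>X0 \<in> unions (prim2 D m). D + 2 \<in> X0 \<and> charge X0 = - 2 * int m \<and>
    (\<forall>X \<in> unions (prim2 D m). D + 2 \<in> X \<longrightarrow> X \<noteq> X0 \<longrightarrow> 2 - 2 * int m \<le> charge X \<and> charge X \<le> 2 * int m)"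
proof -
  define r where "r = 2 * m"
  have r: "2 * r < D + 1" "(r + 1) div 2 = m" "r div 2 = m" using m D by (auto simp: r_def elim!: oddE)
  define U where "U J = {D + 1, D + 2} \<union> (\<Union>j\<in>J. {D + 1 - j, j})" for J
  have low: "(\<Union>j\<in>J. {D + 1 - j, j}) \<subseteq> {1..D}" if "J \<subseteq> {1..r}" for J
  proof -
    have "{D + 1 - j, j} \<subseteq> {1..D}" if "j \<in> J" for j
    proof -
      have "j \<in> {1..r}" using that \<open>J \<subseteq> {1..r}\<close> by blast
      then show ?thesis using r by auto
    qed
    then show ?thesis by blast
  qed
  have mem: "X \<in> unions (prim2 D m) \<and> D + 2 \<in> X \<longleftrightarrow> (\<exists>J. J \<subseteq> {1..r} \<and> X = U J)" for X
  proof -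
    have no: "D + 2 \<notin> (\<Union>j\<in>J. {D + 1 - j, j})" if "J \<subseteq> {1..r}" for J
    proof
      assume "D + 2 \<in> (\<Union>j\<in>J. {D + 1 - j, j})"
      then have "D + 2 \<in> {1..D}" using low[OF that] by (rule subsetD[rotated])
      then show False by simp
    qed
    have split: "unions (prim2 D m) = (\<lambda>J. \<Union>j\<in>J. {D + 1 - j, j}) ` Pow {1..r} \<union> U ` Pow {1..r}"
      unfolding prim2_def r_def[symmetric] unions_insert unions_nest image_image U_def ..
    show ?thesis
    proof
      assume X: "X \<in> unions (prim2 D m) \<and> D + 2 \<in> X"
      then have "X \<notin> (\<lambda>J. \<Union>j\<in>J. {D + 1 - j, j}) ` Pow {1..r}"
        using no by fast
      then have "X \<in> U ` Pow {1..r}" using X unfolding split by simp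
      then obtain J where "X = U J" "J \<in> Pow {1..r}" by (rule imageE)
      then show "\<exists>J. J \<subseteq> {1..r} \<and> X = U J" by (intro exI[of _ J] conjI) simp_all
    next
      assume "\<exists>J. J \<subseteq> {1..r} \<and> X = U J"
      then obtain J where J: "J \<subseteq> {1..r}" "X = U J" by (elim exE conjE)
      have "D + 2 \<in> U J" by (simp add: U_def)
      then show "X \<in> unions (prim2 D m) \<and> D + 2 \<in> X"
        unfolding split J(2) using J(1) by simp
    qed
  qed
  have ch: "charge (U J) = 2 * charge J" if "J \<subseteq> {1..r}" for J
  proof -
    have "{D + 1, D + 2} \<inter> (\<Union>j\<in>J. {D + 1 - j, j}) = {}"
      using low[OF that] by fastforce
    then have "charge (U J) = charge {D + 1, D + 2} + charge (\<Union>j\<in>J. {D + 1 - j, j})"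
      unfolding U_def using charge_nest(2)[OF that _ r(1)] D by (intro charge_Un) auto
    then show ?thesis
      using charge_nest(1)[OF that _ r(1)] D by (simp add: charge_def)
  qed
  define J0 where "J0 = {j\<in>{1..r}. even j}"
  have J0: "J0 \<subseteq> {1..r}" by (auto simp: J0_def)
  have "charge J0 = - int m"
  proof -
    have eq: "{j\<in>J0. odd j} = {}" "{j\<in>J0. even j} = J0" by (auto simp: J0_def)
    have "card J0 = m"
      using card_odd_even_interval(2)[of r] r(3) by (simp only: J0_def)
    then show ?thesis
      using charge_interval_subset(1)[OF J0(1)] unfolding eq by simp
  qed
  then have X0: "U J0 \<in> unions (prim2 D m)" "D + 2 \<in> U J0" "charge (U J0) = - 2 * int m"
    using mem[of "U J0"] J0 ch[OF J0] by auto
  have "2 - 2 * int m \<le> charge X \<and> charge X \<le> 2 * int m"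
    if X: "X \<in> unions (prim2 D m)" "D + 2 \<in> X" "X \<noteq> U J0" for X
  proof -
    obtain J where J: "J \<subseteq> {1..r}" "X = U J"
      using iffD1[OF mem conjI[OF X(1,2)]] by (elim exE conjE) (rule that)
    note o = charge_interval_subset[OF J(1), unfolded r(2,3)]
    have "J \<noteq> J0" using J(2) X(3) by auto
    have "card {j\<in>J. even j} < m \<or> 1 \<le> card {j\<in>J. odd j}"
    proof (rule ccontr)
      assume "\<not> ?thesis"
      then have "{j\<in>J. even j} = J0" "card {j\<in>J. odd j} = 0" using o(3,5) by (auto simp: J0_def)
      moreover have "finite J" using finite_subset[OF J(1)] by simp
      ultimately have "J = J0" by (auto simp: card_eq_0_iff)
      then show False using \<open>J \<noteq> J0\<close> by simp
    qed
    then show ?thesis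
      using o(1-3) ch[OF J(1)] J(2) by auto
  qed
  then show ?thesis using X0 by (intro bexI[of _ "U J0"] conjI ballI impI) simp_all
qed

lemma extract_vector:
  assumes P: "P \<in> Xminus D" "finite P" and X0: "X0 \<in> unions P" "D + 2 \<in> X0"
    and rest: "\<And>X. \<lbrakk>X \<in> unions P; D + 2 \<in> X; X \<noteq> X0\<rbrakk> \<Longrightarrow> frag_of X \<in> frag.span (column (D + 2) ` Xminus D)"
  shows "frag_of X0 \<in> frag.span (column (D + 2) ` Xminus D)"
proof -
  define A where "A = {X \<in> unions P. D + 2 \<in> X}"
  have fin: "finite A" using finite_unions[OF P(2)] by (simp add: A_def)
  have A0: "X0 \<in> A" using X0 by (simp add: A_def)
  have "column (D + 2) P = frag_of X0 + (\<Sum>X\<in>A - {X0}. frag_of X)"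
    unfolding column_def A_def[symmetric] by (rule sum.remove[OF fin A0])
  moreover have "column (D + 2) P \<in> frag.span (column (D + 2) ` Xminus D)"
    using P(1) by (intro frag.span_base imageI)
  moreover have "(\<Sum>X\<in>A - {X0}. frag_of X) \<in> frag.span (column (D + 2) ` Xminus D)"
    by (rule frag.span_sum, rule rest) (simp_all add: A_def)
  ultimately show ?thesis
    using frag.span_add_eq2 by metis
qed

lemma charge_Eminus:
  assumes D: "odd D" and X: "X \<in> Eminus D"
  shows "even (charge X)" and "charge X = 2 * int m \<Longrightarrow> 2 * m \<le> (D + 3) div 2"
    and "charge X = - 2 * int m \<Longrightarrow> 2 * m \<le> (D - 1) div 2"
proof -
  have XE: "X \<subseteq> {1..D + 2}" "even (card X)" "D + 2 \<in> X" using X Eminus_eq[OF D] by auto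
  have fin: "finite X" using finite_subset[OF XE(1)] by simp
  note c = charge_interval_subset[OF XE(1)]
  have "card ({x\<in>X. odd x} \<union> {x\<in>X. even x}) = card {x\<in>X. odd x} + card {x\<in>X. even x}"
    by (rule card_Un_disjoint) (use fin in auto)
  moreover have "{x\<in>X. odd x} \<union> {x\<in>X. even x} = X" by auto
  ultimately have "card X = card {x\<in>X. odd x} + card {x\<in>X. even x}" by simp
  then show "even (charge X)" using c(1) XE(2) by simp
  show "2 * m \<le> (D + 3) div 2" if "charge X = 2 * int m"
    using that c(1,2) by simp
  have "D + 2 \<in> {x\<in>X. odd x}" using XE(3) D by simp
  then have "0 < card {x\<in>X. odd x}" using fin by (auto simp: card_gt_0_iff)
  then show "2 * m \<le> (D - 1) div 2" if "charge X = - 2 * int m"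
    using that c(1,3) D by (auto elim!: oddE)
qed

text \<open>Vectors of charge between \<open>2 - 2 * m\<close> and \<open>2 * m\<close> are dealt with by induction on \<open>m\<close>: in the step
  \<open>prim2 D m\<close> supplies the charge \<open>-2 * m\<close> and then \<open>prim1 D (m + 1)\<close> the charge \<open>2 * m + 2\<close>. If these
  members do not exist, then no vector has that charge.\<close>

lemma columns_span:
  assumes "odd D"
  shows "frag_of ` Eminus D \<subseteq> frag.span (column (D + 2) ` Xminus D)"
  using assms
proof (induction D rule: less_induct)
  case (less D)
  note D = \<open>odd D\<close>
  define W where "W = frag.span (column (D + 2) ` Xminus D)"
  have IH: "frag_of ` Eminus (D - 2) \<subseteq> frag.span (column D ` Xminus (D - 2))" if "3 \<le> D"
  proof -
    have "D - 2 < D" "odd (D - 2)" "D - 2 + 2 = D" using that D by auto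
    then show ?thesis using less.IH[of "D - 2"] by simp
  qed
  have R: "frag_of X \<in> W \<longleftrightarrow> frag_of (X \<union> {k, k + 1}) \<in> W"
    if "X \<in> Eminus D" "k \<in> {1..D}" "k \<notin> X" "k + 1 \<notin> X" for X k
  proof -
    have "frag_of X + frag_of (X \<union> {k, k + 1}) \<in> W"
      using I_map_relation[OF D that IH] by (simp only: W_def)
    then show ?thesis
      unfolding W_def by (metis add_diff_cancel_left' add_diff_cancel_right' frag.span_diff)
  qed
  have same_charge: "frag_of Y \<in> W" if "X \<in> Eminus D" "frag_of X \<in> W" "Y \<in> Eminus D" "charge Y = charge X" for X Y
    using charge_determines[OF D that(1,3) that(4)[symmetric], of "\<lambda>X. frag_of X \<in> W"] R that(2) by blast
  have unions_E: "X \<in> Eminus D" if "P \<in> Xminus D" "X \<in> unions P" "D + 2 \<in> X" for P X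
    using unions_carrier[OF Xminus_PN[OF D that(1)]] that(2,3) D
    by (auto simp: Eminus_def N_of_def)
  have range: "\<forall>X \<in> Eminus D. 2 - 2 * int m \<le> charge X \<longrightarrow> charge X \<le> 2 * int m \<longrightarrow> frag_of X \<in> W" for m
  proof (induction m)
    case 0
    then show ?case by simp
  next
    case (Suc m)
    have low: "frag_of Y \<in> W" if Y: "Y \<in> Eminus D" "charge Y = - 2 * int m" for Y
    proof -
      have m: "2 * m \<le> (D - 1) div 2" using charge_Eminus(3)[OF D Y] .
      then have P: "prim2 D m \<in> Xminus D" using Xminus_eq[OF D] by blast
      obtain X0 where X0: "X0 \<in> unions (prim2 D m)" "D + 2 \<in> X0" "charge X0 = - 2 * int m"
        and rest: "\<And>X. \<lbrakk>X \<in> unions (prim2 D m); D + 2 \<in> X; X \<noteq> X0\<rbrakk>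
          \<Longrightarrow> 2 - 2 * int m \<le> charge X \<and> charge X \<le> 2 * int m"
        using prim2_charges[OF D m] by blast
      have "frag_of X0 \<in> W"
        unfolding W_def
      proof (rule extract_vector[OF P finite_PN[OF Xminus_PN[OF D P]] X0(1,2)])
        fix X assume "X \<in> unions (prim2 D m)" "D + 2 \<in> X" "X \<noteq> X0"
        then show "frag_of X \<in> frag.span (column (D + 2) ` Xminus D)"
          using rest Suc.IH unions_E[OF P] unfolding W_def by blast
      qed
      then show ?thesis
        using same_charge[OF unions_E[OF P X0(1,2)] _ Y(1)] X0(3) Y(2) by simp
    qed
    have high: "frag_of Y \<in> W" if Y: "Y \<in> Eminus D" "charge Y = 2 * int (Suc m)" for Y
    proof -
      have m: "1 \<le> Suc m" "2 * Suc m \<le> (D + 3) div 2" using charge_Eminus(2)[OF D Y] by simp_all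
      then have P: "prim1 D (Suc m) \<in> Xminus D" using Xminus_eq[OF D] by blast
      obtain X0 where X0: "X0 \<in> unions (prim1 D (Suc m))" "D + 2 \<in> X0" "charge X0 = 2 * int (Suc m)"
        and rest: "\<And>X. \<lbrakk>X \<in> unions (prim1 D (Suc m)); D + 2 \<in> X; X \<noteq> X0\<rbrakk>
          \<Longrightarrow> 2 - 2 * int m \<le> charge X \<and> charge X \<le> 2 * int m"
        using prim1_charges[OF D m] unfolding diff_Suc_1 by blast
      have "frag_of X0 \<in> W"
        unfolding W_def
      proof (rule extract_vector[OF P finite_PN[OF Xminus_PN[OF D P]] X0(1,2)])
        fix X assume "X \<in> unions (prim1 D (Suc m))" "D + 2 \<in> X" "X \<noteq> X0"
        then show "frag_of X \<in> frag.span (column (D + 2) ` Xminus D)"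
          using rest Suc.IH unions_E[OF P] unfolding W_def by blast
      qed
      then show ?thesis
        using same_charge[OF unions_E[OF P X0(1,2)] _ Y(1)] X0(3) Y(2) by simp
    qed
    show ?case
    proof (intro ballI impI)
      fix X assume X: "X \<in> Eminus D" "2 - 2 * int (Suc m) \<le> charge X" "charge X \<le> 2 * int (Suc m)"
      obtain c where "charge X = 2 * c" using charge_Eminus(1)[OF D X(1)] by (elim evenE)
      then have "charge X = - 2 * int m \<or> charge X = 2 * int (Suc m) \<or>
          2 - 2 * int m \<le> charge X \<and> charge X \<le> 2 * int m"
        using X(2,3) by simp linarith
      then show "frag_of X \<in> W"
        using low[OF X(1)] high[OF X(1)] Suc.IH X(1) by blast
    qed
  qed
  have "frag_of X \<in> W" if "X \<in> Eminus D" for X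
    using range[of "nat \<bar>charge X\<bar> + 1"] that by force
  then show ?case unfolding W_def by blast
qed

section \<open>Depths\<close>

text \<open>Coordinates are doubled: \<open>2 * i\<close> stands for the point \<open>i\<close>, and \<open>2 * i + 1\<close> for the gap between
  \<open>i\<close> and \<open>i + 1\<close>. An arc covers its end points, but not the gaps outside them.\<close>

definition covers :: "nat \<Rightarrow> nat \<times> nat \<Rightarrow> bool" where
  "covers t p \<longleftrightarrow> (if fst p < snd p then 2 * fst p \<le> t \<and> t \<le> 2 * snd p
     else 2 * fst p \<le> t \<or> t \<le> 2 * snd p)"

definition odd_depth :: "nat set set \<Rightarrow> nat \<Rightarrow> bool" where
  "odd_depth B t \<longleftrightarrow> odd (card {p \<in> oriented B. covers t p})"

text \<open>How coordinates change when \<open>{k, k + 1}\<close> is inserted: \<open>collapse\<close> sends the two new points and the two new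
  gaps to the gap \<open>2 * k - 1\<close> where the insertion takes place, and \<open>expand\<close> skips them. The gap behind the
  new pair is counted as new.\<close>

definition collapse :: "nat \<Rightarrow> nat \<Rightarrow> nat" where
  "collapse k t = (if t < 2 * k then t else if t \<le> 2 * k + 2 then 2 * k - 1 else t - 4)"

definition expand :: "nat \<Rightarrow> nat \<Rightarrow> nat" where
  "expand k t = (if t < 2 * k then t else t + 4)"

lemma finite_oriented: "B \<in> PN N \<Longrightarrow> finite (oriented B)"
proof -
  assume B: "B \<in> PN N"
  have "oriented B \<subseteq> {1..N} \<times> {1..N}"
    unfolding oriented_def using PN_subset[OF B] by fastforce
  then show ?thesis by (rule finite_subset) simp
qed

lemma std_iota: "std (iota k i) (iota k j) \<longleftrightarrow> std i j"
  by (auto simp: std_def iota_def)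

lemma oriented_I_map:
  "oriented (I_map k B) = insert (k, k + 1) (map_prod (iota k) (iota k) ` oriented B)"
proof (intro equalityI subsetI)
  fix p assume "p \<in> oriented (I_map k B)"
  then obtain i j where p: "p = (i, j)" "{i, j} \<in> I_map k B" "std i j"
    by (auto simp: oriented_def)
  show "p \<in> insert (k, k + 1) (map_prod (iota k) (iota k) ` oriented B)"
  proof (cases "{i, j} = {k, k + 1}")
    case True
    then have "i = k \<and> j = k + 1 \<or> i = k + 1 \<and> j = k" by (auto simp: doubleton_eq_iff)
    then show ?thesis using p by (auto simp: std_def)
  next
    case False
    then obtain P where P: "P \<in> B" "{i, j} = iota k ` P" using p(2) by (auto simp: I_map_def)
    then have "i \<in> iota k ` P" "j \<in> iota k ` P" by blast+
    then obtain a b where ab: "i = iota k a" "j = iota k b" by blast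
    have "iota k ` {a, b} = iota k ` P" using P(2) ab by simp
    then have "P = {a, b}" by (metis inj_image_eq_iff inj_iota)
    then have "(a, b) \<in> oriented B"
      using P(1) p(3) by (simp add: oriented_def ab std_iota)
    then show ?thesis using p(1) ab by force
  qed
next
  fix p assume "p \<in> insert (k, k + 1) (map_prod (iota k) (iota k) ` oriented B)"
  then show "p \<in> oriented (I_map k B)"
  proof
    assume "p = (k, k + 1)"
    then show ?thesis by (simp add: oriented_def I_map_def std_def)
  next
    assume "p \<in> map_prod (iota k) (iota k) ` oriented B"
    then obtain a b where "{a, b} \<in> B" "std a b" "p = (iota k a, iota k b)"
      by (auto simp: oriented_def)
    then have "iota k ` {a, b} \<in> I_map k B" unfolding I_map_def by blast
    then show ?thesis
      using \<open>p = _\<close> \<open>std a b\<close> by (simp add: oriented_def std_iota)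
  qed
qed

lemma covers_iota: "1 \<le> k \<Longrightarrow> covers t (map_prod (iota k) (iota k) p) \<longleftrightarrow> covers (collapse k t) p"
proof -
  assume k: "1 \<le> k"
  have 1: "2 * iota k a \<le> t \<longleftrightarrow> 2 * a \<le> collapse k t" for a
    using k by (auto simp: iota_def collapse_def)
  have 2: "t \<le> 2 * iota k a \<longleftrightarrow> collapse k t \<le> 2 * a" for a
    using k by (auto simp: iota_def collapse_def)
  have 3: "iota k a < iota k b \<longleftrightarrow> a < b" for a b
    by (auto simp: iota_def)
  show ?thesis
    by (simp add: covers_def 1 2 3)
qed

text \<open>No old arc ends at an inserted point, so each old arc covers all or nothing of what is collapsed; the
  new arc covers the coordinates from \<open>2 * k\<close> to \<open>2 * k + 2\<close> only.\<close>

lemma odd_depth_I_map: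
  assumes B: "B \<in> PN N" and k: "1 \<le> k"
  shows "odd_depth (I_map k B) t \<longleftrightarrow> odd_depth B (collapse k t) \<noteq> (2 * k \<le> t \<and> t \<le> 2 * k + 2)"
proof -
  let ?f = "map_prod (iota k) (iota k)"
  define A where "A = {p \<in> oriented B. covers (collapse k t) p}"
  have fin: "finite A" using finite_oriented[OF B] by (simp add: A_def)
  have "inj ?f" using inj_iota by (simp add: prod.inj_map)
  then have card: "card (?f ` A) = card A" by (meson card_image inj_on_subset subset_UNIV)
  have new: "(k, k + 1) \<notin> ?f ` A" by (auto simp: iota_def split: if_splits)
  have "{p \<in> oriented (I_map k B). covers t p}
      = (if 2 * k \<le> t \<and> t \<le> 2 * k + 2 then insert (k, k + 1) (?f ` A) else ?f ` A)"
  proof -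
    have "{p \<in> insert q (f ` S). Q p} = (if Q q then insert q (f ` {p \<in> S. Q (f p)}) else f ` {p \<in> S. Q (f p)})"
      for q :: "nat \<times> nat" and f :: "nat \<times> nat \<Rightarrow> nat \<times> nat" and S Q by auto
    moreover have "covers t (k, k + 1) \<longleftrightarrow> 2 * k \<le> t \<and> t \<le> 2 * k + 2" by (simp add: covers_def)
    ultimately show ?thesis
      unfolding oriented_I_map A_def covers_iota[OF k, symmetric] by presburger
  qed
  then show ?thesis
    using fin card new by (simp add: odd_depth_def A_def[symmetric])
qed

text \<open>The count changes on the left of \<open>i\<close> only if an arc starts there, and on the right only if one ends there;
  since pairs are disjoint, not both happen.\<close>

lemma odd_depth_point:
  assumes B: "B \<in> PN N" and i: "1 \<le> i"
  shows "odd_depth B (2 * i - 1) = odd_depth B (2 * i) \<or> odd_depth B (2 * i) = odd_depth B (2 * i + 1)"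
proof (rule ccontr)
  assume not: "\<not> ?thesis"
  have "\<exists>p \<in> oriented B. covers (2 * i - 1) p \<noteq> covers (2 * i) p"
    using not unfolding odd_depth_def by (metis (mono_tags, lifting) Collect_cong)
  then obtain a b where ab: "(a, b) \<in> oriented B" "covers (2 * i - 1) (a, b) \<noteq> covers (2 * i) (a, b)"
    by auto
  have "a = i"
  proof (rule ccontr)
    assume "a \<noteq> i"
    then have "2 * a \<le> 2 * i - 1 \<longleftrightarrow> 2 * a \<le> 2 * i" "2 * i - 1 \<le> 2 * b \<longleftrightarrow> 2 * i \<le> 2 * b"
      using i by arith+
    then show False using ab(2) by (simp only: covers_def fst_conv snd_conv)
  qed
  have "\<exists>p \<in> oriented B. covers (2 * i) p \<noteq> covers (2 * i + 1) p"
    using not unfolding odd_depth_def by (metis (mono_tags, lifting) Collect_cong)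
  then obtain c d where cd: "(c, d) \<in> oriented B" "covers (2 * i) (c, d) \<noteq> covers (2 * i + 1) (c, d)"
    by auto
  have "d = i"
  proof (rule ccontr)
    assume "d \<noteq> i"
    then have "2 * c \<le> 2 * i \<longleftrightarrow> 2 * c \<le> 2 * i + 1" "2 * i \<le> 2 * d \<longleftrightarrow> 2 * i + 1 \<le> 2 * d"
      by arith+
    then show False using cd(2) by (simp only: covers_def fst_conv snd_conv)
  qed
  have "{a, b} = {c, d}"
    by (rule PN_disjnt[OF B, where x = i])
      (use ab(1) cd(1) \<open>a = i\<close> \<open>d = i\<close> in \<open>auto simp: oriented_def\<close>)
  then have "c = b" using \<open>a = i\<close> \<open>d = i\<close> by (auto simp: doubleton_eq_iff)
  then show False
    using ab(1) cd(1) \<open>a = i\<close> \<open>d = i\<close> by (auto simp: oriented_def std_def)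
qed

text \<open>Truncated subtraction gives the right count, 0, where no arc covers \<open>t\<close> from the side in question.\<close>

lemma card_wrapping:
  fixes r c t :: nat
  assumes "2 * r < c"
  shows "card {j\<in>{1..r}. 2 * (c - j) \<le> t \<or> t \<le> 2 * j} = (r - (t - 1) div 2) + (r - (2 * c - 1 - t) div 2)"
proof -
  have eq: "{j\<in>{1..r}. 2 * (c - j) \<le> t \<or> t \<le> 2 * j} = {(t - 1) div 2 + 1..r} \<union> {(2 * c - 1 - t) div 2 + 1..r}"
  proof (rule Set.set_eqI)
    fix j
    have "2 * (c - j) \<le> t \<longleftrightarrow> (2 * c - 1 - t) div 2 + 1 \<le> j" if "1 \<le> j" "j \<le> r"
      using that assms by linarith
    moreover have "t \<le> 2 * j \<longleftrightarrow> (t - 1) div 2 + 1 \<le> j" if "1 \<le> j"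
      using that by linarith
    ultimately show "j \<in> {j\<in>{1..r}. 2 * (c - j) \<le> t \<or> t \<le> 2 * j}
        \<longleftrightarrow> j \<in> {(t - 1) div 2 + 1..r} \<union> {(2 * c - 1 - t) div 2 + 1..r}"
      by auto
  qed
  have "{(t - 1) div 2 + 1..r} \<inter> {(2 * c - 1 - t) div 2 + 1..r} = {}"
  proof (rule ccontr)
    assume "\<not> ?thesis"
    then have "(t - 1) div 2 + 1 \<le> r" "(2 * c - 1 - t) div 2 + 1 \<le> r" by auto
    then show False using assms by linarith
  qed
  then show ?thesis
    unfolding eq by (subst card_Un_disjoint) auto
qed

lemma oriented_nest:
  assumes c: "2 * r < c" "even c"
  shows "oriented (nest c 1 r) = (\<lambda>j. (c - j, j)) ` {1..r}"
proof (intro equalityI subsetI)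
  fix p assume "p \<in> oriented (nest c 1 r)"
  then obtain a b j where p: "p = (a, b)" "std a b" "j \<in> {1..r}" "{a, b} = {c - j, j}"
    by (auto simp: oriented_def nest_def)
  have j: "j < c - j" "even (c - j - j)" using p(3) c by auto
  then have "\<not> std j (c - j)" by (auto simp: std_def)
  then have "a = c - j \<and> b = j" using p(2,4) by (auto simp: doubleton_eq_iff)
  then show "p \<in> (\<lambda>j. (c - j, j)) ` {1..r}" using p by blast
next
  fix p assume "p \<in> (\<lambda>j. (c - j, j)) ` {1..r}"
  then obtain j where j: "j \<in> {1..r}" "p = (c - j, j)" by blast
  then have "j < c - j" "even (c - j - j)" using c by auto
  then show "p \<in> oriented (nest c 1 r)"
    using j by (auto simp: oriented_def nest_def std_def)
qed

lemma card_covers_nest: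
  assumes c: "2 * r < c" "even c"
  shows "card {p \<in> oriented (nest c 1 r). covers t p} = (r - (t - 1) div 2) + (r - (2 * c - 1 - t) div 2)"
proof -
  have "{p \<in> oriented (nest c 1 r). covers t p}
      = (\<lambda>j. (c - j, j)) ` {j\<in>{1..r}. 2 * (c - j) \<le> t \<or> t \<le> 2 * j}"
  proof -
    have "covers t (c - j, j) \<longleftrightarrow> 2 * (c - j) \<le> t \<or> t \<le> 2 * j" if "j \<in> {1..r}" for j
      using that c(1) by (auto simp: covers_def)
    then show ?thesis unfolding oriented_nest[OF c] by auto
  qed
  moreover have "inj_on (\<lambda>j. (c - j, j)) A" for A by (auto simp: inj_on_def)
  ultimately show ?thesis
    using card_wrapping[OF c(1), of t] by (simp only: card_image)
qed

lemma odd_depth_prim1: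
  assumes "odd D" "1 \<le> m" "2 * m \<le> (D + 3) div 2"
  shows "odd_depth (prim1 D m) t
    \<longleftrightarrow> odd ((2 * m - 1 - (t - 1) div 2) + (2 * m - 1 - (2 * D + 5 - t) div 2))"
proof -
  have c: "2 * (2 * m - 1) < D + 3" "even (D + 3)" using assms by auto
  have t: "2 * (D + 3) - 1 - t = 2 * D + 5 - t" by simp
  show ?thesis
    unfolding odd_depth_def prim1_def card_covers_nest[OF c] t ..
qed

lemma odd_depth_prim2:
  assumes D: "odd D" and m: "2 * m \<le> (D - 1) div 2"
  shows "odd_depth (prim2 D m) t
    \<longleftrightarrow> odd ((2 * m - (t - 1) div 2) + (2 * m - (2 * D + 1 - t) div 2)) \<noteq> (2 * D + 2 \<le> t \<and> t \<le> 2 * D + 4)"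
proof -
  define A where "A = {p \<in> oriented (nest (D + 1) 1 (2 * m)). covers t p}"
  have c: "2 * (2 * m) < D + 1" "even (D + 1)" using m D by (auto elim!: oddE)
  have or: "oriented (prim2 D m) = insert (D + 1, D + 2) (oriented (nest (D + 1) 1 (2 * m)))"
  proof -
    have "{i, j} = {D + 1, D + 2} \<and> std i j \<longleftrightarrow> i = D + 1 \<and> j = D + 2" for i j
      by (auto simp: doubleton_eq_iff std_def)
    then show ?thesis unfolding oriented_def prim2_def by auto
  qed
  have new: "(D + 1, D + 2) \<notin> oriented (nest (D + 1) 1 (2 * m))"
    unfolding oriented_nest[OF c] using c by auto
  have "{p \<in> oriented (prim2 D m). covers t p}
      = (if 2 * D + 2 \<le> t \<and> t \<le> 2 * D + 4 then insert (D + 1, D + 2) A else A)"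
    unfolding or A_def by (auto simp: covers_def)
  moreover have "finite A" unfolding A_def oriented_nest[OF c] by simp
  moreover have "card A = (2 * m - (t - 1) div 2) + (2 * m - (2 * D + 1 - t) div 2)"
  proof -
    have t: "2 * (D + 1) - 1 - t = 2 * D + 1 - t" by simp
    show ?thesis unfolding A_def card_covers_nest[OF c] t ..
  qed
  moreover have "(D + 1, D + 2) \<notin> A" using new by (simp add: A_def)
  ultimately show ?thesis by (simp add: odd_depth_def)
qed

text \<open>\<open>B'\<close> is what remains of \<open>B\<close> after deleting the points \<open>k\<close> and \<open>k + 1\<close>. Three situations occur: the two
  points form a pair; or both are free; or one arc ends at \<open>k\<close> and another begins at \<open>k + 1\<close>, and their
  other ends are joined. The last condition says that the gap before \<open>k\<close> recognises the first situation.\<close>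

definition contracts :: "nat \<Rightarrow> nat \<Rightarrow> nat set set \<Rightarrow> nat set set \<Rightarrow> bool" where
  "contracts D k B B' \<longleftrightarrow> B' \<in> Xminus (D - 2) \<and> (\<forall>s. odd_depth B' s = odd_depth B (expand k s)) \<and>
     odd_depth B (2 * k - 1) = odd_depth B (2 * k + 3) \<and>
     (B = I_map k B' \<or> odd_depth B (2 * k - 1) = odd_depth B (2 * k))"

text \<open>Along a nest the depth changes at every step, so two neighbours of equal parity are both free.\<close>

lemma contraction_prim1:
  assumes D: "odd D" and m: "1 \<le> m" "2 * m \<le> (D + 3) div 2" and k: "k \<in> {1..D}"
    and eq: "odd_depth (prim1 D m) (2 * k) = odd_depth (prim1 D m) (2 * k + 2)"
  shows "3 \<le> D \<and> contracts D k (prim1 D m) (prim1 (D - 2) m)"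
proof -
  define r where "r = 2 * m - 1"
  note d = odd_depth_prim1[OF D m, folded r_def]
  have r: "2 * r \<le> D + 1" "odd r" using m D by (auto simp: r_def elim!: oddE)
  have halves: "(2 * k - 1) div 2 = k - 1" "(2 * D + 5 - 2 * k) div 2 = D + 2 - k"
    "(2 * k + 2 - 1) div 2 = k" "(2 * D + 5 - (2 * k + 2)) div 2 = D + 1 - k"
    using k by auto
  have par: "even ((r - (k - 1)) + (r - (D + 2 - k)) + ((r - k) + (r - (D + 1 - k))))"
    using eq unfolding d halves
      even_add[of "(r - (k - 1)) + (r - (D + 2 - k))" "(r - k) + (r - (D + 1 - k))"] by blast
  have k_mid: "r < k \<and> k + r \<le> D + 1"
  proof (rule ccontr)
    assume "\<not> ?thesis"
    then consider "k \<le> r" | "D + 2 \<le> k + r" by linarith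
    then show False
    proof cases
      case 1
      then have "r - (k - 1) = Suc (r - k)" "r - (D + 2 - k) = 0" "r - (D + 1 - k) = 0"
        using k r by auto
      then show False using par by simp
    next
      case 2
      then have "r - (D + 1 - k) = Suc (r - (D + 2 - k))" "r - (k - 1) = 0" "r - k = 0"
        using k r by auto
      then show False using par by simp
    qed
  qed
  then have D3: "3 \<le> D" using D r by (auto elim!: oddE)
  have D': "odd (D - 2)" "2 * m \<le> (D - 2 + 3) div 2"
    using D D3 k_mid r by (auto simp: r_def elim!: oddE)
  note d' = odd_depth_prim1[OF D'(1) m(1) D'(2), folded r_def]
  have "odd_depth (prim1 (D - 2) m) s = odd_depth (prim1 D m) (expand k s)" for s
  proof (cases "s < 2 * k")
    case True
    then have "r - (2 * (D - 2) + 5 - s) div 2 = 0" "r - (2 * D + 5 - s) div 2 = 0"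
      using k_mid D3 by auto
    then show ?thesis using True by (simp add: d d' expand_def)
  next
    case False
    then have "r - (s - 1) div 2 = 0" "r - (s + 4 - 1) div 2 = 0" "2 * (D - 2) + 5 - s = 2 * D + 5 - (s + 4)"
      using k_mid D3 by auto
    then show ?thesis using False by (simp only: d d' expand_def if_False)
  qed
  moreover have "\<not> odd_depth (prim1 D m) t" if "2 * k - 1 \<le> t" "t \<le> 2 * k + 3" for t
  proof -
    have "r - (t - 1) div 2 = 0" "r - (2 * D + 5 - t) div 2 = 0"
      using that k_mid k by auto
    then show ?thesis by (simp add: d)
  qed
  moreover have "prim1 (D - 2) m \<in> Xminus (D - 2)"
    using Xminus_eq[OF D'(1)] D'(2) m(1) by blast
  ultimately show ?thesis using D3 by (simp add: contracts_def)
qed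

lemma contraction_prim2:
  assumes D: "odd D" and m: "2 * m \<le> (D - 1) div 2" and k: "k \<in> {1..D}"
    and eq: "odd_depth (prim2 D m) (2 * k) = odd_depth (prim2 D m) (2 * k + 2)"
  shows "3 \<le> D \<and> contracts D k (prim2 D m) (prim2 (D - 2) m)"
proof -
  define r where "r = 2 * m"
  note d = odd_depth_prim2[OF D m, folded r_def]
  have r: "2 * r + 1 \<le> D" using m D by (auto simp: r_def elim!: oddE)
  have halves: "(2 * k - 1) div 2 = k - 1" "(2 * D + 1 - 2 * k) div 2 = D - k"
    "(2 * k + 2 - 1) div 2 = k" "(2 * D + 1 - (2 * k + 2)) div 2 = D - 1 - k"
    "(2 * D + 2 \<le> 2 * k \<and> 2 * k \<le> 2 * D + 4) = False"
    "(2 * D + 2 \<le> 2 * k + 2 \<and> 2 * k + 2 \<le> 2 * D + 4) = (k = D)"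
    using k by auto
  have par: "even ((r - (k - 1)) + (r - (D - k)) + ((r - k) + (r - (D - 1 - k)))) = (k \<noteq> D)"
    using eq unfolding d halves
      even_add[of "(r - (k - 1)) + (r - (D - k))" "(r - k) + (r - (D - 1 - k))"] by blast
  have k_mid: "r < k \<and> k + r + 1 \<le> D"
  proof (rule ccontr)
    assume "\<not> ?thesis"
    then consider "k \<le> r" | "D \<le> k + r" "k < D" | "k = D" using k by force
    then show False
    proof cases
      case 1
      then have "r - (k - 1) = Suc (r - k)" "r - (D - k) = 0" "r - (D - 1 - k) = 0" "k \<noteq> D"
        using k r by auto
      then show False using par by simp
    next
      case 2
      then have "r - (D - 1 - k) = Suc (r - (D - k))" "r - (k - 1) = 0" "r - k = 0" "k \<noteq> D"
        using k r by auto
      then show False using par by simp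
    next
      case 3
      then have "r - (k - 1) = 0" "r - k = 0" "D - 1 - k = D - k" using r by auto
      then show False using par 3 by simp
    qed
  qed
  then have D3: "3 \<le> D" using D r k by (auto elim!: oddE)
  have D': "odd (D - 2)" "2 * m \<le> (D - 2 - 1) div 2"
  proof -
    obtain b where b: "D = 2 * b + 1" using D by (elim oddE)
    have "2 * (2 * m) + 1 \<le> 2 * b" using k_mid b by (simp add: r_def)
    then have "2 * m \<le> b - 1" by linarith
    then show "2 * m \<le> (D - 2 - 1) div 2" using b by simp
    show "odd (D - 2)" using D D3 by simp
  qed
  note d' = odd_depth_prim2[OF D'(1) D'(2), folded r_def]
  have "odd_depth (prim2 (D - 2) m) s = odd_depth (prim2 D m) (expand k s)" for s
  proof (cases "s < 2 * k")
    case True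
    then have "r - (2 * (D - 2) + 1 - s) div 2 = 0" "r - (2 * D + 1 - s) div 2 = 0"
        "\<not> 2 * (D - 2) + 2 \<le> s" "\<not> 2 * D + 2 \<le> s"
      using k_mid D3 by auto
    then show ?thesis using True by (simp add: d d' expand_def)
  next
    case False
    then have "r - (s - 1) div 2 = 0" "r - (s + 4 - 1) div 2 = 0" "2 * (D - 2) + 1 - s = 2 * D + 1 - (s + 4)"
        "(2 * (D - 2) + 2 \<le> s \<and> s \<le> 2 * (D - 2) + 4) = (2 * D + 2 \<le> s + 4 \<and> s + 4 \<le> 2 * D + 4)"
      using k_mid D3 by auto
    then show ?thesis using False by (simp only: d d' expand_def if_False)
  qed
  moreover have "\<not> odd_depth (prim2 D m) t" if "2 * k - 1 \<le> t" "t \<le> 2 * k + 3" for t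
  proof -
    have "r - (t - 1) div 2 = 0" "r - (2 * D + 1 - t) div 2 = 0" "\<not> 2 * D + 2 \<le> t"
      using that k_mid k by auto
    then show ?thesis by (simp add: d)
  qed
  moreover have "prim2 (D - 2) m \<in> Xminus (D - 2)"
    using Xminus_eq[OF D'(1)] D'(2) by blast
  ultimately show ?thesis using D3 by (simp add: contracts_def)
qed

text \<open>The left pair has the position \<open>k\<close> whichever insertion comes first; the position of the right one is
  \<open>l - 2\<close> as long as the left one is absent.\<close>

lemma I_map_commute:
  assumes "k + 2 \<le> l"
  shows "I_map l (I_map k B) = I_map k (I_map (l - 2) B)"
proof -
  have "iota l (iota k i) = iota k (iota (l - 2) i)" for i
    using assms by (auto simp: iota_def)
  moreover have "iota l k = k" "iota l (k + 1) = k + 1" "iota k (l - 2) = l" "iota k (l - 2 + 1) = l + 1"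
    using assms by (auto simp: iota_def)
  ultimately show ?thesis
    unfolding I_map_def by (auto simp: image_Un image_image insert_commute)
qed

text \<open>Compare \<open>k\<close> with the place \<open>l\<close> of the last insertion. If the pairs \<open>{k, k + 1}\<close> and \<open>{l, l + 1}\<close> are
  disjoint, contraction commutes with the insertion. If they overlap without being equal, then the third
  situation is present, with one of the two arcs the inserted one, and joining simply undoes the insertion.\<close>

lemma contraction:
  assumes "odd D" "B \<in> Xminus D"
  shows "\<forall>k \<in> {1..D}. odd_depth B (2 * k) = odd_depth B (2 * k + 2) \<longrightarrow> 3 \<le> D \<and> (\<exists>B'. contracts D k B B')"
  using assms
proof (induction rule: Xminus_induct)
  case (prim1 D m)
  then show ?case using contraction_prim1 by blast
next
  case (prim2 D m)
  then show ?case using contraction_prim2 by blast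
next
  case (insertion D l B)
  have PN: "B \<in> PN (D + 2)" using Xminus_PN insertion by blast
  have l: "1 \<le> l" "l \<le> D + 2" using insertion by auto
  note d = odd_depth_I_map[OF PN l(1)]
  have D1: "1 \<le> D" using insertion(1) by (auto elim: oddE)
  have "\<exists>B'. contracts (D + 2) k (I_map l B) B'"
    if k: "k \<in> {1..D + 2}" and eq: "odd_depth (I_map l B) (2 * k) = odd_depth (I_map l B) (2 * k + 2)" for k
  proof -
    have k1: "1 \<le> k" "k \<le> D + 2" using k by auto
    consider "l = k" | "l = k + 1" | "k = l + 1" | "k + 2 \<le> l" | "l + 2 \<le> k" by linarith
    then show ?thesis
    proof cases
      case 1
      have "odd_depth B s = odd_depth (I_map l B) (expand k s)" for s
        unfolding d using 1 k1 by (auto simp: expand_def collapse_def)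
      moreover have "odd_depth (I_map l B) (2 * k - 1) = odd_depth (I_map l B) (2 * k + 3)"
        unfolding d using 1 k1 by (auto simp: collapse_def)
      ultimately have "contracts (D + 2) k (I_map l B) B"
        using insertion(3) 1 by (simp add: contracts_def)
      then show ?thesis ..
    next
      case 2
      have c: "collapse l (2 * k - 1) = 2 * k - 1" "collapse l (2 * k) = 2 * k" "collapse l (2 * k + 2) = 2 * k + 1"
          "collapse l (2 * k + 3) = 2 * k + 1" "collapse l (2 * k + 4) = 2 * k + 1"
        using 2 k1 by (auto simp: collapse_def)
      \<comment> \<open>The inserted pair has the parity of \<open>k\<close>, so an arc of \<open>B\<close> ends at \<open>k\<close>.\<close>
      have r: "odd_depth B (2 * k) \<noteq> odd_depth B (2 * k + 1)"
        using eq unfolding d c using 2 by auto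
      then have lft: "odd_depth B (2 * k - 1) = odd_depth B (2 * k)"
        using odd_depth_point[OF PN k1(1)] by blast
      have "odd_depth B s = odd_depth (I_map l B) (expand k s)" for s
      proof -
        consider "s < 2 * k" | "s = 2 * k" | "2 * k < s" by linarith
        then show ?thesis
        proof cases
          case 1
          then show ?thesis unfolding d using 2 k1 by (auto simp: collapse_def expand_def)
        next
          case s: 2
          have e: "expand k s = 2 * k + 4" using s by (simp add: expand_def)
          show ?thesis unfolding d e c using 2 r s by auto
        next
          case 3
          then show ?thesis unfolding d using 2 k1 by (auto simp: collapse_def expand_def)
        qed
      qed
      moreover have "odd_depth (I_map l B) (2 * k - 1) = odd_depth (I_map l B) (2 * k + 3)"
        "odd_depth (I_map l B) (2 * k - 1) = odd_depth (I_map l B) (2 * k)"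
        unfolding d c using 2 k1 r lft by auto
      ultimately have "contracts (D + 2) k (I_map l B) B"
        using insertion(3) by (simp add: contracts_def)
      then show ?thesis ..
    next
      case 3
      have c: "collapse l (2 * k) = 2 * l - 1" "collapse l (2 * k + 2) = 2 * l" "collapse l (2 * k - 1) = 2 * l - 1"
          "collapse l (2 * k + 3) = 2 * l + 1" "collapse l (2 * l) = 2 * l - 1"
        using 3 l by (auto simp: collapse_def)
      \<comment> \<open>The inserted pair has the parity of the point behind it, so an arc of \<open>B\<close> begins there.\<close>
      have r: "odd_depth B (2 * l - 1) \<noteq> odd_depth B (2 * l)"
        using eq unfolding d c using 3 by auto
      then have rgt: "odd_depth B (2 * l) = odd_depth B (2 * l + 1)"
        using odd_depth_point[OF PN l(1)] by blast
      have "odd_depth B s = odd_depth (I_map l B) (expand k s)" for s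
      proof -
        consider "s < 2 * l" | "s = 2 * l" | "s = 2 * l + 1" | "2 * l + 1 < s" by linarith
        then show ?thesis
        proof cases
          case 1
          then show ?thesis unfolding d using 3 l by (auto simp: collapse_def expand_def)
        next
          case s: 2
          have e: "expand k s = 2 * l" using s 3 by (simp add: expand_def)
          show ?thesis unfolding d e c using 3 r s by auto
        next
          case s: 3
          have e: "expand k s = 2 * l + 1" "collapse l (2 * l + 1) = 2 * l - 1"
            using s 3 l by (auto simp: expand_def collapse_def)
          show ?thesis unfolding d e using 3 r rgt s by auto
        next
          case 4
          then show ?thesis unfolding d using 3 l by (auto simp: collapse_def expand_def)
        qed
      qed
      moreover have "odd_depth (I_map l B) (2 * k - 1) = odd_depth (I_map l B) (2 * k + 3)"
        "odd_depth (I_map l B) (2 * k - 1) = odd_depth (I_map l B) (2 * k)"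
        unfolding d c using 3 l r rgt by auto
      ultimately have "contracts (D + 2) k (I_map l B) B"
        using insertion(3) by (simp add: contracts_def)
      then show ?thesis ..
    next
      case 4
      have c: "collapse l (2 * k) = 2 * k" "collapse l (2 * k + 2) = 2 * k + 2" "collapse l (2 * k - 1) = 2 * k - 1"
          "collapse l (2 * k + 3) = 2 * k + 3"
        using 4 l by (auto simp: collapse_def)
      have out: "\<not> (2 * l \<le> 2 * k \<and> 2 * k \<le> 2 * l + 2)" "\<not> (2 * l \<le> 2 * k + 2 \<and> 2 * k + 2 \<le> 2 * l + 2)"
          "\<not> (2 * l \<le> 2 * k - 1 \<and> 2 * k - 1 \<le> 2 * l + 2)" "\<not> (2 * l \<le> 2 * k + 3 \<and> 2 * k + 3 \<le> 2 * l + 2)"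
        using 4 by auto
      have "k \<in> {1..D}" "odd_depth B (2 * k) = odd_depth B (2 * k + 2)"
        using 4 l k1 eq unfolding d c using out by auto
      then obtain B0 where D3: "3 \<le> D" and B0: "contracts D k B B0"
        using insertion.IH by blast
      then have B0': "B0 \<in> Xminus (D - 2)" "\<And>s. odd_depth B0 s = odd_depth B (expand k s)"
          "odd_depth B (2 * k - 1) = odd_depth B (2 * k + 3)" "B = I_map k B0 \<or> odd_depth B (2 * k - 1) = odd_depth B (2 * k)"
        by (auto simp: contracts_def)
      have D2: "odd (D - 2)" "D - 2 + 2 = D" using D3 insertion(1) by auto
      have PN0: "B0 \<in> PN D" using Xminus_PN[OF D2(1) B0'(1)] D2(2) by simp
      have l2: "1 \<le> l - 2" "l - 2 \<le> D" using 4 l k1 by auto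
      note d0 = odd_depth_I_map[OF PN0 l2(1)]
      have "odd_depth (I_map (l - 2) B0) s = odd_depth (I_map l B) (expand k s)" for s
      proof -
        have "odd_depth B (expand k (collapse (l - 2) s)) = odd_depth B (collapse l (expand k s))"
        \<comment> \<open>If the pairs are neighbours, the insertion at \<open>l\<close> takes place in a gap that contraction merges with the
          gap before \<open>k\<close>; these two gaps have the same parity.\<close>
        proof (cases "s \<in> {2 * l - 4..2 * l - 1} \<and> l = k + 2")
          case True
          then have "expand k (collapse (l - 2) s) = 2 * k - 1" "collapse l (expand k s) = 2 * k + 3"
            using k1 by (auto simp: expand_def collapse_def)
          then show ?thesis using B0'(3) by simp
        next
          case False
          then have "expand k (collapse (l - 2) s) = collapse l (expand k s)"
            using 4 k1 by (auto simp: expand_def collapse_def)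
          then show ?thesis by simp
        qed
        moreover have "(2 * (l - 2) \<le> s \<and> s \<le> 2 * (l - 2) + 2) = (2 * l \<le> expand k s \<and> expand k s \<le> 2 * l + 2)"
          using 4 k1 by (auto simp: expand_def)
        ultimately show ?thesis unfolding d d0 B0'(2) by simp
      qed
      moreover have "I_map (l - 2) B0 \<in> Xminus D"
        using B0'(1) l2 D3 unfolding Xminus_eq[OF insertion(1)] by auto
      moreover have "odd_depth (I_map l B) (2 * k - 1) = odd_depth (I_map l B) (2 * k + 3)"
        unfolding d c using B0'(3) out by simp
      moreover have "I_map l B = I_map k (I_map (l - 2) B0) \<or>
          odd_depth (I_map l B) (2 * k - 1) = odd_depth (I_map l B) (2 * k)"
        using B0'(4) I_map_commute[OF 4] unfolding d c using out by auto
      ultimately have "contracts (D + 2) k (I_map l B) (I_map (l - 2) B0)"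
        by (simp add: contracts_def)
      then show ?thesis ..
    next
      case 5
      define j where "j = k - 2"
      have c: "collapse l (2 * k) = 2 * j" "collapse l (2 * k + 2) = 2 * j + 2" "collapse l (2 * k - 1) = 2 * j - 1"
          "collapse l (2 * k + 3) = 2 * j + 3"
        using 5 l by (auto simp: collapse_def j_def)
      have out: "\<not> (2 * l \<le> 2 * k \<and> 2 * k \<le> 2 * l + 2)" "\<not> (2 * l \<le> 2 * k + 2 \<and> 2 * k + 2 \<le> 2 * l + 2)"
          "\<not> (2 * l \<le> 2 * k - 1 \<and> 2 * k - 1 \<le> 2 * l + 2)" "\<not> (2 * l \<le> 2 * k + 3 \<and> 2 * k + 3 \<le> 2 * l + 2)"
        using 5 by auto
      have j: "j \<in> {1..D}" "l \<le> j" "k = j + 2" using 5 l k1 by (auto simp: j_def)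
      have "odd_depth B (2 * j) = odd_depth B (2 * j + 2)"
        using eq unfolding d c using out by auto
      then obtain B0 where D3: "3 \<le> D" and B0: "contracts D j B B0"
        using insertion.IH j(1) by blast
      then have B0': "B0 \<in> Xminus (D - 2)" "\<And>s. odd_depth B0 s = odd_depth B (expand j s)"
          "odd_depth B (2 * j - 1) = odd_depth B (2 * j + 3)" "B = I_map j B0 \<or> odd_depth B (2 * j - 1) = odd_depth B (2 * j)"
        by (auto simp: contracts_def)
      have D2: "odd (D - 2)" "D - 2 + 2 = D" using D3 insertion(1) by auto
      have PN0: "B0 \<in> PN D" using Xminus_PN[OF D2(1) B0'(1)] D2(2) by simp
      note d0 = odd_depth_I_map[OF PN0 l(1)]
      have "odd_depth (I_map l B0) s = odd_depth (I_map l B) (expand k s)" for s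
      proof -
        have "expand j (collapse l s) = collapse l (expand k s)"
          using j l by (auto simp: expand_def collapse_def)
        moreover have "(2 * l \<le> s \<and> s \<le> 2 * l + 2) = (2 * l \<le> expand k s \<and> expand k s \<le> 2 * l + 2)"
          using j by (auto simp: expand_def)
        ultimately show ?thesis unfolding d d0 B0'(2) by simp
      qed
      moreover have "I_map l B0 \<in> Xminus D"
        using B0'(1) j l D3 unfolding Xminus_eq[OF insertion(1)] by auto
      moreover have "odd_depth (I_map l B) (2 * k - 1) = odd_depth (I_map l B) (2 * k + 3)"
        unfolding d c using B0'(3) out by simp
      moreover have "I_map l B = I_map k (I_map l B0) \<or>
          odd_depth (I_map l B) (2 * k - 1) = odd_depth (I_map l B) (2 * k)"
      proof -
        have "I_map k (I_map l B0) = I_map l (I_map j B0)"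
          using I_map_commute[OF 5] by (simp add: j_def)
        then show ?thesis using B0'(4) unfolding d c using out by auto
      qed
      ultimately have "contracts (D + 2) k (I_map l B) (I_map l B0)"
        by (simp add: contracts_def)
      then show ?thesis ..
    qed
  qed
  then show ?case using D1 by simp
qed

text \<open>Two nests of the same kind differ at an end of the outermost arc of the longer one, where the depths are
  1 and 0; nests of different kinds differ at the point 1, whose depths are \<open>2 * m - 1\<close> and \<open>2 * n\<close>.\<close>

lemma prim_separated:
  assumes D: "odd D"
  shows "\<lbrakk>1 \<le> m; m < m'; 2 * m' \<le> (D + 3) div 2\<rbrakk> \<Longrightarrow> \<exists>i\<in>{1..D + 2}. odd_depth (prim1 D m) (2 * i) \<noteq> odd_depth (prim1 D m') (2 * i)"
    and "\<lbrakk>m < m'; 2 * m' \<le> (D - 1) div 2\<rbrakk> \<Longrightarrow> \<exists>i\<in>{1..D + 2}. odd_depth (prim2 D m) (2 * i) \<noteq> odd_depth (prim2 D m') (2 * i)"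
    and "\<lbrakk>1 \<le> m; 2 * m \<le> (D + 3) div 2; 2 * n \<le> (D - 1) div 2\<rbrakk> \<Longrightarrow> \<exists>i\<in>{1..D + 2}. odd_depth (prim1 D m) (2 * i) \<noteq> odd_depth (prim2 D n) (2 * i)"
proof -
  assume m: "1 \<le> m" "m < m'" "2 * m' \<le> (D + 3) div 2"
  then have m': "1 \<le> m'" "2 * m \<le> (D + 3) div 2" by auto
  define i where "i = 2 * m' - 1"
  have i: "(2 * i - 1) div 2 = 2 * m' - 2" "(2 * D + 5 - 2 * i) div 2 = D + 3 - 2 * m'"
    "2 * m' - 1 - (2 * m' - 2) = 1" "2 * m' - 1 - (D + 3 - 2 * m') = 0" "2 * m - 1 - (D + 3 - 2 * m') = 0"
    "2 * m - 1 - (2 * m' - 2) = 0"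
    using m by (auto simp: i_def)
  have "odd_depth (prim1 D m') (2 * i)" "\<not> odd_depth (prim1 D m) (2 * i)"
    unfolding odd_depth_prim1[OF D m'(1) m(3)] odd_depth_prim1[OF D m(1) m'(2)] i by simp_all
  moreover have "i \<in> {1..D + 2}" using m by (auto simp: i_def)
  ultimately show "\<exists>i\<in>{1..D + 2}. odd_depth (prim1 D m) (2 * i) \<noteq> odd_depth (prim1 D m') (2 * i)" by blast
next
  assume m: "m < m'" "2 * m' \<le> (D - 1) div 2"
  then have m': "2 * m \<le> (D - 1) div 2" by auto
  define i where "i = 2 * m'"
  have i: "(2 * i - 1) div 2 = 2 * m' - 1" "(2 * D + 1 - 2 * i) div 2 = D - 2 * m'"
    "2 * m' - (2 * m' - 1) = 1" "2 * m' - (D - 2 * m') = 0" "2 * m - (D - 2 * m') = 0"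
    "2 * m - (2 * m' - 1) = 0" "(2 * D + 2 \<le> 2 * i \<and> 2 * i \<le> 2 * D + 4) = False"
    using m by (auto simp: i_def)
  have "odd_depth (prim2 D m') (2 * i)" "\<not> odd_depth (prim2 D m) (2 * i)"
    unfolding odd_depth_prim2[OF D m(2)] odd_depth_prim2[OF D m'] i by simp_all
  moreover have "i \<in> {1..D + 2}" using m by (auto simp: i_def)
  ultimately show "\<exists>i\<in>{1..D + 2}. odd_depth (prim2 D m) (2 * i) \<noteq> odd_depth (prim2 D m') (2 * i)" by blast
next
  assume m: "1 \<le> m" "2 * m \<le> (D + 3) div 2" and n: "2 * n \<le> (D - 1) div 2"
  have D1: "1 \<le> D" using D by (auto elim: oddE)
  have i: "(2 * 1 - 1) div 2 = (0::nat)" "(2 * D + 5 - 2 * 1) div 2 = D + 1" "(2 * D + 1 - 2 * 1) div 2 = D - 1"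
    "2 * m - 1 - (D + 1) = 0" "2 * n - (D - 1) = 0"
    "(2 * D + 2 \<le> 2 * 1 \<and> 2 * 1 \<le> 2 * D + 4) = False"
    using m n D1 by auto
  have "odd_depth (prim1 D m) (2 * 1)" "\<not> odd_depth (prim2 D n) (2 * 1)"
    unfolding odd_depth_prim1[OF D m] odd_depth_prim2[OF D n] i using m(1) by simp_all
  then show "\<exists>i\<in>{1..D + 2}. odd_depth (prim1 D m) (2 * i) \<noteq> odd_depth (prim2 D n) (2 * i)"
    by (intro bexI[of _ 1]) auto
qed

text \<open>If one of the two members is \<open>I_map k C\<close>, then the other one contracts at \<open>k\<close> to a member with the
  point depths of \<open>C\<close>, which is \<open>C\<close> by induction; the gap before \<open>k\<close> has the parity that an insertion
  of \<open>{k, k + 1}\<close> leaves there.\<close>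

lemma odd_depth_injective:
  assumes "odd D" "A1 \<in> Xminus D" "A2 \<in> Xminus D"
    and "\<And>i. i \<in> {1..D + 2} \<Longrightarrow> odd_depth A1 (2 * i) = odd_depth A2 (2 * i)"
  shows "A1 = A2"
  using assms
proof (induction D arbitrary: A1 A2 rule: less_induct)
  case (less D)
  note D = \<open>odd D\<close>
  have inserted: "A1 = A2"
    if D3: "3 \<le> D" and k: "k \<in> {1..D}" and C: "C \<in> Xminus (D - 2)" "A1 = I_map k C"
      and A2: "A2 \<in> Xminus D" and eq: "\<And>i. i \<in> {1..D + 2} \<Longrightarrow> odd_depth A1 (2 * i) = odd_depth A2 (2 * i)"
    for k C A1 A2
  proof -
    have D2: "odd (D - 2)" "D - 2 + 2 = D" "D - 2 < D" using D3 D by auto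
    have PN: "C \<in> PN D" using Xminus_PN[OF D2(1) C(1)] D2(2) by simp
    have k1: "1 \<le> k" "k \<le> D" using k by auto
    note d = odd_depth_I_map[OF PN k1(1), folded C(2)]
    have at_k: "odd_depth A1 (2 * k) \<longleftrightarrow> \<not> odd_depth C (2 * k - 1)" "odd_depth A1 (2 * k + 2) \<longleftrightarrow> \<not> odd_depth C (2 * k - 1)"
      by (simp_all add: d collapse_def)
    have "odd_depth A2 (2 * k) = odd_depth A1 (2 * k)" "odd_depth A2 (2 * k + 2) = odd_depth A1 (2 * k + 2)"
      using eq[of k] eq[of "k + 1"] k1 by simp_all
    with at_k have "odd_depth A2 (2 * k) = odd_depth A2 (2 * k + 2)" by simp
    then obtain C' where C': "contracts D k A2 C'"
      using contraction[OF D A2] k by blast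
    have depth: "odd_depth C' s = odd_depth A2 (expand k s)" for s
      using C' by (simp add: contracts_def)
    have "odd_depth C (2 * i) = odd_depth C' (2 * i)" if i: "i \<in> {1..D - 2 + 2}" for i
    proof -
      have e: "expand k (2 * i) = 2 * iota k i" by (auto simp: expand_def iota_def)
      have "iota k i \<in> {1..D + 2}" using i D2(2) by (auto simp: iota_def)
      then have "odd_depth C' (2 * i) = odd_depth A1 (2 * iota k i)"
        unfolding depth e using eq by simp
      also have "\<dots> = odd_depth C (2 * i)"
        unfolding d using k1 by (auto simp: collapse_def iota_def)
      finally show ?thesis ..
    qed
    then have "C = C'"
      using less.IH[OF D2(3,1) C(1)] C' by (simp add: contracts_def)
    have "odd_depth A2 (2 * k - 1) = odd_depth C (2 * k - 1)"
      using depth[of "2 * k - 1"] k1 \<open>C = C'\<close> by (simp add: expand_def)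
    then have "odd_depth A2 (2 * k - 1) \<noteq> odd_depth A2 (2 * k)"
      using at_k(1) \<open>odd_depth A2 (2 * k) = odd_depth A1 (2 * k)\<close> by simp
    then have "A2 = I_map k C'" using C' by (simp add: contracts_def)
    then show ?thesis using C(2) \<open>C = C'\<close> by simp
  qed
  have cases: "(\<exists>m. 1 \<le> m \<and> 2 * m \<le> (D + 3) div 2 \<and> B = prim1 D m) \<or>
      (\<exists>m. 2 * m \<le> (D - 1) div 2 \<and> B = prim2 D m) \<or>
      3 \<le> D \<and> (\<exists>k\<in>{1..D}. \<exists>C\<in>Xminus (D - 2). B = I_map k C)" if "B \<in> Xminus D" for B
    using that unfolding Xminus_eq[OF D] by (auto split: if_splits)
  note eq = less.prems(4)
  show ?case
  proof (cases "3 \<le> D \<and> ((\<exists>k\<in>{1..D}. \<exists>C\<in>Xminus (D - 2). A1 = I_map k C) \<or> (\<exists>k\<in>{1..D}. \<exists>C\<in>Xminus (D - 2). A2 = I_map k C))")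
    case True
    then show ?thesis
      using inserted[OF _ _ _ _ less.prems(3) eq] inserted[OF _ _ _ _ less.prems(2) eq[symmetric]]
      by metis
  next
    case False
    have eq': "\<not> (\<exists>i\<in>{1..D + 2}. odd_depth A1 (2 * i) \<noteq> odd_depth A2 (2 * i))"
        "\<not> (\<exists>i\<in>{1..D + 2}. odd_depth A2 (2 * i) \<noteq> odd_depth A1 (2 * i))"
      using eq by blast+
    consider m where "1 \<le> m" "2 * m \<le> (D + 3) div 2" "A1 = prim1 D m" | m where "2 * m \<le> (D - 1) div 2" "A1 = prim2 D m"
      using cases[OF less.prems(2)] False by blast
    then show ?thesis
    proof cases
      case 1
      consider n where "1 \<le> n" "2 * n \<le> (D + 3) div 2" "A2 = prim1 D n" | n where "2 * n \<le> (D - 1) div 2" "A2 = prim2 D n"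
        using cases[OF less.prems(3)] False by blast
      then show ?thesis
      proof cases
        case n: 1
        show ?thesis
          using prim_separated(1)[OF D, of m n] prim_separated(1)[OF D, of n m] 1 n eq'
          by (metis linorder_neqE_nat)
      next
        case n: 2
        then show ?thesis using prim_separated(3)[OF D 1(1,2) n(1)] 1 eq' by blast
      qed
    next
      case 2
      consider n where "1 \<le> n" "2 * n \<le> (D + 3) div 2" "A2 = prim1 D n" | n where "2 * n \<le> (D - 1) div 2" "A2 = prim2 D n"
        using cases[OF less.prems(3)] False by blast
      then show ?thesis
      proof cases
        case n: 1
        then show ?thesis using prim_separated(3)[OF D n(1,2) 2(1)] 2 eq' by blast
      next
        case n: 2
        show ?thesis
          using prim_separated(2)[OF D, of m n] prim_separated(2)[OF D, of n m] 2 n eq'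
          by (metis linorder_neqE_nat)
      qed
    qed
  qed
qed

lemma odd_depth_top:
  assumes "odd D" "B \<in> Xminus D"
  shows "odd_depth B (2 * (D + 2))"
  using assms
proof (induction rule: Xminus_induct)
  case (prim1 D m)
  have "2 * m - 1 - (2 * (D + 2) - 1) div 2 = 0" "(2 * D + 5 - 2 * (D + 2)) div 2 = 0"
    using prim1 by auto
  then show ?case unfolding odd_depth_prim1[OF prim1] using prim1(2) by simp
next
  case (prim2 D m)
  have "2 * m - (2 * (D + 2) - 1) div 2 = 0" "(2 * D + 1 - 2 * (D + 2)) div 2 = 0"
    using prim2 by auto
  then show ?case unfolding odd_depth_prim2[OF prim2] by simp
next
  case (insertion D k B)
  have "collapse k (2 * (D + 2 + 2)) = 2 * (D + 2)" "\<not> 2 * (D + 2 + 2) \<le> 2 * k + 2" "1 \<le> k"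
    using insertion(2) by (auto simp: collapse_def)
  then show ?case
    using odd_depth_I_map[OF Xminus_PN[OF insertion(1,3)], of k] insertion(4) by simp
qed

section \<open>The map \<open>\<epsilon>\<close>\<close>

lemma floor_set_carrier:
  assumes B: "B \<in> PN N" and N: "odd N" and p: "(i, j) \<in> oriented B"
  shows "floor_set N i j \<in> carrier (EN N)"
    and "x \<in> {1..N} \<Longrightarrow> x \<in> floor_set N i j \<longleftrightarrow> covers (2 * x) (i, j)"
proof -
  have ij: "i \<in> {1..N}" "j \<in> {1..N}" "std i j"
    using p PN_subset[OF B, of "{i, j}"] by (auto simp: oriented_def)
  show "x \<in> {1..N} \<Longrightarrow> x \<in> floor_set N i j \<longleftrightarrow> covers (2 * x) (i, j)"
    using ij by (auto simp: floor_set_def covers_def)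
  show "floor_set N i j \<in> carrier (EN N)"
  proof (cases "i < j")
    case True
    then show ?thesis using ij by (auto simp: floor_set_def EN_simps std_def Suc_diff_le)
  next
    case False
    then have "j < i" "even (i - j)" using ij(3) by (auto simp: std_def)
    have "card ({i..N} \<union> {1..j}) = card {i..N} + card {1..j}"
      by (rule card_Un_disjoint) (use \<open>j < i\<close> in auto)
    also have "\<dots> = Suc N - (i - j)" using \<open>j < i\<close> ij by auto
    finally have "even (card ({i..N} \<union> {1..j}))"
      using N \<open>even (i - j)\<close> ij \<open>j < i\<close> by simp
    then show ?thesis using False ij by (auto simp: floor_set_def EN_simps)
  qed
qed

lemma mem_eps:
  assumes D: "odd D" and B: "B \<in> PN (D + 2)" and x: "x \<in> {1..D + 2}"
  shows "x \<in> eps D B \<longleftrightarrow> odd_depth B (2 * x) \<noteq> (x \<in> under (D + 2) B)"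
proof -
  have N: "odd (D + 2)" "N_of D = D + 2" using D by (auto simp: N_of_def)
  have "{p \<in> oriented B. x \<in> floor_set (D + 2) (fst p) (snd p)} = {p \<in> oriented B. covers (2 * x) p}"
    using floor_set_carrier(2)[OF B N(1) _ x] by auto
  moreover have "x \<in> (\<Oplus>\<^bsub>EN (D + 2)\<^esub> p \<in> oriented B. floor_set (D + 2) (fst p) (snd p))
      \<longleftrightarrow> odd (card {p \<in> oriented B. x \<in> floor_set (D + 2) (fst p) (snd p)})"
    using floor_set_carrier(1)[OF B N(1)] finite_oriented[OF B] by (intro mem_finsum_EN) auto
  ultimately show ?thesis
    unfolding eps_def Let_def N(2) EN_simps odd_depth_def by auto
qed

lemma eps_Xminus:
  assumes D: "odd D" and B: "B \<in> Xminus D"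
  shows "eps D B \<in> Eminus D" and "eps D B = {x \<in> {1..D + 2}. odd_depth B (2 * x)}"
proof -
  note PN = Xminus_PN[OF D B]
  have N: "odd (D + 2)" "N_of D = D + 2" using D by (auto simp: N_of_def)
  have under: "under (D + 2) B = {}" using B by (simp add: under_def Xminus_def)
  have "eps D B \<in> carrier (EN (D + 2))"
    unfolding eps_def Let_def N(2) under
    using finsum_EN_closed[of "oriented B" "\<lambda>p. floor_set (D + 2) (fst p) (snd p)" "D + 2"]
      floor_set_carrier(1)[OF PN N(1)]
    by (auto simp: EN_simps)
  moreover have mem: "x \<in> eps D B \<longleftrightarrow> odd_depth B (2 * x)" if "x \<in> {1..D + 2}" for x
    using mem_eps[OF D PN that] unfolding under by simp
  ultimately show "eps D B = {x \<in> {1..D + 2}. odd_depth B (2 * x)}"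
    by (auto simp: EN_simps)
  show "eps D B \<in> Eminus D"
    using \<open>eps D B \<in> carrier (EN (D + 2))\<close> mem[of "D + 2"] odd_depth_top[OF D B]
    by (simp add: Eminus_def N(2))
qed

lemma inj_on_eps_Xminus:
  assumes D: "odd D"
  shows "inj_on (eps D) (Xminus D)"
proof (rule inj_onI)
  fix A1 A2 assume B: "A1 \<in> Xminus D" "A2 \<in> Xminus D" "eps D A1 = eps D A2"
  have "odd_depth A1 (2 * i) = odd_depth A2 (2 * i)" if "i \<in> {1..D + 2}" for i
    using B(3) that unfolding eps_Xminus(2)[OF D B(1)] eps_Xminus(2)[OF D B(2)] by blast
  then show "A1 = A2" by (rule odd_depth_injective[OF D B(1,2)])
qed

section \<open>The members of \<open>X\<^sub>D\<close> that avoid \<open>N\<close>\<close>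

definition matched :: "nat set set \<Rightarrow> nat set \<Rightarrow> bool" where
  "matched B S \<longleftrightarrow> S \<subseteq> supp B \<and> (\<forall>P\<in>B. P \<inter> S \<noteq> {} \<longrightarrow> P \<subseteq> S)"

text \<open>An invariant of insertion, strong enough to decide whether \<open>N\<close> lies in the correction term. Open
  intervals are used because an inserted pair lies wholly inside or wholly outside the image of an open
  interval; \<open>u\<close> is the point to be removed from \<open>[i\<^sub>2\<^sub>s + 1, N - 1]\<close>. For an even last end the correction term
  is \<open>{N} \<union> [1, u]\<close>, which contains \<open>N\<close> whatever \<open>u\<close> is.\<close>

definition tame :: "nat \<Rightarrow> nat set set \<Rightarrow> bool" where
  "tame N B \<longleftrightarrow>
    (\<forall>a b. {a, b} \<in> B \<and> a < b \<and> odd (b - a) \<longrightarrow> matched B {a<..<b}) \<and>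
    (B0 B = {} \<or> (\<exists>xs. nested_seq (B0 B) xs \<and> odd (length xs div 2) \<and>
      (odd (last xs) \<longrightarrow> (\<exists>u. last xs < u \<and> u < N \<and> u \<notin> supp B \<and>
         matched B {last xs<..<u} \<and> matched B {u<..<N}))))"

lemma iota_less_iff [simp]: "iota k a < iota k b \<longleftrightarrow> a < b"
  by (auto simp: iota_def)

lemma iota_parity: "a < b \<Longrightarrow> odd (iota k b - iota k a) \<longleftrightarrow> odd (b - a)"
  by (auto simp: iota_def)

lemma iota_cases: "x = k \<or> x = k + 1 \<or> (\<exists>y. x = iota k y)"
proof -
  consider "x < k" | "x = k" | "x = k + 1" | "k + 2 \<le> x" by linarith
  then show ?thesis
  proof cases
    case 1
    then have "x = iota k x" by (simp add: iota_def)
    then show ?thesis by blast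
  next
    case 4
    then have "\<not> x - 2 < k" "x - 2 + 2 = x" by auto
    then have "x = iota k (x - 2)" by (simp only: iota_def if_False)
    then show ?thesis by blast
  qed auto
qed

lemma iota_neq [simp]: "iota k a \<noteq> k" "iota k a \<noteq> k + 1" "iota k a \<noteq> Suc k"
  by (auto simp: iota_def)

lemma matched_I_map:
  assumes "matched B {x<..<y}"
  shows "matched (I_map k B) {iota k x<..<iota k y}"
  unfolding matched_def
proof (intro conjI ballI impI)
  show "{iota k x<..<iota k y} \<subseteq> supp (I_map k B)"
  proof
    fix z assume z: "z \<in> {iota k x<..<iota k y}"
    consider "z = k \<or> z = k + 1" | w where "z = iota k w" using iota_cases[of z k] by blast
    then show "z \<in> supp (I_map k B)"
    proof cases
      case 2
      then have "w \<in> supp B" using z assms by (auto simp: matched_def)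
      then show ?thesis using 2 by (simp add: supp_I_map)
    qed (auto simp: supp_I_map)
  qed
  fix P assume P: "P \<in> I_map k B" "P \<inter> {iota k x<..<iota k y} \<noteq> {}"
  show "P \<subseteq> {iota k x<..<iota k y}"
  proof (cases "P = {k, k + 1}")
    case True
    have "iota k x \<noteq> k" "iota k y \<noteq> k + 1" by simp_all
    moreover from True P(2) have "iota k x < k \<and> k < iota k y \<or> iota k x < k + 1 \<and> k + 1 < iota k y"
      by auto
    ultimately have "iota k x < k" "k + 1 < iota k y" by linarith+
    then show ?thesis using True by auto
  next
    case False
    then obtain Q where Q: "Q \<in> B" "P = iota k ` Q" using P(1) by (auto simp: I_map_def)
    then have "Q \<inter> {x<..<y} \<noteq> {}" using P(2) by auto
    then have "Q \<subseteq> {x<..<y}" using Q(1) assms by (auto simp: matched_def)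
    then show ?thesis using Q(2) by auto
  qed
qed

lemma B0_I_map:
  assumes B: "B \<in> PN N"
  shows "B0 (I_map k B) = (`) (iota k) ` B0 B"
proof (intro equalityI subsetI)
  fix P assume "P \<in> B0 (I_map k B)"
  then obtain i j where P: "P \<in> I_map k B" "P = {i, j}" "j < i" "even (i - j)" by (auto simp: B0_def)
  have "P \<noteq> {k, k + 1}"
  proof
    assume "P = {k, k + 1}"
    then have "i = k + 1" "j = k" using P(2,3) by (auto simp: doubleton_eq_iff)
    then show False using P(4) by simp
  qed
  then obtain Q where Q: "Q \<in> B" "P = iota k ` Q" using P(1) by (auto simp: I_map_def)
  then obtain a b where ab: "a \<in> Q" "b \<in> Q" "i = iota k a" "j = iota k b" using P(2) by blast
  have "iota k ` Q = iota k ` {a, b}" using Q(2) P(2) ab by simp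
  then have "Q = {a, b}" by (metis inj_image_eq_iff inj_iota)
  moreover have "b < a" "even (a - b)" using P(3,4) ab iota_parity[of b a k] by auto
  ultimately have "Q \<in> B0 B" using Q(1) by (auto simp: B0_def)
  then show "P \<in> (`) (iota k) ` B0 B" using Q(2) by blast
next
  fix P assume "P \<in> (`) (iota k) ` B0 B"
  then obtain i j where ij: "{i, j} \<in> B" "j < i" "even (i - j)" "P = iota k ` {i, j}" by (auto simp: B0_def)
  have "P \<in> I_map k B" unfolding I_map_def using ij(1,4) by blast
  moreover have "iota k j < iota k i" "even (iota k i - iota k j)" "P = {iota k i, iota k j}"
    using ij iota_parity[of j i k] by auto
  ultimately show "P \<in> B0 (I_map k B)" unfolding B0_def by blast
qed

lemma nested_seq_map_iota:
  assumes "nested_seq C xs"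
  shows "nested_seq ((`) (iota k) ` C) (map (iota k) xs)"
proof -
  obtain s where s: "1 \<le> s" "length xs = 2 * s" "C = {{xs ! (2 * s - 1 - r), xs ! r} | r. r < s}"
    and sorted: "sorted_wrt (<) xs"
    using assms by (auto simp: nested_seq_def)
  have "(`) (iota k) ` C = {{map (iota k) xs ! (2 * s - 1 - r), map (iota k) xs ! r} | r. r < s}"
    unfolding s(3) using s(2) by (auto simp: image_iff) (metis (no_types, lifting) image_empty image_insert | force)+
  moreover have "sorted_wrt (<) (map (iota k) xs)"
    using sorted by (simp add: sorted_wrt_map)
  ultimately show ?thesis
    unfolding nested_seq_def using s(1,2) by (intro conjI exI[of _ s]) auto
qed

lemma tame_I_map:
  assumes B: "B \<in> PN N" and k: "k \<in> {1..N}" and tame: "tame N B"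
  shows "tame (N + 2) (I_map k B)"
  unfolding tame_def
proof (intro conjI allI impI)
  fix a b assume ab: "{a, b} \<in> I_map k B \<and> a < b \<and> odd (b - a)"
  show "matched (I_map k B) {a<..<b}"
  proof (cases "{a, b} = {k, k + 1}")
    case True
    then have "a = k" "b = k + 1" using ab by (auto simp: doubleton_eq_iff)
    then have "{a<..<b} = {}" by auto
    then show ?thesis by (simp add: matched_def)
  next
    case False
    then obtain Q where Q: "Q \<in> B" "{a, b} = iota k ` Q" using ab by (auto simp: I_map_def)
    then have "a \<in> iota k ` Q" "b \<in> iota k ` Q" by blast+
    then obtain c d where cd: "a = iota k c" "b = iota k d" by blast
    have "iota k ` Q = iota k ` {c, d}" using Q(2) cd by simp
    then have "Q = {c, d}" by (metis inj_image_eq_iff inj_iota)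
    moreover have "c < d" using ab cd by simp
    ultimately have "matched B {c<..<d}"
      using tame Q(1) ab cd iota_parity[of c d k] by (auto simp: tame_def)
    then show ?thesis unfolding cd by (rule matched_I_map)
  qed
next
  show "B0 (I_map k B) = {} \<or> (\<exists>xs. nested_seq (B0 (I_map k B)) xs \<and> odd (length xs div 2) \<and>
      (odd (last xs) \<longrightarrow> (\<exists>u. last xs < u \<and> u < N + 2 \<and> u \<notin> supp (I_map k B) \<and>
         matched (I_map k B) {last xs<..<u} \<and> matched (I_map k B) {u<..<N + 2})))"
  proof (cases "B0 B = {}")
    case True
    then show ?thesis by (simp add: B0_I_map[OF B])
  next
    case False
    then obtain xs where xs: "nested_seq (B0 B) xs" "odd (length xs div 2)"
      and u: "odd (last xs) \<Longrightarrow> \<exists>u. last xs < u \<and> u < N \<and> u \<notin> supp B \<and>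
         matched B {last xs<..<u} \<and> matched B {u<..<N}"
      using tame by (auto simp: tame_def)
    have last: "last (map (iota k) xs) = iota k (last xs)"
      using xs(2) by (intro last_map) auto
    have "\<exists>u. last (map (iota k) xs) < u \<and> u < N + 2 \<and> u \<notin> supp (I_map k B) \<and>
         matched (I_map k B) {last (map (iota k) xs)<..<u} \<and> matched (I_map k B) {u<..<N + 2}"
      if "odd (last (map (iota k) xs))"
    proof -
      have "odd (last xs)" using that unfolding last by (auto simp: iota_def split: if_splits)
      then obtain u where u: "last xs < u" "u < N" "u \<notin> supp B" "matched B {last xs<..<u}" "matched B {u<..<N}"
        using u by blast
      have top: "iota k N = N + 2" using k by (simp add: iota_def)
      have "iota k u \<notin> supp (I_map k B)"
        using u(3) inj_iota[of k] by (auto simp: supp_I_map dest: injD)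
      moreover have "iota k u < N + 2" using u(2) top iota_less_iff by metis
      ultimately show ?thesis
        using u(1) matched_I_map[OF u(4), of k] matched_I_map[OF u(5), of k]
        unfolding last top by (intro exI[of _ "iota k u"]) simp
    qed
    then show ?thesis
      using nested_seq_map_iota[OF xs(1), of k] xs(2) unfolding B0_I_map[OF B]
      by (intro disjI2 exI[of _ "map (iota k) xs"]) simp
  qed
qed

lemma nested_seq_nest:
  assumes "1 \<le> a" "a \<le> b" "2 * b < c"
  shows "\<exists>xs. nested_seq (nest c a b) xs \<and> length xs = 2 * (b + 1 - a) \<and> last xs = c - a"
proof -
  let ?xs = "[a..<b + 1] @ [c - b..<c - a + 1]"
  define s where "s = b + 1 - a"
  have "c - a + 1 - (c - b) = s" using assms by (simp add: s_def)
  then have len: "length ?xs = 2 * s" by (simp only: length_append length_upt s_def[symmetric])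
  have nth: "?xs ! r = a + r" "?xs ! (2 * s - 1 - r) = c - (a + r)" if "r < s" for r
  proof -
    have len1: "length [a..<b + 1] = s" by (simp only: length_upt s_def)
    have "?xs ! r = [a..<b + 1] ! r" using that by (simp only: nth_append len1 if_True)
    also have "\<dots> = a + r" by (rule nth_upt) (use that assms in \<open>simp add: s_def\<close>)
    finally show "?xs ! r = a + r" .
    have "\<not> 2 * s - 1 - r < s" using that by simp
    then have "?xs ! (2 * s - 1 - r) = [c - b..<c - a + 1] ! (2 * s - 1 - r - s)"
      by (simp only: nth_append len1 if_False)
    also have "\<dots> = c - b + (2 * s - 1 - r - s)"
      by (rule nth_upt) (use that assms in \<open>simp add: s_def\<close>)
    also have "\<dots> = c - (a + r)" using that assms by (simp add: s_def)
    finally show "?xs ! (2 * s - 1 - r) = c - (a + r)" .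
  qed
  have "nest c a b = {{?xs ! (2 * s - 1 - r), ?xs ! r} | r. r < s}"
  proof (intro equalityI subsetI)
    fix P assume "P \<in> nest c a b"
    then obtain q where q: "a \<le> q" "q \<le> b" "P = {c - q, q}" by (auto simp: nest_def)
    then have "q - a < s" "a + (q - a) = q" by (auto simp: s_def)
    then have "P = {?xs ! (2 * s - 1 - (q - a)), ?xs ! (q - a)}" using nth[of "q - a"] q by simp
    then show "P \<in> {{?xs ! (2 * s - 1 - r), ?xs ! r} | r. r < s}" using \<open>q - a < s\<close> by blast
  next
    fix P assume "P \<in> {{?xs ! (2 * s - 1 - r), ?xs ! r} | r. r < s}"
    then obtain r where r: "r < s" "P = {?xs ! (2 * s - 1 - r), ?xs ! r}" by blast
    have "P = {c - (a + r), a + r}" unfolding r(2) nth[OF r(1)] ..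
    moreover have "a + r \<in> {a..b}" using r(1) assms(2) unfolding s_def by auto
    ultimately show "P \<in> nest c a b" unfolding nest_def by blast
  qed
  moreover have "sorted_wrt (<) ?xs" using assms by (auto simp: sorted_wrt_append)
  moreover have "1 \<le> s" using assms by (simp add: s_def)
  ultimately have "nested_seq (nest c a b) ?xs" unfolding nested_seq_def using len by blast
  moreover have "last ?xs = c - a" using assms by simp
  ultimately show ?thesis using len unfolding s_def by blast
qed

lemma nest_even:
  assumes "even c" "2 * b < c"
  shows "B0 (nest c a b) = nest c a b" and "\<lbrakk>{i, j} \<in> nest c a b; i < j\<rbrakk> \<Longrightarrow> even (j - i)"
proof -
  have diff: "r < c - r" "even (c - r - r)" if "r \<in> {a..b}" for r
    using that assms by auto
  then show "B0 (nest c a b) = nest c a b"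
    unfolding B0_def nest_def by blast
  assume "{i, j} \<in> nest c a b" "i < j"
  then obtain r where r: "r \<in> {a..b}" "{i, j} = {c - r, r}" by (auto simp: nest_def)
  then have "i = r \<and> j = c - r"
    using diff(1)[OF r(1)] \<open>i < j\<close> by (auto simp: doubleton_eq_iff)
  then show "even (j - i)" using diff(2)[OF r(1)] by simp
qed

lemma tame_Pr:
  assumes D: "odd D" and B: "B \<in> Pr D" "D + 2 \<notin> supp B"
  shows "tame (D + 2) B"
proof -
  have "nest (D + 3) 1 (t - 1) \<noteq> B" if "t \<in> {2..(D + 3) div 2}" for t
  proof -
    have "D + 2 \<in> supp (nest (D + 3) 1 (t - 1))"
      unfolding supp_nest using that by (auto intro!: image_eqI[of _ _ 1])
    then show ?thesis using B(2) by blast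
  qed
  moreover have "B \<noteq> {{D + 1, D + 2}}" "B \<noteq> {{D + 1, D + 2}} \<union> C" for C
    using B(2) by (auto simp: supp_def)
  ultimately consider "B = {}"
    | t where "even t" "t \<in> {2..(D + 1) div 2}" "B = nest (D + 3) 2 t"
    | t where "even t" "t \<in> {2..(D + 1) div 2}" "B = nest (D + 1) 1 (t - 1)"
    using B(1) unfolding Pr_def by blast
  then show ?thesis
  proof cases
    case 1
    then show ?thesis by (simp add: tame_def B0_def)
  next
    case (2 t)
    have c: "even (D + 3)" "2 * t < D + 3" "2 \<le> t" using D 2 by auto
    have "2 * t < D + 3 \<Longrightarrow> \<exists>xs. nested_seq B xs \<and> length xs = 2 * (t + 1 - 2) \<and> last xs = D + 3 - 2"
      unfolding 2(3) using c(3) by (intro nested_seq_nest) auto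
    then obtain xs where xs: "nested_seq B xs" "length xs = 2 * (t + 1 - 2)" "last xs = D + 3 - 2"
      using c(2) by blast
    have "odd (length xs div 2)" "\<not> odd (last xs)" using xs(2,3) 2(1,2) D by auto
    then have "\<exists>xs. nested_seq (B0 B) xs \<and> odd (length xs div 2) \<and> \<not> odd (last xs)"
      using xs(1) unfolding 2(3) nest_even(1)[OF c(1,2)] by blast
    then show ?thesis
      unfolding tame_def using nest_even(2)[OF c(1,2)] 2(3) by blast
  next
    case (3 t)
    have c: "even (D + 1)" "2 * (t - 1) < D + 1" "2 \<le> t" using D 3 by auto
    have "2 * (t - 1) < D + 1 \<Longrightarrow> \<exists>xs. nested_seq B xs \<and> length xs = 2 * (t - 1 + 1 - 1) \<and> last xs = D + 1 - 1"
      unfolding 3(3) using c(3) by (intro nested_seq_nest) auto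
    then obtain xs where xs: "nested_seq B xs" "length xs = 2 * (t - 1 + 1 - 1)" "last xs = D + 1 - 1"
      using c(2) by blast
    have seq: "nested_seq (B0 B) xs" using xs(1) unfolding 3(3) nest_even(1)[OF c(1,2)] .
    have "odd (length xs div 2)" "last xs = D" using xs(2,3) 3(1,2) by auto
    moreover have "D + 1 \<notin> supp B"
      unfolding 3(3) supp_nest using c by auto
    moreover have "{D<..<D + 1} = {}" "{D + 1<..<D + 2} = {}" by auto
    then have "matched B {D<..<D + 1}" "matched B {D + 1<..<D + 2}" by (auto simp: matched_def)
    ultimately have "\<exists>u. last xs < u \<and> u < D + 2 \<and> u \<notin> supp B \<and>
        matched B {last xs<..<u} \<and> matched B {u<..<D + 2}"
      by (intro exI[of _ "D + 1"]) simp
    then have "\<exists>xs. nested_seq (B0 B) xs \<and> odd (length xs div 2) \<and>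
        (\<exists>u. last xs < u \<and> u < D + 2 \<and> u \<notin> supp B \<and> matched B {last xs<..<u} \<and> matched B {u<..<D + 2})"
      using seq \<open>odd (length xs div 2)\<close> by blast
    then show ?thesis
      unfolding tame_def using nest_even(2)[OF c(1,2)] 3(3) by blast
  qed
qed

lemma tame_XD:
  assumes "odd D" "B \<in> XD D" "D + 2 \<notin> supp B"
  shows "tame (D + 2) B"
  using assms
proof (induction D arbitrary: B rule: less_induct)
  case (less D)
  note D = \<open>odd D\<close>
  show ?case
  proof (cases "B \<in> Pr D")
    case True
    then show ?thesis using tame_Pr[OF D] less.prems(3) by blast
  next
    case False
    show ?thesis
    proof (cases "3 \<le> D")
      case D3: True
      then obtain k C where k: "k \<in> {1..D}" and C: "C \<in> XD (D - 2)" "B = I_map k C"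
        using less.prems(2) False XD_step[OF D3] by blast
      have D2: "odd (D - 2)" "D - 2 + 2 = D" "D - 2 < D" using D3 D by auto
      have PN: "C \<in> PN D" using XD_PN[OF D2(1)] C(1) D2(1,2) by (auto simp: N_of_def)
      have "D \<notin> supp C" using less.prems(3) I_map_top[OF k] C(2) by simp
      then have "tame D C" using less.IH[OF D2(3,1) C(1)] D2(2) by simp
      then show ?thesis using tame_I_map[OF PN k] C(2) by simp
    next
      case D3: False
      then have "D = 1" using D by (auto elim!: oddE)
      then have B: "B = {{1, 2}}" using less.prems(2) False by simp
      have B0: "B0 B = {}"
        unfolding B B0_def by (auto simp: doubleton_eq_iff)
      have "{a<..<b} = {}" if "{a, b} \<in> B" "a < b" for a b :: nat
        using that unfolding B by (auto simp: doubleton_eq_iff)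
      then show ?thesis unfolding tame_def using B0 by (auto simp: matched_def)
    qed
  qed
qed

text \<open>The partner of the leftmost point cuts off a first tile, and what lies behind it is again matched.\<close>

lemma matched_interval_tiling:
  assumes B: "B \<in> PN N"
    and odd_pairs: "\<forall>a b. {a, b} \<in> B \<and> a < b \<and> odd (b - a) \<longrightarrow> matched B {a<..<b}"
    and "matched B {x<..<y}" "\<forall>P \<in> B0 B. P \<inter> {x<..<y} = {}"
  shows "\<exists>ps. sorted_wrt (<) (concat (map (\<lambda>(a, b). [a, b]) ps)) \<and> (\<forall>(a, b) \<in> set ps. {a, b} \<in> B1 B) \<and>
    {x<..<y} = (\<Union>(a, b) \<in> set ps. {a..b}) \<and> set (concat (map (\<lambda>(a, b). [a, b]) ps)) \<subseteq> {x<..<y}"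
  using assms(3,4)
proof (induction "y - x" arbitrary: x rule: less_induct)
  case (less x)
  show ?case
  proof (cases "{x<..<y} = {}")
    case True
    then show ?thesis by (intro exI[of _ "[]"]) simp
  next
    case False
    then have x1: "x + 1 \<in> {x<..<y}" by auto
    then obtain P where P: "P \<in> B" "x + 1 \<in> P"
      using less.prems(1) by (auto simp: matched_def supp_def)
    then have sub: "P \<subseteq> {x<..<y}" using less.prems(1) x1 unfolding matched_def by blast
    have "card P = 2" using PN_subset[OF B P(1)] by simp
    then obtain b where b: "P = {x + 1, b}" "b \<noteq> x + 1"
      using P(2) by (metis card_2_iff doubleton_eq_iff insert_iff singletonD)
    have bxy: "x + 1 < b" "b < y" using sub b by auto
    have "odd (b - (x + 1))"
    proof
      assume "even (b - (x + 1))"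
      then have "P \<in> B0 B" using P(1) b bxy(1) by (auto simp: B0_def insert_commute)
      with less.prems(2) have "P \<inter> {x<..<y} = {}" by (rule bspec)
      then show False using P(2) x1 by blast
    qed
    then have B1: "{x + 1, b} \<in> B1 B" and inner: "matched B {x + 1<..<b}"
      using P(1) b bxy(1) odd_pairs by (auto simp: B1_def)
    have "matched B {b<..<y}"
      unfolding matched_def
    proof (intro conjI ballI impI)
      show "{b<..<y} \<subseteq> supp B" using less.prems(1) bxy by (auto simp: matched_def)
      fix Q assume Q: "Q \<in> B" "Q \<inter> {b<..<y} \<noteq> {}"
      moreover have "{b<..<y} \<subseteq> {x<..<y}" using bxy by auto
      ultimately have Qsub: "Q \<subseteq> {x<..<y}" using less.prems(1) unfolding matched_def by blast
      have "Q \<noteq> P" using Q(2) b bxy by auto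
      then have "Q \<inter> P = {}" using PN_disjnt[OF B Q(1) P(1)] by blast
      moreover have "Q \<inter> {x + 1<..<b} = {}"
      proof (rule ccontr)
        assume "Q \<inter> {x + 1<..<b} \<noteq> {}"
        then have "Q \<subseteq> {x + 1<..<b}" using inner Q(1) unfolding matched_def by blast
        then show False using Q(2) by auto
      qed
      ultimately show "Q \<subseteq> {b<..<y}"
      proof (intro subsetI)
        fix z assume disj: "Q \<inter> P = {}" "Q \<inter> {x + 1<..<b} = {}" and z: "z \<in> Q"
        have "z \<noteq> x + 1" "z \<noteq> b" "\<not> (x + 1 < z \<and> z < b)" "x < z" "z < y"
          using disj z b Qsub by auto
        then show "z \<in> {b<..<y}" by auto
      qed
    qed
    moreover have "y - b < y - x" using bxy by auto
    moreover have "{b<..<y} \<subseteq> {x<..<y}" using bxy by auto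
    then have "\<forall>P \<in> B0 B. P \<inter> {b<..<y} = {}" using less.prems(2) by blast
    ultimately obtain ps where ps: "sorted_wrt (<) (concat (map (\<lambda>(a, b). [a, b]) ps))"
      "\<forall>(a, b) \<in> set ps. {a, b} \<in> B1 B" "{b<..<y} = (\<Union>(a, b) \<in> set ps. {a..b})"
      "set (concat (map (\<lambda>(a, b). [a, b]) ps)) \<subseteq> {b<..<y}"
      using less.hyps[of b] by blast
    have split: "{x<..<y} = {x + 1..b} \<union> {b<..<y}" using bxy by auto
    have low: "b < z \<and> x + 1 < z" if "z \<in> set (concat (map (\<lambda>(a, b). [a, b]) ps))" for z
    proof -
      have "z \<in> {b<..<y}" using that ps(4) by blast
      then show ?thesis using bxy by simp
    qed
    show ?thesis
    proof (intro exI[of _ "(x + 1, b) # ps"] conjI)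
      show "sorted_wrt (<) (concat (map (\<lambda>(a, b). [a, b]) ((x + 1, b) # ps)))"
        using ps(1) low bxy(1) by simp
      show "\<forall>(a, b) \<in> set ((x + 1, b) # ps). {a, b} \<in> B1 B" using ps(2) B1 by simp
      show "{x<..<y} = (\<Union>(a, b) \<in> set ((x + 1, b) # ps). {a..b})"
        unfolding split ps(3) by simp
      show "set (concat (map (\<lambda>(a, b). [a, b]) ((x + 1, b) # ps))) \<subseteq> {x<..<y}"
        using ps(4) bxy unfolding split by auto
    qed
  qed
qed

lemma nested_seq_set:
  assumes "nested_seq C xs"
  shows "set xs = \<Union> C" and "sorted_wrt (<) xs" and "xs \<noteq> []"
proof -
  obtain s where s: "1 \<le> s" "length xs = 2 * s" "C = {{xs ! (2 * s - 1 - r), xs ! r} | r. r < s}"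
    and sorted: "sorted_wrt (<) xs"
    using assms by (auto simp: nested_seq_def)
  show "sorted_wrt (<) xs" "xs \<noteq> []" using s sorted by auto
  show "set xs = \<Union> C"
  proof (intro equalityI subsetI)
    fix x assume "x \<in> set xs"
    then obtain i where i: "i < 2 * s" "x = xs ! i" using s(2) by (metis in_set_conv_nth)
    show "x \<in> \<Union> C"
    proof (cases "i < s")
      case True
      then show ?thesis unfolding s(3) using i(2) by blast
    next
      case False
      then have "2 * s - 1 - i < s" "2 * s - 1 - (2 * s - 1 - i) = i" using i(1) by auto
      then have "{x, xs ! (2 * s - 1 - i)} \<in> C" unfolding s(3) i(2) by (metis (mono_tags, lifting) mem_Collect_eq)
      then show ?thesis by blast
    qed
  next
    fix x assume "x \<in> \<Union> C"
    then obtain r where "r < s" "x = xs ! (2 * s - 1 - r) \<or> x = xs ! r" unfolding s(3) by blast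
    then show "x \<in> set xs" using s(2) by auto
  qed
qed

lemma nested_seq_unique: "\<lbrakk>nested_seq C xs; nested_seq C ys\<rbrakk> \<Longrightarrow> xs = ys"
  using nested_seq_set strict_sorted_equal by metis

text \<open>The free point \<open>u\<close> of \<open>tame\<close> satisfies \<open>is_u\<close>. No other point does: the intervals of another solution
  would cover \<open>u\<close>, but every point of such an interval belongs to a pair.\<close>

lemma u_of_less:
  assumes B: "B \<in> PN N" and N: "N \<notin> supp B" and tame: "tame N B"
    and xs: "nested_seq (B0 B) xs" "odd (last xs)"
  shows "u_of N B < N"
proof -
  have "xs \<noteq> []" using nested_seq_set(3)[OF xs(1)] .
  have odd_pairs: "\<forall>a b. {a, b} \<in> B \<and> a < b \<and> odd (b - a) \<longrightarrow> matched B {a<..<b}"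
    using tame unfolding tame_def by (rule conjunct1)
  have "B0 B \<noteq> {}" using xs(1) nested_seq_set[OF xs(1)] by auto
  then obtain ys where ys: "nested_seq (B0 B) ys" "odd (last ys) \<longrightarrow> (\<exists>u. last ys < u \<and> u < N \<and> u \<notin> supp B \<and>
         matched B {last ys<..<u} \<and> matched B {u<..<N})"
    using tame by (auto simp: tame_def)
  have "ys = xs" using nested_seq_unique[OF ys(1) xs(1)] .
  then obtain u where u: "last xs < u" "u < N" "u \<notin> supp B"
      "matched B {last xs<..<u}" "matched B {u<..<N}"
    using ys(2) xs(2) by blast
  have outer: "x \<le> last xs" if "P \<in> B0 B" "x \<in> P" for P x
  proof -
    have "x \<in> set xs" using nested_seq_set(1)[OF xs(1)] that by blast
    then have "x \<in> set (butlast xs) \<or> x = last xs"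
      using \<open>xs \<noteq> []\<close> by (metis append_butlast_last_id rotate1.simps(2) set_ConsD set_rotate1)
    moreover have "sorted_wrt (<) (butlast xs @ [last xs])"
      using nested_seq_set(2)[OF xs(1)] \<open>xs \<noteq> []\<close> by simp
    ultimately show ?thesis by (auto simp: sorted_wrt_append)
  qed
  have outer': "\<forall>P \<in> B0 B. P \<inter> {x<..<y} = {}" if xy: "last xs \<le> x" for x y
    using outer xy by fastforce
  have J: "J_set N xs = {last xs<..<u} \<union> {u<..<N} \<union> {u}"
    using xs(2) u(1,2) by (auto simp: J_set_def)
  obtain ps where ps: "sorted_wrt (<) (concat (map (\<lambda>(a, b). [a, b]) ps))" "\<forall>(a, b) \<in> set ps. {a, b} \<in> B1 B"
      "{last xs<..<u} = (\<Union>(a, b) \<in> set ps. {a..b})" "set (concat (map (\<lambda>(a, b). [a, b]) ps)) \<subseteq> {last xs<..<u}"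
    using matched_interval_tiling[OF B odd_pairs u(4) outer'[OF order_refl]] by (elim exE conjE) (rule that)
  obtain qs where qs: "sorted_wrt (<) (concat (map (\<lambda>(a, b). [a, b]) qs))" "\<forall>(a, b) \<in> set qs. {a, b} \<in> B1 B"
      "{u<..<N} = (\<Union>(a, b) \<in> set qs. {a..b})" "set (concat (map (\<lambda>(a, b). [a, b]) qs)) \<subseteq> {u<..<N}"
    using matched_interval_tiling[OF B odd_pairs u(5) outer'[OF less_imp_le[OF u(1)]]]
    by (elim exE conjE) (rule that)
  have "is_u N B u"
    unfolding is_u_def
  proof (intro exI[of _ xs] exI[of _ "ps @ qs"] conjI)
    have "a < b" if a: "a \<in> set (concat (map (\<lambda>(a, b). [a, b]) ps))"
        and b: "b \<in> set (concat (map (\<lambda>(a, b). [a, b]) qs))" for a b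
      using subsetD[OF ps(4) a] subsetD[OF qs(4) b] by simp
    then show "sorted_wrt (<) (concat (map (\<lambda>(a, b). [a, b]) (ps @ qs)))"
      using ps(1) qs(1) unfolding map_append concat_append sorted_wrt_append by blast
    have union: "(\<Union>(a, b) \<in> set (ps @ qs). {a..b}) = {last xs<..<u} \<union> {u<..<N}"
      unfolding set_append UN_Un ps(3)[symmetric] qs(3)[symmetric] ..
    show "J_set N xs = (\<Union>(a, b) \<in> set (ps @ qs). {a..b}) \<union> {u}" unfolding union J ..
    show "u \<notin> (\<Union>(a, b) \<in> set (ps @ qs). {a..b})" unfolding union by simp
    show "\<forall>(a, b) \<in> set (ps @ qs). {a, b} \<in> B1 B" using ps(2) qs(2) by auto
  qed (rule xs(1))
  moreover have "v = u" if v: "is_u N B v" for v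
  proof (rule ccontr)
    assume "v \<noteq> u"
    obtain zs rs where zs: "nested_seq (B0 B) zs" and rs: "\<forall>(a, b) \<in> set rs. {a, b} \<in> B1 B"
        "J_set N zs = (\<Union>(a, b) \<in> set rs. {a..b}) \<union> {v}"
      using v unfolding is_u_def by blast
    have "zs = xs" using nested_seq_unique[OF zs xs(1)] .
    then have "u \<in> (\<Union>(a, b) \<in> set rs. {a..b})" using J rs(2) \<open>v \<noteq> u\<close> by blast
    then obtain a b where ab: "(a, b) \<in> set rs" "a \<le> u" "u \<le> b" by auto
    then have "{a, b} \<in> B1 B" using rs(1) by auto
    then obtain i j where ij: "{a, b} \<in> B" "{a, b} = {i, j}" "i < j" "odd (j - i)"
      unfolding B1_def mem_Collect_eq by (elim conjE exE) (rule that)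
    then have "a = i" "b = j" using ab by (auto simp: doubleton_eq_iff)
    then have "matched B {a<..<b}" using odd_pairs ij by simp
    moreover have "a \<noteq> u" "b \<noteq> u" using u(3) ij(1) by (auto simp: supp_def)
    ultimately have "u \<in> supp B" using ab by (auto simp: matched_def)
    then show False using u(3) by simp
  qed
  ultimately have "u_of N B = u" unfolding u_of_def by (rule the_equality)
  then show ?thesis using u(2) by simp
qed

lemma nested_seq_arcs:
  assumes C: "nested_seq (B0 B) xs"
  shows "i_of B = last xs" and "card (oriented (B0 B)) = length xs div 2"
proof -
  obtain s where s: "1 \<le> s" "length xs = 2 * s" "B0 B = {{xs ! (2 * s - 1 - r), xs ! r} | r. r < s}"
    and sorted: "sorted_wrt (<) xs"
    using C by (auto simp: nested_seq_def)
  have lt: "xs ! i < xs ! j" if "i < j" "j < 2 * s" for i j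
    using sorted_wrt_nth_less[OF sorted that(1)] that(2) s(2) by simp
  have ev: "even (xs ! (2 * s - 1 - r) - xs ! r)" if "r < s" for r
  proof -
    have "{xs ! (2 * s - 1 - r), xs ! r} \<in> B0 B" unfolding s(3) using that by blast
    then obtain i j where "{xs ! (2 * s - 1 - r), xs ! r} = {i, j}" "j < i" "even (i - j)"
      by (auto simp: B0_def)
    moreover have "xs ! r < xs ! (2 * s - 1 - r)" using lt[of r "2 * s - 1 - r"] that by simp
    ultimately show ?thesis by (auto simp: doubleton_eq_iff)
  qed
  have or: "oriented (B0 B) = (\<lambda>r. (xs ! (2 * s - 1 - r), xs ! r)) ` {..<s}"
  proof (intro equalityI subsetI)
    fix p assume "p \<in> oriented (B0 B)"
    then obtain i j where p: "p = (i, j)" "{i, j} \<in> B0 B" "std i j" by (auto simp: oriented_def)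
    then obtain r where r: "r < s" "{i, j} = {xs ! (2 * s - 1 - r), xs ! r}" unfolding s(3) by blast
    have "xs ! r < xs ! (2 * s - 1 - r)" using lt[of r "2 * s - 1 - r"] r(1) by simp
    then have "i = xs ! (2 * s - 1 - r) \<and> j = xs ! r"
      using r(2) p(3) ev[OF r(1)] by (auto simp: doubleton_eq_iff std_def)
    then show "p \<in> (\<lambda>r. (xs ! (2 * s - 1 - r), xs ! r)) ` {..<s}" using p(1) r(1) by blast
  next
    fix p assume "p \<in> (\<lambda>r. (xs ! (2 * s - 1 - r), xs ! r)) ` {..<s}"
    then obtain r where r: "r < s" "p = (xs ! (2 * s - 1 - r), xs ! r)" by blast
    have "xs ! r < xs ! (2 * s - 1 - r)" using lt[of r "2 * s - 1 - r"] r(1) by simp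
    moreover have "{xs ! (2 * s - 1 - r), xs ! r} \<in> B0 B" unfolding s(3) using r(1) by blast
    ultimately show "p \<in> oriented (B0 B)" using r(2) ev[OF r(1)] by (simp add: oriented_def std_def)
  qed
  have "inj_on (\<lambda>r. (xs ! (2 * s - 1 - r), xs ! r)) {..<s}"
  proof (rule inj_onI)
    fix q r assume "q \<in> {..<s}" "r \<in> {..<s}" "(xs ! (2 * s - 1 - q), xs ! q) = (xs ! (2 * s - 1 - r), xs ! r)"
    then show "q = r" using lt[of q r] lt[of r q] by (cases q r rule: linorder_cases) auto
  qed
  then show "card (oriented (B0 B)) = length xs div 2"
    unfolding or using s(2) by (simp add: card_image)
  have "{i. \<exists>j. (i, j) \<in> oriented (B0 B)} = (\<lambda>r. xs ! (2 * s - 1 - r)) ` {..<s}"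
    unfolding or by auto
  moreover have "Max ((\<lambda>r. xs ! (2 * s - 1 - r)) ` {..<s}) = last xs"
  proof (rule Max_eqI)
    have last: "last xs = xs ! (2 * s - 1)" using s by (subst last_conv_nth) auto
    show "last xs \<in> (\<lambda>r. xs ! (2 * s - 1 - r)) ` {..<s}"
      unfolding last using s(1) by (intro image_eqI[of _ _ 0]) auto
    fix y assume "y \<in> (\<lambda>r. xs ! (2 * s - 1 - r)) ` {..<s}"
    then obtain r where r: "r < s" "y = xs ! (2 * s - 1 - r)" by blast
    show "y \<le> last xs"
    proof (cases "r = 0")
      case True
      then show ?thesis unfolding last r(2) by simp
    next
      case False
      then have "2 * s - 1 - r < 2 * s - 1" "2 * s - 1 < 2 * s" using r(1) by auto
      then show ?thesis unfolding last r(2) by (intro less_imp_le lt)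
    qed
  qed simp
  ultimately show "i_of B = last xs" unfolding i_of_def by simp
qed

text \<open>The arcs over \<open>N\<close> are those of \<open>B\<^sup>0\<close>; if there are any, their number is odd and the correction
  term restores evenness.\<close>

lemma top_parity:
  assumes D: "odd D" and B: "B \<in> XD D" "D + 2 \<notin> supp B"
  shows "odd_depth B (2 * (D + 2)) \<longleftrightarrow> D + 2 \<in> under (D + 2) B"
proof -
  have PN: "B \<in> PN (D + 2)" using XD_PN[OF D] B(1) D by (auto simp: N_of_def)
  note tame = tame_XD[OF D B]
  have arcs: "{p \<in> oriented B. covers (2 * (D + 2)) p} = oriented (B0 B)"
  proof (intro equalityI subsetI)
    fix p assume "p \<in> {p \<in> oriented B. covers (2 * (D + 2)) p}"
    then obtain i j where p: "p = (i, j)" "{i, j} \<in> B" "std i j" "covers (2 * (D + 2)) (i, j)"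
      by (auto simp: oriented_def)
    have "i \<le> D + 2" "j \<le> D + 2" using PN_subset[OF PN p(2)] by auto
    moreover have "j \<noteq> D + 2" using B(2) p(2) by (auto simp: supp_def)
    ultimately have "\<not> i < j" using p(4) by (auto simp: covers_def)
    then have "j < i" "even (i - j)" using p(3) by (auto simp: std_def)
    then show "p \<in> oriented (B0 B)" using p by (auto simp: oriented_def B0_def)
  next
    fix p assume "p \<in> oriented (B0 B)"
    then obtain i j where p: "p = (i, j)" "{i, j} \<in> B0 B" "std i j" by (auto simp: oriented_def)
    then obtain a b where ab: "{i, j} \<in> B" "{i, j} = {a, b}" "b < a" "even (a - b)" by (auto simp: B0_def)
    have "j < i" using ab(2,3,4) p(3) by (auto simp: doubleton_eq_iff std_def)
    moreover have "i \<le> D + 2" using PN_subset[OF PN ab(1)] by auto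
    ultimately show "p \<in> {p \<in> oriented B. covers (2 * (D + 2)) p}"
      using p ab(1) by (auto simp: oriented_def covers_def)
  qed
  show ?thesis
  proof (cases "B0 B = {}")
    case True
    then have "oriented (B0 B) = {}" by (simp add: oriented_def)
    then have "\<not> odd_depth B (2 * (D + 2))" unfolding odd_depth_def arcs by simp
    moreover have "under (D + 2) B = {}" using True by (simp add: under_def)
    ultimately show ?thesis by simp
  next
    case False
    then obtain xs where xs: "nested_seq (B0 B) xs" "odd (length xs div 2)"
      using tame by (auto simp: tame_def)
    have "odd_depth B (2 * (D + 2))"
      unfolding odd_depth_def arcs nested_seq_arcs(2)[OF xs(1)] using xs(2) .
    moreover have "D + 2 \<in> under (D + 2) B"
      using False B(2) u_of_less[OF PN B(2) tame xs(1)]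
      by (auto simp: under_def nested_seq_arcs(1)[OF xs(1)])
    ultimately show ?thesis by simp
  qed
qed

section \<open>The basis\<close>

lemma finite_Xminus:
  assumes "odd D"
  shows "finite (Xminus D)"
proof (rule finite_subset)
  show "Xminus D \<subseteq> Pow (Pow {1..D + 2})"
    using Xminus_PN[OF assms] by (auto simp: PN_def two_subsets_def)
qed simp

lemma eps_inverse:
  assumes D: "odd D" and B: "B \<in> Xminus D"
  shows "the_inv_into (XD D) (eps D) (eps D B) = B"
  unfolding the_inv_into_def
proof (rule the_equality)
  show "B \<in> XD D \<and> eps D B = eps D B" using B by (simp add: Xminus_def)
  fix C assume C: "C \<in> XD D \<and> eps D C = eps D B"
  have "D + 2 \<in> eps D C"
    using C eps_Xminus(1)[OF D B] Eminus_eq[OF D] by auto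
  have "D + 2 \<in> supp C"
  proof (rule ccontr)
    assume no: "D + 2 \<notin> supp C"
    have "C \<in> PN (D + 2)" using XD_PN[OF D] C D by (auto simp: N_of_def)
    then show False
      using mem_eps[OF D, of C "D + 2"] top_parity[OF D _ no] C \<open>D + 2 \<in> eps D C\<close> by simp
  qed
  then have "C \<in> Xminus D" using C by (simp add: Xminus_def)
  then show "C = B" using inj_on_eps_Xminus[OF D] B C by (auto dest: inj_onD)
qed

lemma Mcolumn_eps:
  assumes D: "odd D" and B: "B \<in> Xminus D"
  shows "Mcolumn D (eps D B) = column (D + 2) B"
proof -
  note PN = Xminus_PN[OF D B]
  have N: "N_of D = D + 2" using D by (simp add: N_of_def)
  have "Mcolumn D (eps D B) = (\<Sum>X\<in>Eminus D. if X \<in> unions B then frag_of X else 0)"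
    unfolding Mcolumn_def Mminus_def bracket_def eps_inverse[OF D B] N span_EN_eq_unions[OF PN]
    by (rule sum.cong) auto
  also have "\<dots> = (\<Sum>X | X \<in> Eminus D \<and> X \<in> unions B. frag_of X)"
    using finite_Eminus by (simp add: sum.If_cases Int_def)
  also have "{X. X \<in> Eminus D \<and> X \<in> unions B} = {X. X \<in> unions B \<and> D + 2 \<in> X}"
    using unions_carrier[OF PN] by (auto simp: Eminus_def N)
  finally show ?thesis by (simp add: column_def)
qed

theorem mainTheorem2:
  fixes D :: nat
  assumes "odd D"
  shows "inj_on (Mcolumn D) (Eminus D) \<and>
         frag.independent (Mcolumn D ` Eminus D) \<and>
         frag.span (Mcolumn D ` Eminus D) = carrier (free_Abelian_group (Eminus D))"
proof -
  note D = assms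
  have fin: "finite (Xminus D)" "finite (Eminus D)" using finite_Xminus[OF D] finite_Eminus by auto
  have sub: "eps D ` Xminus D \<subseteq> Eminus D" using eps_Xminus(1)[OF D] by blast
  have card: "card (Xminus D) \<le> card (Eminus D)"
    using card_inj_on_le[OF inj_on_eps_Xminus[OF D] sub fin(2)] .
  note basis = spanning_family_is_basis[OF fin card columns_span[OF D]]
  have onto: "eps D ` Xminus D = Eminus D"
    using card_subset_eq[OF fin(2) sub] card_image[OF inj_on_eps_Xminus[OF D]] basis(1) by simp
  have image: "Mcolumn D ` Eminus D = column (D + 2) ` Xminus D"
    unfolding onto[symmetric] image_image using Mcolumn_eps[OF D] by (rule image_cong[OF refl])
  have inj: "inj_on (Mcolumn D) (Eminus D)"
  proof (rule inj_onI)
    fix X Y assume XY: "X \<in> Eminus D" "Y \<in> Eminus D" "Mcolumn D X = Mcolumn D Y"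
    obtain B C where BC: "B \<in> Xminus D" "X = eps D B" "C \<in> Xminus D" "Y = eps D C"
      using XY(1,2) unfolding onto[symmetric] by blast
    have "column (D + 2) B = column (D + 2) C"
      using XY(3) Mcolumn_eps[OF D BC(1)] Mcolumn_eps[OF D BC(3)] unfolding BC(2,4) by simp
    then show "X = Y" using inj_onD[OF basis(2) _ BC(1,3)] BC(2,4) by simp
  qed
  have carrier: "carrier (free_Abelian_group (Eminus D)) = {c. Poly_Mapping.keys c \<subseteq> Eminus D}"
    by auto
  have "frag.span (Mcolumn D ` Eminus D) = {c. Poly_Mapping.keys c \<subseteq> Eminus D}"
  proof
    show "frag.span (Mcolumn D ` Eminus D) \<subseteq> {c. Poly_Mapping.keys c \<subseteq> Eminus D}"
    proof (rule frag.span_minimal)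
      have "Poly_Mapping.keys (Mcolumn D Y) \<subseteq> Eminus D" for Y
        unfolding Mcolumn_def
      proof (rule order_trans[OF keys_sum], rule UN_least)
        fix X assume "X \<in> Eminus D"
        then show "Poly_Mapping.keys (frag_cmul (Mminus D X Y) (frag_of X)) \<subseteq> Eminus D"
          using keys_cmul[of "Mminus D X Y" "frag_of X"] by auto
      qed
      then show "Mcolumn D ` Eminus D \<subseteq> {c. Poly_Mapping.keys c \<subseteq> Eminus D}" by blast
      show "frag.subspace {c. Poly_Mapping.keys c \<subseteq> Eminus D}"
        by (auto simp: frag.subspace_def dest!: subsetD[OF Poly_Mapping.keys_add] subsetD[OF keys_cmul])
    qed
    show "{c. Poly_Mapping.keys c \<subseteq> Eminus D} \<subseteq> frag.span (Mcolumn D ` Eminus D)"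
    proof
      fix c :: "nat set \<Rightarrow>\<^sub>0 int" assume "c \<in> {c. Poly_Mapping.keys c \<subseteq> Eminus D}"
      then have "c = (\<Sum>X\<in>Eminus D. frag_cmul (Poly_Mapping.lookup c X) (frag_of X))"
        using frag_keys_expansion[OF fin(2)] by blast
      also have "\<dots> \<in> frag.span (Mcolumn D ` Eminus D)"
        unfolding image using columns_span[OF D] by (intro frag.span_sum frag.span_scale) blast
      finally show "c \<in> frag.span (Mcolumn D ` Eminus D)" .
    qed
  qed
  then show ?thesis using inj basis(3) unfolding image carrier by blast
qed

end
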